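(* Let $d\ge1$ and let $(\mathbf X,Y)$ be jointly Gaussian, with $Y\sim\mathcal N(0,1)$ and $\mathbf X\sim\mathcal N(\mathbf 0,\Sigma_{\mathbf X})$ a $d$-dimensional column vector, where $\Sigma_{\mathbf X}$ is a known invertible matrix with all-ones diagonal. Let $\boldsymbol\rho=\mathbb E\,Y\mathbf X^T=[\rho_1,\dots,\rho_d]$. Let $\hat{\boldsymbol\rho}=Y_{\mathbf J}\hat{\mathbf W}_{\mathbf J}^{-1}\Sigma_{\mathbf X}^{1/2}$ be the stopping-set estimator using $k$ expected bits, and let $\hat{\boldsymbol\rho}_{\mathrm{scl}}$ be the scalar (max or threshold) estimator applied separately to each of the $d$ correlations using $k$ expected bits in total, both defined in the context. Then $\hat{\boldsymbol\rho}$ dominates $\hat{\boldsymbol\rho}_{\mathrm{scl}}$: for all values of $\boldsymbol\rho$ and every allocation of the bits among the $d$ correlations, $$\limsup_{k\to\infty}\,k\,\mathbb E\|\hat{\boldsymbol\rho}-\boldsymbol\rho\|^2\ \le\ \lim_{k\to\infty}\,k\,\mathbb E\|\hat{\boldsymbol\rho}_{\mathrm{scl}}-\boldsymbol\rho\|^2 .$$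
   Context: Notation: $Q(x)=\int_x^\infty \frac1{\sqrt{2\pi}}e^{-u^2/2}du$; $h(p)=-p\log_2p-(1-p)\log_2(1-p)$, $h_g(p)=h(p)/p$ for $p\in(0,1)$ (entropy of a geometric variable), with inverse $h_g^{-1}$ on $(0,\infty)$. The cost of describing a geometric index is taken to be its entropy. $(\mathbf X_i,Y_i)_{i\ge1}$ are i.i.d. copies of $(\mathbf X,Y)$. Scalar estimator: fix weights $w_1,\dots,w_d>0$ with $\sum_\ell w_\ell=1$ (e.g. $w_\ell=1/d$) and use $k_\ell=w_\ell k$ bits for $\rho_\ell$, on disjoint sets of samples for different $\ell$. For each $\ell$, $\hat\rho_\ell=Y_J/\mathbb E(\mathbf X_J)_\ell$, where $J$ is either $\min\{i:(\mathbf X_i)_\ell>t_\ell\}$ with $t_\ell=Q^{-1}(h_g^{-1}(k_\ell))$ (threshold method), or the index of the maximum of $(\mathbf X_i)_\ell$ among $2^{k_\ell}$ samples (max method; integrality neglected). $\hat{\boldsymbol\rho}_{\mathrm{scl}}=[\hat\rho_1,\dots,\hat\rho_d]$. Stopping-set estimator: $\mathbf W_i=\Sigma_{\mathbf X}^{-1/2}\mathbf X_i$. For $a,b>0$, $A_\ell^w=\{\mathbf w\in\mathbb R^d:|w_\ell|>a,\ |w_j|<b\ \forall j\ne\ell\}$; $J_0^w=0$, $J_\ell^w=\min\{i>J_{\ell-1}^w:\mathbf W_i\in A_\ell^w\}$; $\mathbf W_{\mathbf J}=[\mathbf W_{J_1^w},\dots,\mathbf W_{J_d^w}]$ (columns),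 $Y_{\mathbf J}=[Y_{J_1^w},\dots,Y_{J_d^w}]$ (row). $\hat{\mathbf W}_{\mathbf J}$ is obtained entrywise from $\mathbf W_{\mathbf J}$ with $k_q$ bits per entry: diagonal entries are truncated to absolute value at most $c=\sqrt3\,a$ ($w$ with $|w|>c$ is mapped to $\operatorname{sign}(w)c$) and $[-c,-a]\cup[a,c]$ is divided into $2^{k_q}$ intervals of equal length, each value being represented by a fixed point of its interval; off-diagonal entries lie in $[-b,b]$, which is divided into $2^{k_q}$ intervals of equal length, each value being represented by a fixed point of its interval. Parameters: $k_l=\frac1d(\sqrt{k+1}-1)^2$, $k_q=\sqrt{4k_l/d^3}$, $b=b_0$ for a fixed constant $b_0>0$ (small), $a=Q^{-1}\!\left(\frac{h_g^{-1}(k_l)}{2(1-2Q(b_0))^{d-1}}\right)$ (defined for large $k$), so that $k_l=h_g(2Q(a)(1-2Q(b))^{d-1})$ and $d\,k_l+d^2k_q=k$. Rounding is neglected; for definiteness $k$ ranges over the positive reals for which $k_q$ is a positive integer. "Dominates" means: performs at least as well, in total mean squared error, uniformly for all possible values of the correlations; the comparison is at the level of the leading $1/k$ coefficient. *)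

theory Defs
  imports "HOL-Probability.Probability"
begin

section \<open>Gaussian vectors and i.i.d. copies\<close>

text \<open>The case \<open>\<sigma> = 0\<close> is a point mass: jointly Gaussian vectors may be degenerate
  (here \<open>Y\<close> may be a linear function of \<open>X\<close>).\<close>

definition gaussian_rv :: "'a measure \<Rightarrow> real \<Rightarrow> real \<Rightarrow> ('a \<Rightarrow> real) \<Rightarrow> bool" where
  "gaussian_rv M \<mu> \<sigma> Z \<longleftrightarrow> Z \<in> borel_measurable M \<and>
     ((\<sigma> = 0 \<and> (AE \<omega> in M. Z \<omega> = \<mu>)) \<or>
      (\<sigma> > 0 \<and> distributed M lborel Z (normal_density \<mu> \<sigma>)))"

definition jointly_gaussian :: "'a measure \<Rightarrow> ('a \<Rightarrow> 'b::euclidean_space) \<Rightarrow> bool" where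
  "jointly_gaussian M V \<longleftrightarrow> V \<in> borel_measurable M \<and>
     (\<forall>u. \<exists>\<mu> \<sigma>. gaussian_rv M \<mu> \<sigma> (\<lambda>\<omega>. u \<bullet> V \<omega>))"

definition normal_vector :: "'a measure \<Rightarrow> real ^ 'd \<Rightarrow> real ^ 'd ^ 'd \<Rightarrow> ('a \<Rightarrow> real ^ 'd) \<Rightarrow> bool" where
  "normal_vector M m \<Sigma> X \<longleftrightarrow> jointly_gaussian M X \<and>
     (\<forall>i. (\<integral>\<omega>. X \<omega> $ i \<partial>M) = m $ i) \<and>
     (\<forall>i j. (\<integral>\<omega>. (X \<omega> $ i - m $ i) * (X \<omega> $ j - m $ j) \<partial>M) = \<Sigma> $ i $ j)"

text \<open>Samples are numbered from 1.\<close>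

definition iid_copies :: "'a measure \<Rightarrow> ('a \<Rightarrow> 'b::topological_space) \<Rightarrow> (nat \<Rightarrow> 'a \<Rightarrow> 'b) \<Rightarrow> bool" where
  "iid_copies M V Vs \<longleftrightarrow> prob_space.indep_vars M (\<lambda>_. borel) Vs {1..} \<and>
     (\<forall>i\<ge>1. distr M borel (Vs i) = distr M borel V)"

text \<open>Total mean squared error, as a nonnegative integral so that it is \<open>\<infinity>\<close> rather
  than 0 when the squared error is not integrable.\<close>

definition mse :: "'a measure \<Rightarrow> ('a \<Rightarrow> real ^ 'd) \<Rightarrow> real ^ 'd \<Rightarrow> ennreal" where
  "mse M est \<rho> = (\<integral>\<^sup>+\<omega>. ennreal ((norm (est \<omega> - \<rho>))\<^sup>2) \<partial>M)"

section \<open>Special functions and the symmetric square root\<close>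

definition Qfun :: "real \<Rightarrow> real" where
  "Qfun x = (LBINT u:{x..}. std_normal_density u)"

definition Qinv :: "real \<Rightarrow> real" where
  "Qinv = the_inv_into UNIV Qfun"

definition bin_entropy :: "real \<Rightarrow> real" where
  "bin_entropy p = - p * log 2 p - (1 - p) * log 2 (1 - p)"

definition geom_entropy :: "real \<Rightarrow> real" where
  "geom_entropy p = bin_entropy p / p"

definition geom_entropy_inv :: "real \<Rightarrow> real" where
  "geom_entropy_inv = the_inv_into {0<..<1} geom_entropy"

text \<open>The unique positive semidefinite symmetric square root.\<close>

definition sqrt_mat :: "real ^ 'd ^ 'd \<Rightarrow> real ^ 'd ^ 'd" where
  "sqrt_mat A = (THE S. transpose S = S \<and> (\<forall>v. 0 \<le> v \<bullet> (S *v v)) \<and> S ** S = A)"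

section \<open>The scalar estimator\<close>

datatype scalar_method = Threshold | Maximum

text \<open>Positions (from 0) within a sequence of real samples. Ties in the maximum have
  probability 0; the first maximiser is taken.\<close>

definition threshold_index :: "real \<Rightarrow> (nat \<Rightarrow> real) \<Rightarrow> nat" where
  "threshold_index t x = (LEAST j. x j > t)"

definition max_index :: "nat \<Rightarrow> (nat \<Rightarrow> real) \<Rightarrow> nat" where
  "max_index N x = (LEAST j. j < N \<and> (\<forall>i<N. x i \<le> x j))"

text \<open>With \<open>\<kappa>\<close> bits. Since \<open>2 powr \<kappa>\<close> need not be an integer, the maximum method uses
  the largest number of samples whose index can be described with \<open>\<kappa>\<close> bits.\<close>

definition scalar_index :: "scalar_method \<Rightarrow> real \<Rightarrow> (nat \<Rightarrow> real) \<Rightarrow> nat" where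
  "scalar_index meth \<kappa> x = (case meth of
      Threshold \<Rightarrow> threshold_index (Qinv (geom_entropy_inv \<kappa>)) x
    | Maximum \<Rightarrow> max_index (nat \<lfloor>2 powr \<kappa>\<rfloor>) x)"

text \<open>\<open>s l j\<close> is the number of the \<open>j\<close>-th sample reserved for the \<open>l\<close>-th correlation.\<close>

definition disjoint_samples :: "('d \<Rightarrow> nat \<Rightarrow> nat) \<Rightarrow> bool" where
  "disjoint_samples s \<longleftrightarrow> (\<forall>l. strict_mono (s l) \<and> range (s l) \<subseteq> {1..}) \<and>
     disjoint_family (\<lambda>l. range (s l))"

definition scalar_sample ::
  "('d \<Rightarrow> scalar_method) \<Rightarrow> ('d \<Rightarrow> real) \<Rightarrow> ('d \<Rightarrow> nat \<Rightarrow> nat) \<Rightarrow> (nat \<Rightarrow> 'a \<Rightarrow> real ^ 'd)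
    \<Rightarrow> real \<Rightarrow> 'd \<Rightarrow> 'a \<Rightarrow> nat" where
  "scalar_sample meth wt s Xs k l \<omega> =
     s l (scalar_index (meth l) (wt l * k) (\<lambda>j. Xs (s l j) \<omega> $ l))"

definition scalar_estimator ::
  "'a measure \<Rightarrow> ('d \<Rightarrow> scalar_method) \<Rightarrow> ('d \<Rightarrow> real) \<Rightarrow> ('d \<Rightarrow> nat \<Rightarrow> nat)
    \<Rightarrow> (nat \<Rightarrow> 'a \<Rightarrow> real ^ 'd) \<Rightarrow> (nat \<Rightarrow> 'a \<Rightarrow> real) \<Rightarrow> real \<Rightarrow> 'a \<Rightarrow> real ^ 'd" where
  "scalar_estimator M meth wt s Xs Ys k \<omega> = (\<chi> l.
     let J = scalar_sample meth wt s Xs k l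
     in Ys (J \<omega>) \<omega> / (\<integral>\<omega>'. Xs (J \<omega>') \<omega>' $ l \<partial>M))"

section \<open>The stopping-set estimator\<close>

definition stop_set :: "real \<Rightarrow> real \<Rightarrow> 'd \<Rightarrow> (real ^ 'd) set" where
  "stop_set a b l = {w. \<bar>w $ l\<bar> > a \<and> (\<forall>j. j \<noteq> l \<longrightarrow> \<bar>w $ j\<bar> < b)}"

text \<open>The function \<open>e\<close> numbers the coordinates: \<open>e 1, \<dots>, e d\<close>.\<close>

fun stop_index :: "(nat \<Rightarrow> 'd) \<Rightarrow> real \<Rightarrow> real \<Rightarrow> (nat \<Rightarrow> real ^ 'd) \<Rightarrow> nat \<Rightarrow> nat" where
  "stop_index e a b w 0 = 0"
| "stop_index e a b w (Suc n) =
     (LEAST i. i > stop_index e a b w n \<and> w i \<in> stop_set a b (e (Suc n)))"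

definition column_index ::
  "(nat \<Rightarrow> 'd::finite) \<Rightarrow> real \<Rightarrow> real \<Rightarrow> (nat \<Rightarrow> real ^ 'd) \<Rightarrow> 'd \<Rightarrow> nat" where
  "column_index e a b w l = stop_index e a b w (the_inv_into {1..CARD('d)} e l)"

text \<open>Uniform quantisation of \<open>[lo, hi]\<close> with \<open>N\<close> cells. The \<open>j\<close>-th cell is represented by
  its point at relative position \<open>\<theta> j \<in> [0, 1]\<close>, an arbitrary fixed point of the cell.\<close>

definition quantize :: "real \<Rightarrow> real \<Rightarrow> nat \<Rightarrow> (nat \<Rightarrow> real) \<Rightarrow> real \<Rightarrow> real" where
  "quantize lo hi N \<theta> x =
     (let \<Delta> = (hi - lo) / real N;
          j = min (nat \<lfloor>(x - lo) / \<Delta>\<rfloor>) (N - 1)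
      in lo + (real j + \<theta> j) * \<Delta>)"

text \<open>Truncation to \<open>[-c, c]\<close>, then \<open>N\<close> (even) cells of equal length: the first \<open>N/2\<close>
  divide \<open>[-c, -a]\<close> and the others divide \<open>[a, c]\<close>.\<close>

definition quantize_diag :: "real \<Rightarrow> real \<Rightarrow> nat \<Rightarrow> (nat \<Rightarrow> real) \<Rightarrow> real \<Rightarrow> real" where
  "quantize_diag a c N \<theta> x =
     (let x' = (if \<bar>x\<bar> > c then sgn x * c else x)
      in if x' < 0 then quantize (- c) (- a) (N div 2) \<theta> x'
         else quantize a c (N div 2) (\<lambda>j. \<theta> (N div 2 + j)) x')"

definition loc_bits :: "nat \<Rightarrow> real \<Rightarrow> real" where
  "loc_bits d k = (sqrt (k + 1) - 1)\<^sup>2 / real d"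

definition quant_bits :: "nat \<Rightarrow> real \<Rightarrow> real" where
  "quant_bits d k = sqrt (4 * loc_bits d k / real d ^ 3)"

definition stop_level :: "nat \<Rightarrow> real \<Rightarrow> real \<Rightarrow> real" where
  "stop_level d b k =
     Qinv (geom_entropy_inv (loc_bits d k) / (2 * (1 - 2 * Qfun b) ^ (d - 1)))"

definition admissible_bits :: "nat \<Rightarrow> real set" where
  "admissible_bits d = {k. k > 0 \<and> (\<exists>m::nat. m > 0 \<and> quant_bits d k = real m)}"

text \<open>The arguments \<open>x\<close> and \<open>y\<close> are the sample sequences. The \<open>j\<close>-th column of \<open>WJ\<close> is
  \<open>w (J j)\<close>; \<open>\<theta> i j\<close> selects the representing points for the entry in row \<open>i\<close> and
  column \<open>j\<close>.\<close>

definition stopping_estimator ::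
  "(nat \<Rightarrow> 'd::finite) \<Rightarrow> real ^ 'd ^ 'd \<Rightarrow> real \<Rightarrow> ('d \<Rightarrow> 'd \<Rightarrow> nat \<Rightarrow> real) \<Rightarrow> real
    \<Rightarrow> (nat \<Rightarrow> real ^ 'd) \<Rightarrow> (nat \<Rightarrow> real) \<Rightarrow> real ^ 'd" where
  "stopping_estimator e \<Sigma> b \<theta> k x y =
     (let a = stop_level CARD('d) b k;
          c = sqrt 3 * a;
          N = 2 ^ nat \<lfloor>quant_bits CARD('d) k\<rfloor>;
          w = (\<lambda>i. matrix_inv (sqrt_mat \<Sigma>) *v x i);
          J = column_index e a b w;
          YJ = (\<chi> j. y (J j));
          WJ = (\<chi> i j. w (J j) $ i);
          WJq = (\<chi> i j. if i = j then quantize_diag a c N (\<theta> i j) (WJ $ i $ j)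
                        else quantize (- b) b N (\<theta> i j) (WJ $ i $ j))
      in (YJ v* matrix_inv WJq) v* sqrt_mat \<Sigma>)"

end

theory Submission
  imports Defs "HOL-Real_Asymp.Real_Asymp"
begin

text \<open>Both errors are computed to leading order. Whitening gives \<open>Y = \<alpha> \<bullet> W + Z\<close> with \<open>W\<close> standard normal and \<open>Z\<close>
  independent of \<open>W\<close> of variance \<open>1 - \<bar>\<alpha>\<bar>\<^sup>2\<close>. Conditionally on the \<open>W\<close>-samples the selection
  is deterministic, so the error splits into a function of the \<open>W\<close>-samples and uncorrelated noise. The quantised
  matrix has diagonal entries of absolute value at least \<open>a\<close> and bounded other entries, so its inverse has norm at most
  \<open>1 / (a - O(1))\<close>, and the stopping-set error is at most \<open>d (1 - \<bar>\<alpha>\<bar>\<^sup>2) / a\<^sup>2\<close> up to lower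
  order terms, where \<open>a\<^sup>2 \<sim> 2 ln 2 k / d\<close>. The scalar error is \<open>(1 - \<rho>\<^sub>l\<^sup>2) / (2 ln 2 w\<^sub>l k)\<close>
  to leading order, because the selected sample concentrates around a level \<open>t\<close> with
  \<open>t\<^sup>2 \<sim> 2 ln 2 w\<^sub>l k\<close>. Now \<open>\<rho>\<^sub>l\<^sup>2 \<le> \<bar>\<alpha>\<bar>\<^sup>2\<close> (less of \<open>Y\<close> is explained by one
  coordinate than by all) and \<open>\<Sum>1/w\<^sub>l \<ge> d\<^sup>2\<close>.\<close>

subsection \<open>Tails of the standard normal distribution\<close>

text \<open>The two sides ask for different things. For the scalar estimator a limit is asserted, so
  its error is computed exactly through mean and variance of the selected sample; for the other one
  an upper bound is enough, and constants that stay bounded while \<open>a\<close> grows are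
  estimated crudely. The bit split makes this work. With s = sqrt (k + 1) - 1 it reads k_l = s^2 / d
  and k_q = 2 s / d^2, so that d k_l + d^2 k_q = s^2 + 2 s = k. Location keeps the share k_l ~ k /
  d, which fixes a^2, while k_q of order sqrt k makes the cell size 2^(-k_q) smaller than any
  negative power of k. The obstacles are probabilistic. Freezing the selected indices needs
  independence of generated sigma-algebras, and measurability of the indices and of the inverse
  matrix with respect to them. The truncated diagonal entries are unbounded, so the overshoot of a
  stopped sample has to be controlled without computing its law. Independence of W and Z comes from
  vanishing covariances of vectors that may be degenerate, hence characteristic functions rather
  than densities.\<close>

abbreviation gauss :: "real measure" where "gauss \<equiv> density lborel std_normal_density"

lemma prob_space_gauss: "prob_space gauss"
  by (rule prob_space_normal_density) simp

lemma Qfun_nn: "ennreal (Qfun x) = (\<integral>\<^sup>+u. ennreal (std_normal_density u) * indicator {x..} u \<partial>lborel)"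
proof -
  have "(\<integral>\<^sup>+u. ennreal (std_normal_density u) * indicator {x..} u \<partial>lborel)
    = (\<integral>\<^sup>+u. ennreal (indicator {x..} u * std_normal_density u) \<partial>lborel)"
    by (intro nn_integral_cong) (simp add: indicator_def)
  also have "\<dots> = ennreal (LBINT u. indicator {x..} u * std_normal_density u)"
    by (intro nn_integral_eq_integral integrable_mult_indicator[where 'b=real, simplified]) auto
  finally show ?thesis by (simp add: Qfun_def set_lebesgue_integral_def)
qed

lemma emeasure_gauss: "A \<in> sets borel \<Longrightarrow> emeasure gauss A = (\<integral>\<^sup>+u. ennreal (std_normal_density u) * indicator A u \<partial>lborel)"
  by (simp add: emeasure_density)

lemma Qfun_nonneg: "0 \<le> Qfun x"
  unfolding Qfun_def set_lebesgue_integral_def by (intro integral_nonneg_AE) simp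

lemma Qfun_measure: "Qfun x = measure gauss {x..}"
  using Qfun_nn[of x, symmetric] emeasure_gauss[of "{x..}"] Qfun_nonneg[of x]
  by (simp add: measure_def)

lemma gauss_null: "emeasure gauss {x} = 0"
  by (simp add: emeasure_gauss)

lemma measure_gauss_greater: "measure gauss {x<..} = Qfun x"
proof -
  interpret prob_space gauss by (rule prob_space_gauss)
  have "{x..} = {x} \<union> {x<..}" by auto
  then have "measure gauss {x..} = measure gauss {x} + measure gauss {x<..}"
    using finite_measure_Union[of "{x}" "{x<..}"] by simp
  then show ?thesis by (simp add: Qfun_measure measure_def gauss_null)
qed

lemma measure_gauss_atMost: "measure gauss {..x} = 1 - Qfun x"
proof -
  interpret prob_space gauss by (rule prob_space_gauss)
  have "{..x} = space gauss - {x<..}" by auto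
  then show ?thesis using prob_compl[of "{x<..}"] by (simp add: measure_gauss_greater)
qed

lemma Qfun_diff: 
  assumes "x \<le> y" shows "Qfun x - Qfun y = measure gauss {x..<y}"
proof -
  interpret prob_space gauss by (rule prob_space_gauss)
  have "{x..} = {x..<y} \<union> {y..}" using assms by auto
  then have "measure gauss {x..} = measure gauss {x..<y} + measure gauss {y..}"
    using finite_measure_Union[of "{x..<y}" "{y..}"] by force
  then show ?thesis by (simp add: Qfun_measure)
qed

lemma Qfun_strict_antimono: 
  assumes "x < y" shows "Qfun y < Qfun x"
proof -
  interpret prob_space gauss by (rule prob_space_gauss)
  have "emeasure gauss {x..<y} \<noteq> 0"
  proof
    assume "emeasure gauss {x..<y} = 0"
    then have "AE u in lborel. u \<notin> {x..<y}"
      by (simp add: emeasure_gauss nn_integral_0_iff_AE normal_density_pos not_le[symmetric])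
        (auto elim!: eventually_mono simp: less_imp_neq[OF normal_density_pos, symmetric] not_le not_less indicator_def split: if_splits)
    then have "emeasure lborel {x..<y} = 0" 
      by (subst (asm) AE_iff_measurable[of "{x..<y}"]) auto
    then show False using assms by simp
  qed
  then have "measure gauss {x..<y} > 0" by (simp add: emeasure_eq_measure zero_less_measure_iff)
  then show ?thesis using Qfun_diff[of x y] assms by simp
qed

lemma Qfun_pos: "0 < Qfun x"
  using Qfun_strict_antimono[of x "x+1"] Qfun_nonneg[of "x+1"] by simp

lemma Qfun_less_iff: "Qfun x < Qfun y \<longleftrightarrow> y < x"
  by (metis Qfun_strict_antimono linorder_less_linear order.asym)

lemma Qfun_antimono: "x \<le> y \<Longrightarrow> Qfun y \<le> Qfun x"
  using Qfun_strict_antimono[of x y] by (cases "x = y") auto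

lemma inj_Qfun: "inj Qfun"
  by (rule injI) (metis Qfun_strict_antimono linorder_neqE_linordered_idom order_less_irrefl)

lemma std_normal_density_le_1: "std_normal_density x \<le> 1"
proof -
  have "1 \<le> 2 * pi" using pi_gt3 by linarith
  then have "1 \<le> sqrt (2 * pi)" by simp
  moreover have "exp (- x\<^sup>2 / 2) \<le> 1" by simp
  ultimately have "exp (- x\<^sup>2 / 2) \<le> sqrt (2 * pi)" by linarith
  then show ?thesis unfolding std_normal_density_def by simp
qed

text \<open>The density is at most 1. This supplies the continuity behind the intermediate value
  argument for \<open>Qinv\<close>.\<close>

lemma Qfun_lipschitz: assumes "x \<le> y" shows "Qfun x - Qfun y \<le> y - x"
proof -
  have "emeasure gauss {x..<y} = (\<integral>\<^sup>+u. ennreal (std_normal_density u) * indicator {x..<y} u \<partial>lborel)"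
    by (rule emeasure_gauss) simp
  also have "\<dots> \<le> (\<integral>\<^sup>+u. indicator {x..<y} u \<partial>lborel)"
    using std_normal_density_le_1 by (intro nn_integral_mono) (auto split: split_indicator)
  also have "\<dots> = ennreal (y - x)" using assms by simp
  finally show ?thesis using Qfun_diff[OF assms] assms
    by (simp add: measure_def) (metis enn2real_leI diff_ge_0_iff_ge)
qed

lemma continuous_on_Qfun: "continuous_on A Qfun"
proof (rule continuous_on_subset[of UNIV])
  have "\<bar>Qfun x - Qfun y\<bar> \<le> \<bar>x - y\<bar>" for x y
    using Qfun_lipschitz[of x y] Qfun_lipschitz[of y x] Qfun_antimono[of x y] Qfun_antimono[of y x]
    by (cases "x \<le> y") auto
  then show "continuous_on UNIV Qfun"
    by (intro uniformly_continuous_imp_continuous) 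
      (auto simp: uniformly_continuous_on_def dist_real_def intro: le_less_trans)
qed simp

lemma Qfun_minus: "Qfun (- x) = 1 - Qfun x"
proof -
  have "ennreal (Qfun (-x)) = (\<integral>\<^sup>+u. ennreal (std_normal_density u) * indicator {-x..} u \<partial>lborel)"
    by (rule Qfun_nn)
  also have "\<dots> = (\<integral>\<^sup>+u. ennreal (std_normal_density (-u)) * indicator {-x..} (-u) \<partial>lborel)"
    using nn_integral_real_affine[of "\<lambda>u. ennreal (std_normal_density u) * indicator {-x..} u" "-1" 0] by simp
  also have "\<dots> = emeasure gauss {..x}"
    by (subst emeasure_gauss) (auto intro!: nn_integral_cong simp: std_normal_density_def indicator_def)
  finally show ?thesis using measure_gauss_atMost[of x] Qfun_nonneg
    by (simp add: measure_def)
      (metis Qfun_nonneg enn2real_ennreal)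
qed

lemma Qfun_0: "Qfun 0 = 1/2"
  using Qfun_minus[of 0] by simp

lemma Qfun_less_half: "b > 0 \<Longrightarrow> Qfun b < 1/2"
  using Qfun_strict_antimono[of 0 b] Qfun_0 by simp

lemma measure_gauss_abs_less: assumes "b > 0" shows "measure gauss {-b<..<b} = 1 - 2 * Qfun b"
proof -
  interpret prob_space gauss by (rule prob_space_gauss)
  have "{-b<..} = {-b<..<b} \<union> {b..}" using assms by auto
  then have "measure gauss {-b<..} = measure gauss {-b<..<b} + measure gauss {b..}"
    using finite_measure_Union[of "{-b<..<b}" "{b..}"] by force
  then show ?thesis by (simp add: measure_gauss_greater Qfun_minus Qfun_measure[symmetric])
qed

text \<open>The derivative of -phi(x)/x is phi(x) (1 + 1/x^2), so the latter integrates over [t,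
  inf) to exactly phi(t)/t. For x >= 1 the extra factor lies between 1 and 2, which gives both
  bounds.\<close>

lemma Mills_ratio:
  assumes "t \<ge> 1"
  shows "std_normal_density t / (2 * t) \<le> Qfun t" "Qfun t \<le> std_normal_density t / t"
proof -
  define c where "c = 1 / sqrt (2 * pi)"
  have c: "c > 0" by (simp add: c_def)
  have dens: "std_normal_density = (\<lambda>x. c * exp (- x\<^sup>2 / 2))" by (auto simp: std_normal_density_def c_def)
  define F where "F = (\<lambda>x. - (c * exp (- x\<^sup>2 / 2)) / x)"
  have D: "DERIV F x :> std_normal_density x * (1 + 1 / x\<^sup>2)" if "x \<ge> t" for x
    using that assms unfolding F_def dens
    by (auto intro!: derivative_eq_intros simp: field_simps power2_eq_square)
  have "(F \<longlongrightarrow> 0) at_top" unfolding F_def by real_asymp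
  then have "(\<integral>\<^sup>+x. ennreal (std_normal_density x * (1 + 1 / x\<^sup>2)) * indicator {t ..} x \<partial>lborel) = 0 - F t"
    by (intro nn_integral_FTC_atLeast D) auto
  also have "0 - F t = std_normal_density t / t" by (simp add: F_def dens)
  finally have eq: "(\<integral>\<^sup>+x. ennreal (std_normal_density x * (1 + 1 / x\<^sup>2)) * indicator {t ..} x \<partial>lborel) = ennreal (std_normal_density t / t)" .
  have "ennreal (Qfun t) \<le> ennreal (std_normal_density t / t)"
    unfolding Qfun_nn eq[symmetric]
    by (intro nn_integral_mono mult_right_mono ennreal_leI) (auto simp: algebra_simps)
  then show "Qfun t \<le> std_normal_density t / t" using assms by (subst (asm) ennreal_le_iff) auto
  have "ennreal (std_normal_density t / t) \<le> (\<integral>\<^sup>+x. 2 * (ennreal (std_normal_density x) * indicator {t ..} x) \<partial>lborel)"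
    unfolding eq[symmetric]
  proof (rule nn_integral_mono)
    fix x show "ennreal (std_normal_density x * (1 + 1 / x\<^sup>2)) * indicator {t ..} x \<le> 2 * (ennreal (std_normal_density x) * indicator {t ..} x)"
    proof (cases "x \<ge> t")
      case True
      then have "1 / x\<^sup>2 \<le> 1" using assms by (simp add: divide_le_eq)
      then have "std_normal_density x * (1 + 1 / x\<^sup>2) \<le> std_normal_density x * 2" by (intro mult_left_mono) auto
      then have "ennreal (std_normal_density x * (1 + 1 / x\<^sup>2)) \<le> ennreal (2 * std_normal_density x)" by (intro ennreal_leI) simp
      then show ?thesis using True by (simp add: ennreal_mult)
    qed (simp add: indicator_def)
  qed
  also have "\<dots> = ennreal (2 * Qfun t)" by (simp add: nn_integral_cmult Qfun_nn[symmetric] ennreal_mult Qfun_nonneg)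
  finally have "std_normal_density t / t \<le> 2 * Qfun t" using Qfun_nonneg by (subst (asm) ennreal_le_iff) auto
  then show "std_normal_density t / (2 * t) \<le> Qfun t" by simp
qed

text \<open>On [t, inf) the density lies below phi(t) exp (-t (x - t)): only the factor exp (-(x -
  t)^2 / 2) is dropped. The second moment of this exponential is 2 phi(t)/t^3, and the lower Mills
  bound turns phi(t) into at most 2 t Q(t). So, given that a sample exceeds t, its overshoot has
  mean square at most 4/t^2.\<close>

lemma truncated_second_moment:
  assumes t: "t \<ge> 1"
  shows "(\<integral>\<^sup>+x. ennreal ((x - t)\<^sup>2) * indicator {t..} x \<partial>gauss) \<le> ennreal (4 / t\<^sup>2 * Qfun t)"
proof -
  define \<phi> where "\<phi> = std_normal_density t"
  have \<phi>: "\<phi> \<ge> 0" by (simp add: \<phi>_def)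
  \<comment> \<open>Antiderivative of the exponential majorant times (x - t)^2, from integrating by
    parts twice; -F(t) = 2 phi(t)/t^3.\<close>
  define F where "F = (\<lambda>x. - \<phi> * exp (- t * (x - t)) * ((x - t)\<^sup>2 / t + 2 * (x - t) / t\<^sup>2 + 2 / t ^ 3))"
  have D: "DERIV F x :> \<phi> * exp (- t * (x - t)) * (x - t)\<^sup>2" for x
    using t unfolding F_def
    by (auto intro!: derivative_eq_intros simp: field_simps power2_eq_square power3_eq_cube)
  have "(F \<longlongrightarrow> 0) at_top" unfolding F_def using t by real_asymp
  then have eq: "(\<integral>\<^sup>+x. ennreal (\<phi> * exp (- t * (x - t)) * (x - t)\<^sup>2) * indicator {t ..} x \<partial>lborel) = 0 - F t"
    using \<phi> by (intro nn_integral_FTC_atLeast D) auto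
  have le: "std_normal_density x \<le> \<phi> * exp (- t * (x - t))" if "x \<ge> t" for x
  proof -
    have "x\<^sup>2 - t\<^sup>2 - 2 * t * (x - t) = (x - t)\<^sup>2" by (simp add: power2_eq_square algebra_simps)
    then have "- x\<^sup>2 / 2 \<le> - t\<^sup>2 / 2 + - t * (x - t)" using zero_le_power2[of "x - t"] by (simp add: field_simps)
    then have "exp (- x\<^sup>2 / 2) \<le> exp (- t\<^sup>2 / 2) * exp (- t * (x - t))" by (simp only: exp_add[symmetric] exp_le_cancel_iff)
    then show ?thesis unfolding \<phi>_def std_normal_density_def by (simp add: divide_right_mono)
  qed
  have "(\<integral>\<^sup>+x. ennreal ((x - t)\<^sup>2) * indicator {t..} x \<partial>gauss) 
    = (\<integral>\<^sup>+x. ennreal (std_normal_density x) * (ennreal ((x - t)\<^sup>2) * indicator {t..} x) \<partial>lborel)"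
    by (rule nn_integral_density) auto
  also have "\<dots> \<le> (\<integral>\<^sup>+x. ennreal (\<phi> * exp (- t * (x - t)) * (x - t)\<^sup>2) * indicator {t ..} x \<partial>lborel)"
  proof (rule nn_integral_mono)
    fix x show "ennreal (std_normal_density x) * (ennreal ((x - t)\<^sup>2) * indicator {t..} x) \<le> ennreal (\<phi> * exp (- t * (x - t)) * (x - t)\<^sup>2) * indicator {t ..} x"
      using mult_right_mono[OF le[of x], of "(x - t)\<^sup>2"] by (simp add: indicator_def ennreal_mult[symmetric] ennreal_leI)
  qed
  also have "\<dots> = ennreal (2 * \<phi> / t ^ 3)" unfolding eq F_def by (simp add: mult.commute)
  also have "\<dots> \<le> ennreal (4 / t\<^sup>2 * Qfun t)"
  proof (rule ennreal_leI)
    have "4 / t\<^sup>2 * (\<phi> / (2 * t)) \<le> 4 / t\<^sup>2 * Qfun t" using Mills_ratio(1)[OF t] unfolding \<phi>_def by (intro mult_left_mono) auto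
    then show "2 * \<phi> / t ^ 3 \<le> 4 / t\<^sup>2 * Qfun t" using t by (simp add: power2_eq_square power3_eq_cube)
  qed
  finally show ?thesis .
qed

text \<open>The quotient of the densities at u - eps and u is exp (eps u - eps^2/2), smallest at u =
  t on the range of integration. Lowering a level by eps thus multiplies the tail by a factor that
  is large as soon as eps t is; this drives the lower tail of the maximum of N samples with Q(t) =
  1/N.\<close>

lemma Qfun_shift: assumes "0 \<le> \<epsilon>" shows "exp (\<epsilon> * t - \<epsilon>\<^sup>2 / 2) * Qfun t \<le> Qfun (t - \<epsilon>)"
proof -
  have "ennreal (exp (\<epsilon> * t - \<epsilon>\<^sup>2 / 2) * Qfun t) = 
    (\<integral>\<^sup>+u. ennreal (exp (\<epsilon> * t - \<epsilon>\<^sup>2 / 2)) * (ennreal (std_normal_density u) * indicator {t..} u) \<partial>lborel)"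
    by (subst nn_integral_cmult) (auto simp: Qfun_nn[symmetric] ennreal_mult Qfun_nonneg)
  also have "\<dots> \<le> (\<integral>\<^sup>+u. ennreal (std_normal_density (- \<epsilon> + u)) * indicator {t-\<epsilon>..} (- \<epsilon> + u) \<partial>lborel)"
  proof (rule nn_integral_mono)
    fix u show "ennreal (exp (\<epsilon> * t - \<epsilon>\<^sup>2 / 2)) * (ennreal (std_normal_density u) * indicator {t..} u) \<le> ennreal (std_normal_density (- \<epsilon> + u)) * indicator {t-\<epsilon>..} (- \<epsilon> + u)"
    proof (cases "u \<ge> t")
      case True
      have "\<epsilon> * t \<le> \<epsilon> * u" using True assms by (intro mult_left_mono)
      then have "(\<epsilon> * t - \<epsilon>\<^sup>2 / 2) + - u\<^sup>2 / 2 \<le> - (- \<epsilon> + u)\<^sup>2 / 2" by (simp add: power2_eq_square field_simps)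
      then have "exp (\<epsilon> * t - \<epsilon>\<^sup>2 / 2) * exp (- u\<^sup>2 / 2) \<le> exp (- (- \<epsilon> + u)\<^sup>2 / 2)" by (simp only: exp_add[symmetric] exp_le_cancel_iff)
      then have "exp (\<epsilon> * t - \<epsilon>\<^sup>2 / 2) * std_normal_density u \<le> std_normal_density (- \<epsilon> + u)"
        unfolding std_normal_density_def by (simp add: divide_right_mono)
      then show ?thesis using True by (simp add: ennreal_mult[symmetric] ennreal_leI)
    qed (simp add: indicator_def)
  qed
  also have "\<dots> = ennreal (Qfun (t - \<epsilon>))"
    using nn_integral_real_affine[of "\<lambda>u. ennreal (std_normal_density u) * indicator {t-\<epsilon>..} u" 1 "-\<epsilon>"] 
    by (simp add: Qfun_nn)
  finally show ?thesis using Qfun_nonneg by (subst (asm) ennreal_le_iff) auto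
qed

text \<open>The Mills bounds determine Q(t) up to a factor 2; in the logarithm, divided by t^2, only
  the exponent t^2/2 survives.\<close>

lemma ln_Qfun_asymp: "((\<lambda>t. t\<^sup>2 / (- ln (Qfun t))) \<longlongrightarrow> 2) at_top"
proof -
  define c where "c = 1 / sqrt (2 * pi)"
  have c: "c > 0" by (simp add: c_def)
  have dens: "std_normal_density = (\<lambda>x. c * exp (- x\<^sup>2 / 2))" by (auto simp: std_normal_density_def c_def)
  have "((\<lambda>t. - ln (Qfun t) / t\<^sup>2) \<longlongrightarrow> 1/2) at_top"
  proof (rule tendsto_sandwich)
    show "\<forall>\<^sub>F t in at_top. - ln (c * exp (- t\<^sup>2 / 2) / t) / t\<^sup>2 \<le> - ln (Qfun t) / t\<^sup>2"
      using eventually_ge_at_top[of 1]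
    proof eventually_elim
      case (elim t)
      then show ?case using Mills_ratio(2)[OF elim] Qfun_pos[of t] c
        by (intro divide_right_mono) (auto simp: dens)
    qed
    show "\<forall>\<^sub>F t in at_top. - ln (Qfun t) / t\<^sup>2 \<le> - ln (c * exp (- t\<^sup>2 / 2) / (2 * t)) / t\<^sup>2"
      using eventually_ge_at_top[of 1]
    proof eventually_elim
      case (elim t)
      then show ?case using Mills_ratio(1)[OF elim] Qfun_pos[of t] c
        by (intro divide_right_mono) (auto simp: dens)
    qed
    show "((\<lambda>t. - ln (c * exp (- t\<^sup>2 / 2) / t) / t\<^sup>2) \<longlongrightarrow> 1/2) at_top" using c by real_asymp
    show "((\<lambda>t. - ln (c * exp (- t\<^sup>2 / 2) / (2 * t)) / t\<^sup>2) \<longlongrightarrow> 1/2) at_top" using c by real_asymp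
  qed
  from tendsto_inverse[OF this] show ?thesis by simp
qed

lemma Qfun_tendsto_0: "(Qfun \<longlongrightarrow> 0) at_top"
proof (rule tendsto_sandwich[OF _ _ tendsto_const])
  show "\<forall>\<^sub>F t in at_top. Qfun t \<le> 1 / t"
    using eventually_ge_at_top[of 1]
  proof eventually_elim
    case (elim t)
    then show ?case using Mills_ratio(2)[OF elim] std_normal_density_le_1[of t] 
      by (meson divide_right_mono le_numeral_extra(1) order_trans zero_le_one)
  qed
  show "((\<lambda>t::real. 1 / t) \<longlongrightarrow> 0) at_top" by real_asymp
qed (simp add: Qfun_nonneg)

text \<open>\<open>Qinv\<close> is specified only on the range of \<open>Qfun\<close>. The
  intermediate value theorem between 0, where Q is 1/2, and a point with Q < p puts p into this
  range. Small p suffice later, since all levels tend to infinity.\<close>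

lemma Qfun_Qinv: assumes "0 < p" "p \<le> 1/2" shows "Qfun (Qinv p) = p"
proof -
  have "\<forall>\<^sub>F t in at_top. Qfun t < p" using Qfun_tendsto_0 assms(1) by (rule order_tendstoD)
  then obtain t where t: "t \<ge> 0" "Qfun t < p"
    using eventually_ge_at_top[of "0::real"] by (metis (mono_tags, lifting) eventually_at_top_linorder linorder_linear)
  have "\<exists>x\<ge>0. x \<le> t \<and> Qfun x = p"
    using t assms Qfun_0 by (intro IVT2') (auto intro: continuous_on_Qfun)
  then have "p \<in> range Qfun" by auto
  then show ?thesis unfolding Qinv_def by (rule f_the_inv_into_f[OF inj_Qfun])
qed

text \<open>With an arbitrary filter and an arbitrary vanishing p, one statement serves the
  threshold, the 1/N quantile of the maximum method and the level of the stopping sets.\<close>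

lemma Qinv_asymp:
  assumes p: "(p \<longlongrightarrow> 0) F" "\<forall>\<^sub>F x in F. 0 < p x"
  shows "filterlim (\<lambda>x. Qinv (p x)) at_top F" "\<forall>\<^sub>F x in F. Qfun (Qinv (p x)) = p x"
    "((\<lambda>x. (Qinv (p x))\<^sup>2 / (- ln (p x))) \<longlongrightarrow> 2) F"
proof -
  have "\<forall>\<^sub>F x in F. p x < 1/2" using p(1) by (rule order_tendstoD) simp
  with p(2) show inv: "\<forall>\<^sub>F x in F. Qfun (Qinv (p x)) = p x"
    by eventually_elim (simp add: Qfun_Qinv)
  show lim: "filterlim (\<lambda>x. Qinv (p x)) at_top F"
    unfolding filterlim_at_top
  proof
    fix Z :: real
    have "\<forall>\<^sub>F x in F. p x < Qfun Z" using p(1) Qfun_pos by (rule order_tendstoD)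
    with inv show "\<forall>\<^sub>F x in F. Z \<le> Qinv (p x)"
    proof eventually_elim
      case (elim x)
      then show ?case using Qfun_less_iff[of "Qinv (p x)" Z] by simp
    qed
  qed
  have "((\<lambda>x. (Qinv (p x))\<^sup>2 / (- ln (Qfun (Qinv (p x))))) \<longlongrightarrow> 2) F"
    by (rule filterlim_compose[OF ln_Qfun_asymp lim])
  then show "((\<lambda>x. (Qinv (p x))\<^sup>2 / (- ln (p x))) \<longlongrightarrow> 2) F"
    by (rule Lim_transform_eventually) (use inv in eventually_elim, simp)
qed

subsection \<open>Entropy of the geometric distribution\<close>

lemma geom_entropy_ln:
  assumes "0 < p" "p < 1"
  shows "geom_entropy p = (- ln p - (1 - p) / p * ln (1 - p)) / ln 2"
  using assms by (simp add: geom_entropy_def bin_entropy_def log_def field_simps)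

text \<open>Up to the factor 1 / ln 2 the derivative is ln (1 - p) / p^2, which is negative. The
  resulting injectivity is what gives \<open>geom_entropy_inv\<close> a meaning.\<close>

lemma geom_entropy_strict_antimono:
  assumes "0 < x" "x < y" "y < 1"
  shows "geom_entropy y < geom_entropy x"
proof -
  define g where "g = (\<lambda>p::real. - ln p - (1 - p) / p * ln (1 - p))"
  have "g y < g x"
  proof (rule DERIV_neg_imp_decreasing[OF assms(2)])
    fix p assume p: "x \<le> p" "p \<le> y"
    then have p01: "0 < p" "p < 1" using assms by auto
    have "DERIV g p :> ln (1 - p) / p\<^sup>2" 
      using p01 unfolding g_def
      by (auto intro!: derivative_eq_intros simp: field_simps power2_eq_square)
    moreover have "ln (1 - p) / p\<^sup>2 < 0" using p01 by (simp add: divide_less_0_iff)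
    ultimately show "\<exists>y. DERIV g p :> y \<and> y < 0" by blast
  qed
  then show ?thesis using assms by (simp add: geom_entropy_ln g_def divide_strict_right_mono)
qed

text \<open>The second summand of the entropy, (1 - p)/p times -ln (1 - p), lies in [0, 1] because
  ln (1/(1 - p)) <= p/(1 - p). So the entropy determines -ln p up to an additive 1.\<close>

lemma geom_entropy_bounds:
  assumes "0 < p" "p < 1"
  shows "- ln p \<le> geom_entropy p * ln 2" "geom_entropy p * ln 2 \<le> 1 - ln p"
proof -
  have eq: "geom_entropy p * ln 2 = - ln p - (1 - p) / p * ln (1 - p)"
    using geom_entropy_ln[OF assms] by simp
  have "(1 - p) / p * ln (1 - p) \<le> 0" using assms by (intro mult_nonneg_nonpos) auto
  then show "- ln p \<le> geom_entropy p * ln 2" by (simp add: eq)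
  have "- ln (1 - p) = ln (1 / (1 - p))" using assms by (simp add: ln_div)
  also have "\<dots> \<le> 1 / (1 - p) - 1" using assms by (intro ln_le_minus_one) simp
  also have "\<dots> = p / (1 - p)" using assms by (simp add: field_simps)
  finally have "(1 - p) / p * (- ln (1 - p)) \<le> (1 - p) / p * (p / (1 - p))"
    using assms by (intro mult_left_mono) auto
  then show "geom_entropy p * ln 2 \<le> 1 - ln p" using assms by (simp add: eq)
qed

lemma geom_entropy_inv:
  assumes "\<kappa> > 0"
  shows "0 < geom_entropy_inv \<kappa>" "geom_entropy_inv \<kappa> < 1" "geom_entropy (geom_entropy_inv \<kappa>) = \<kappa>"
proof -
  have inj: "inj_on geom_entropy {0<..<1}"
    by (rule inj_onI) (metis geom_entropy_strict_antimono greaterThanLessThan_iff linorder_neqE_linordered_idom order_less_irrefl)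
  \<comment> \<open>Left end for the intermediate value theorem: here -ln p0 >= \<kappa> ln 2, so
    the entropy is at least \<kappa>. The right end p1 exists since the entropy tends to 0 at 1; the
    cap 1/2 keeps p0 below p1.\<close>
  define p0 where "p0 = min (1/2) (exp (- \<kappa> * ln 2))"
  have p0: "0 < p0" "p0 \<le> 1/2" by (auto simp: p0_def)
  have "ln p0 \<le> ln (exp (- \<kappa> * ln 2))" using p0(1) by (intro ln_mono) (auto simp: p0_def)
  then have "\<kappa> * ln 2 \<le> - ln p0" by simp
  also have "\<dots> \<le> geom_entropy p0 * ln 2" using p0 by (intro geom_entropy_bounds) auto
  finally have le: "\<kappa> \<le> geom_entropy p0" by simp
  have "((\<lambda>p::real. (- ln p - (1 - p) / p * ln (1 - p)) / ln 2) \<longlongrightarrow> 0) (at_left 1)"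
    by real_asymp
  then have "\<forall>\<^sub>F p in at_left 1. (- ln p - (1 - p) / p * ln (1 - p)) / ln 2 < \<kappa>"
    using assms by (rule order_tendstoD)
  moreover have "\<forall>\<^sub>F p::real in at_left 1. p \<in> {1/2<..<1}" by (rule eventually_at_leftI[of "1/2"]) auto
  ultimately have "\<forall>\<^sub>F p in at_left 1. p > 1/2 \<and> p < 1 \<and> geom_entropy p < \<kappa>"
    by eventually_elim (simp add: geom_entropy_ln)
  then obtain p1 where p1: "p1 > 1/2" "p1 < 1" "geom_entropy p1 < \<kappa>"
    using eventually_happens[of _ "at_left (1::real)"] by auto
  have cont: "continuous_on {p0..p1} geom_entropy"
  proof (subst continuous_on_cong[OF refl])
    show "geom_entropy p = (- ln p - (1 - p) / p * ln (1 - p)) / ln 2" if "p \<in> {p0..p1}" for p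
      using that p0 p1 by (intro geom_entropy_ln) auto
    show "continuous_on {p0..p1} (\<lambda>p. (- ln p - (1 - p) / p * ln (1 - p)) / ln 2)"
      using p0 p1 by (auto intro!: continuous_intros)
  qed
  have "\<exists>p\<ge>p0. p \<le> p1 \<and> geom_entropy p = \<kappa>"
    using le p0 p1 cont by (intro IVT2') auto
  then have *: "\<kappa> \<in> geom_entropy ` {0<..<1}" using p0 p1 by force
  show "geom_entropy (geom_entropy_inv \<kappa>) = \<kappa>"
    unfolding geom_entropy_inv_def by (rule f_the_inv_into_f[OF inj *])
  have "geom_entropy_inv \<kappa> \<in> {0<..<1}"
    unfolding geom_entropy_inv_def by (rule the_inv_into_into[OF inj *]) simp
  then show "0 < geom_entropy_inv \<kappa>" "geom_entropy_inv \<kappa> < 1" by auto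
qed

lemma ln_geom_entropy_inv:
  assumes "\<kappa> > 0"
  shows "\<kappa> * ln 2 - 1 \<le> - ln (geom_entropy_inv \<kappa>)" "- ln (geom_entropy_inv \<kappa>) \<le> \<kappa> * ln 2"
  using geom_entropy_bounds[of "geom_entropy_inv \<kappa>"] geom_entropy_inv[OF assms] by auto

lemma geom_entropy_inv_asymp:
  "((\<lambda>\<kappa>. - ln (geom_entropy_inv \<kappa>) / \<kappa>) \<longlongrightarrow> ln 2) at_top"
proof (rule tendsto_sandwich)
  show "\<forall>\<^sub>F \<kappa> in at_top. (\<kappa> * ln 2 - 1) / \<kappa> \<le> - ln (geom_entropy_inv \<kappa>) / \<kappa>"
    using eventually_gt_at_top[of 0] by eventually_elim (intro divide_right_mono ln_geom_entropy_inv, auto)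
  show "\<forall>\<^sub>F \<kappa> in at_top. - ln (geom_entropy_inv \<kappa>) / \<kappa> \<le> \<kappa> * ln 2 / \<kappa>"
    using eventually_gt_at_top[of 0] by eventually_elim (intro divide_right_mono ln_geom_entropy_inv, auto)
  show "((\<lambda>\<kappa>::real. (\<kappa> * ln 2 - 1) / \<kappa>) \<longlongrightarrow> ln 2) at_top" by real_asymp
  show "((\<lambda>\<kappa>::real. \<kappa> * ln 2 / \<kappa>) \<longlongrightarrow> ln 2) at_top" by real_asymp
qed

lemma geom_entropy_inv_tendsto: "(geom_entropy_inv \<longlongrightarrow> 0) at_top"
proof (rule tendsto_sandwich[OF _ _ tendsto_const])
  show "\<forall>\<^sub>F \<kappa> in at_top. 0 \<le> geom_entropy_inv \<kappa>"
    using eventually_gt_at_top[of 0] by eventually_elim (auto dest: geom_entropy_inv(1))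
  show "\<forall>\<^sub>F \<kappa> in at_top. geom_entropy_inv \<kappa> \<le> exp (1 - \<kappa> * ln 2)"
    using eventually_gt_at_top[of 0]
  proof eventually_elim
    case (elim \<kappa>)
    have "ln (geom_entropy_inv \<kappa>) \<le> 1 - \<kappa> * ln 2" using ln_geom_entropy_inv(1)[OF elim] by simp
    then show ?case using geom_entropy_inv(1)[OF elim] by (metis exp_le_cancel_iff exp_ln)
  qed
  show "((\<lambda>\<kappa>::real. exp (1 - \<kappa> * ln 2)) \<longlongrightarrow> 0) at_top" by real_asymp
qed

text \<open>Dividing by C adds ln C to the negative logarithm, and ln C / K vanishes. Hence C = 1
  (threshold method) and C = 2 (1 - 2 Q(b))^(d-1) (stopping sets) lead to the same leading
  order.\<close>

lemma Qinv_geom_asymp: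
  assumes K: "filterlim K at_top F" and C: "C > 0"
  defines "t \<equiv> \<lambda>x. Qinv (geom_entropy_inv (K x) / C)"
  shows "filterlim t at_top F" "\<forall>\<^sub>F x in F. Qfun (t x) = geom_entropy_inv (K x) / C"
    "((\<lambda>x. (t x)\<^sup>2 / K x) \<longlongrightarrow> 2 * ln 2) F"
proof -
  have Kpos: "\<forall>\<^sub>F x in F. K x > 0" using K by (simp add: filterlim_at_top_dense)
  have p0: "((\<lambda>x. geom_entropy_inv (K x) / C) \<longlongrightarrow> 0) F"
    using tendsto_divide[OF filterlim_compose[OF geom_entropy_inv_tendsto K] tendsto_const[of C]] C by simp
  have pp: "\<forall>\<^sub>F x in F. 0 < geom_entropy_inv (K x) / C"
    using Kpos by eventually_elim (use C geom_entropy_inv in auto)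
  note Q = Qinv_asymp[OF p0 pp]
  show "filterlim t at_top F" "\<forall>\<^sub>F x in F. Qfun (t x) = geom_entropy_inv (K x) / C"
    using Q(1,2) by (auto simp: t_def)
  have l0: "((\<lambda>x. ln C / K x) \<longlongrightarrow> 0) F"
    by (rule real_tendsto_divide_at_top[OF tendsto_const K])
  have "((\<lambda>x. - ln (geom_entropy_inv (K x)) / K x + ln C / K x) \<longlongrightarrow> ln 2 + 0) F"
    by (intro tendsto_add filterlim_compose[OF geom_entropy_inv_asymp K] l0)
  then have "((\<lambda>x. (Qinv (geom_entropy_inv (K x) / C))\<^sup>2 / (- ln (geom_entropy_inv (K x) / C)) * 
      (- ln (geom_entropy_inv (K x)) / K x + ln C / K x)) \<longlongrightarrow> 2 * (ln 2 + 0)) F"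
    by (rule tendsto_mult[OF Q(3)])
  moreover have "\<forall>\<^sub>F x in F. geom_entropy_inv (K x) / C < 1" using p0 by (rule order_tendstoD) simp
  then have "\<forall>\<^sub>F x in F. (Qinv (geom_entropy_inv (K x) / C))\<^sup>2 / (- ln (geom_entropy_inv (K x) / C)) * 
      (- ln (geom_entropy_inv (K x)) / K x + ln C / K x) = (t x)\<^sup>2 / K x"
    using Kpos pp
  proof eventually_elim
    case (elim x)
    have pos: "0 < geom_entropy_inv (K x)" using geom_entropy_inv elim by blast
    have "- ln (geom_entropy_inv (K x) / C) > 0" using elim by simp
    moreover have "- ln (geom_entropy_inv (K x)) / K x + ln C / K x = - ln (geom_entropy_inv (K x) / C) / K x"
      using pos C by (simp add: ln_div diff_divide_distrib)
    ultimately show ?case by (simp add: t_def)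
  qed
  ultimately show "((\<lambda>x. (t x)\<^sup>2 / K x) \<longlongrightarrow> 2 * ln 2) F" by (simp add: Lim_transform_eventually)
qed

text \<open>The level t is the one that a single one of N samples exceeds on average. Rounding 2
  powr K down changes ln N by o(1), so ln N / K still tends to ln 2.\<close>

lemma Qinv_samples_asymp:
  assumes K: "filterlim K at_top F"
  defines "N \<equiv> \<lambda>x. nat \<lfloor>2 powr K x\<rfloor>"
  defines "t \<equiv> \<lambda>x. Qinv (1 / real (N x))"
  shows "filterlim t at_top F" "\<forall>\<^sub>F x in F. Qfun (t x) = 1 / real (N x)" "\<forall>\<^sub>F x in F. N x \<ge> 2"
    "((\<lambda>x. (t x)\<^sup>2 / K x) \<longlongrightarrow> 2 * ln 2) F"
proof -
  have K1: "\<forall>\<^sub>F x in F. K x \<ge> 1" using K by (simp add: filterlim_at_top)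
  have Nb: "2 powr \<kappa> - 1 \<le> real (nat \<lfloor>2 powr \<kappa>\<rfloor>)" "real (nat \<lfloor>2 powr \<kappa>\<rfloor>) \<le> 2 powr \<kappa>" for \<kappa> :: real
    by (simp_all add: of_nat_nat)
  have N2: "nat \<lfloor>2 powr \<kappa>\<rfloor> \<ge> 2" if "\<kappa> \<ge> 1" for \<kappa> :: real
  proof -
    have "2 powr 1 \<le> 2 powr \<kappa>" using that by (intro powr_mono) auto
    then show ?thesis by (simp add: le_nat_iff le_floor_iff)
  qed
  show "\<forall>\<^sub>F x in F. N x \<ge> 2" using K1 by eventually_elim (simp add: N_def N2)
  have pp: "\<forall>\<^sub>F x in F. 0 < 1 / real (N x)" using K1   proof eventually_elim
    case (elim x) then show ?case using N2[OF elim] ge_one_powr_ge_zero[of 2 "K x"] by (simp add: N_def)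
  qed
  have Nlim: "((\<lambda>\<kappa>::real. 1 / real (nat \<lfloor>2 powr \<kappa>\<rfloor>)) \<longlongrightarrow> 0) at_top"
  proof (rule tendsto_sandwich[OF _ _ tendsto_const])
    show "\<forall>\<^sub>F \<kappa> in at_top. 1 / real (nat \<lfloor>2 powr \<kappa>\<rfloor>) \<le> 1 / (2 powr \<kappa> - 1)"
      using eventually_ge_at_top[of 1]
    proof eventually_elim
      case (elim \<kappa>)
      have "2 powr 1 \<le> 2 powr \<kappa>" using elim by (intro powr_mono) auto
      then show ?case using Nb(1)[of \<kappa>] by (intro divide_left_mono mult_pos_pos) auto
    qed
    show "((\<lambda>\<kappa>::real. 1 / (2 powr \<kappa> - 1)) \<longlongrightarrow> 0) at_top" by real_asymp
  qed simp
  have p0: "((\<lambda>x. 1 / real (N x)) \<longlongrightarrow> 0) F" unfolding N_def by (rule filterlim_compose[OF Nlim K])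
  note Q = Qinv_asymp[OF p0 pp]
  show "filterlim t at_top F" "\<forall>\<^sub>F x in F. Qfun (t x) = 1 / real (N x)"
    using Q(1,2) by (auto simp: t_def)
  have lnN: "((\<lambda>\<kappa>::real. ln (real (nat \<lfloor>2 powr \<kappa>\<rfloor>)) / \<kappa>) \<longlongrightarrow> ln 2) at_top"
  proof (rule tendsto_sandwich)
    show "\<forall>\<^sub>F \<kappa> in at_top. ln (2 powr \<kappa> - 1) / \<kappa> \<le> ln (real (nat \<lfloor>2 powr \<kappa>\<rfloor>)) / \<kappa>"
      using eventually_ge_at_top[of 1]
    proof eventually_elim
      case (elim \<kappa>)
      have "2 powr 1 \<le> 2 powr \<kappa>" using elim by (intro powr_mono) auto
      then show ?case using Nb(1)[of \<kappa>] elim by (intro divide_right_mono) auto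
    qed
    show "\<forall>\<^sub>F \<kappa> in at_top. ln (real (nat \<lfloor>2 powr \<kappa>\<rfloor>)) / \<kappa> \<le> ln (2 powr \<kappa>) / \<kappa>"
      using eventually_ge_at_top[of 1]
    proof eventually_elim
      case (elim \<kappa>)
      then show ?case using Nb(2)[of \<kappa>] N2[OF elim] ge_one_powr_ge_zero[of 2 \<kappa>] by (intro divide_right_mono ln_mono) auto
    qed
    show "((\<lambda>\<kappa>::real. ln (2 powr \<kappa> - 1) / \<kappa>) \<longlongrightarrow> ln 2) at_top" by real_asymp
    show "((\<lambda>\<kappa>::real. ln (2 powr \<kappa>) / \<kappa>) \<longlongrightarrow> ln 2) at_top" by real_asymp
  qed
  have "((\<lambda>x. (Qinv (1 / real (N x)))\<^sup>2 / (- ln (1 / real (N x))) * (ln (real (N x)) / K x)) \<longlongrightarrow> 2 * ln 2) F"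
    unfolding N_def by (intro tendsto_mult filterlim_compose[OF lnN K] Q(3)[unfolded N_def])
  moreover have "\<forall>\<^sub>F x in F. (Qinv (1 / real (N x)))\<^sup>2 / (- ln (1 / real (N x))) * (ln (real (N x)) / K x) = (t x)\<^sup>2 / K x"
    using K1
  proof eventually_elim
    case (elim x)
    have "N x \<ge> 2" using N2[OF elim] by (simp add: N_def)
    then have "ln (real (N x)) > 0" by simp
    then show ?case using \<open>N x \<ge> 2\<close> by (simp add: t_def ln_div)
  qed
  ultimately show "((\<lambda>x. (t x)\<^sup>2 / K x) \<longlongrightarrow> 2 * ln 2) F" by (simp add: Lim_transform_eventually)
qed

subsection \<open>The symmetric square root of a positive definite matrix\<close>

lemma symmetric_matrix_inner:
  fixes A :: "real ^ 'd ^ 'd"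
  shows "transpose A = A \<longleftrightarrow> (\<forall>u v. u \<bullet> (A *v v) = (A *v u) \<bullet> v)"
proof
  assume "transpose A = A"
  then show "\<forall>u v. u \<bullet> (A *v v) = (A *v u) \<bullet> v"
    by (metis dot_lmul_matrix transpose_matrix_vector)
next
  assume *: "\<forall>u v. u \<bullet> (A *v v) = (A *v u) \<bullet> v"
  have entry: "A $ i $ j = axis i 1 \<bullet> (A *v axis j 1)" for i j
    by (simp add: inner_axis' matrix_vector_mult_basis column_def)
  show "transpose A = A"
    by (simp add: vec_eq_iff transpose_def entry) (metis * inner_commute)
qed

text \<open>The equation says \<open>(1 - B)\<^sup>2 = 1 - E\<close>.\<close>

lemma symmetric_contraction_root:
  fixes E :: "'v::{real_inner,banach} \<Rightarrow>\<^sub>L 'v"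
  assumes "norm E < 1" "\<And>u v. u \<bullet> E v = E u \<bullet> v"
  obtains B :: "'v \<Rightarrow>\<^sub>L 'v" where "norm B < 1" "\<And>u v. u \<bullet> B v = B u \<bullet> v" "2 *\<^sub>R B = E + (B o\<^sub>L B)"
proof -
  define q where "q = norm E"
  have q: "0 \<le> q" "q < 1" using assms by (auto simp: q_def)
  \<comment> \<open>Complete set for Banach's fixed point theorem: (q + q^2)/2 <= q makes
    \<open>f\<close> map it into itself, A A - B B = A (A - B) + (A - B) B gives the Lipschitz
    constant q < 1, and symmetry, a closed condition, passes to the fixed point.\<close>
  define S where "S = {B :: 'v \<Rightarrow>\<^sub>L 'v. norm B \<le> q \<and> (\<forall>u v. u \<bullet> blinfun_apply B v = blinfun_apply B u \<bullet> v)}"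
  define f where "f = (\<lambda>B :: 'v \<Rightarrow>\<^sub>L 'v. (1/2) *\<^sub>R (E + (B o\<^sub>L B)))"
  have "closed S" unfolding S_def
    by (intro closed_Collect_conj closed_Collect_all closed_Collect_le closed_Collect_eq continuous_intros)
  then have "Topological_Spaces.complete S" by (rule complete_eq_closed[THEN iffD2])
  moreover have "0 \<in> S" using q by (auto simp: S_def)
  then have "S \<noteq> {}" by blast
  moreover have "f ` S \<subseteq> S"
  proof
    fix C :: "'v \<Rightarrow>\<^sub>L 'v" assume "C \<in> f ` S"
    then obtain B :: "'v \<Rightarrow>\<^sub>L 'v" where B: "norm B \<le> q" "\<And>u v. u \<bullet> B v = B u \<bullet> v" "C = f B" by (auto simp: S_def)
    have "norm (B o\<^sub>L B) \<le> q * q" 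
      using norm_blinfun_compose[of B B] mult_mono[OF B(1) B(1)] q by auto
    also have "\<dots> \<le> q" using q by (simp add: mult_left_le)
    finally have "norm (E + (B o\<^sub>L B)) \<le> q + q" using norm_triangle_ineq[of E "B o\<^sub>L B"] by (simp add: q_def)
    then have "norm C \<le> q" by (simp add: B(3) f_def)
    moreover have "u \<bullet> blinfun_apply C v = C u \<bullet> v" for u v
      by (simp add: B(3) f_def blinfun.bilinear_simps inner_add_left inner_add_right assms(2) B(2))
    ultimately show "C \<in> S" by (simp add: S_def)
  qed
  moreover have "dist (f A) (f B) \<le> q * dist A B" if "A \<in> S" "B \<in> S" for A B
  proof -
    have n: "norm A \<le> q" "norm B \<le> q" using that by (auto simp: S_def)
    have "f A - f B = (1/2) *\<^sub>R ((A o\<^sub>L (A - B)) + ((A - B) o\<^sub>L B))"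
      by (simp add: f_def algebra_simps bounded_bilinear.diff_left[OF bounded_bilinear_blinfun_compose] bounded_bilinear.diff_right[OF bounded_bilinear_blinfun_compose])
    then have "norm (f A - f B) = norm ((A o\<^sub>L (A - B)) + ((A - B) o\<^sub>L B)) / 2" by simp
    also have "\<dots> \<le> (norm A * norm (A - B) + norm (A - B) * norm B) / 2"
      by (intro divide_right_mono norm_triangle_le add_mono norm_blinfun_compose) auto
    also have "\<dots> \<le> (q * norm (A - B) + norm (A - B) * q) / 2"
      using n by (intro divide_right_mono add_mono mult_right_mono mult_left_mono) auto
    finally show ?thesis by (simp add: dist_norm)
  qed
  ultimately have "\<exists>!B\<in>S. f B = B" using q by (intro Banach_fix) auto
  then obtain B where B: "B \<in> S" "f B = B" by auto
  have "2 *\<^sub>R B = 2 *\<^sub>R f B" using B by simp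
  also have "\<dots> = E + (B o\<^sub>L B)" by (simp add: f_def)
  finally show ?thesis using that[of B] B(1) q by (auto simp: S_def)
qed

text \<open>With R = S - T, the equation S^2 = T^2 says S R + R T = 0. Multiplying by R and taking
  traces gives tr (R S R) + tr (R T R) = 0. As R is symmetric, each trace is a sum of quadratic
  forms over the columns of R, hence nonnegative, and coercivity of S forces the columns to
  vanish.\<close>

lemma psd_root_unique:
  fixes S T :: "real ^ 'd ^ 'd"
  assumes S: "transpose S = S" "c > 0" "\<And>v. c * (norm v)\<^sup>2 \<le> v \<bullet> (S *v v)"
    and T: "transpose T = T" "\<And>v. 0 \<le> v \<bullet> (T *v v)"
    and eq: "S ** S = T ** T"
  shows "S = T"
proof -
  define R where "R = S - T"
  have symR: "R $ i $ k = R $ k $ i" for i k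
  proof -
    have "transpose S $ i $ k = S $ i $ k" "transpose T $ i $ k = T $ i $ k" by (simp_all only: S(1) T(1))
    then show ?thesis by (simp add: R_def transpose_def)
  qed
  have tr: "trace (R ** (P ** R)) = (\<Sum>i\<in>UNIV. column i R \<bullet> (P *v column i R))" for P :: "real^'d^'d"
    unfolding trace_def
    by (intro sum.cong refl) (simp add: matrix_matrix_mult_def inner_vec_def matrix_vector_mult_def column_def symR)
  have "S ** R + R ** T = 0"
  proof (subst matrix_eq, rule allI)
    fix v
    have "S *v (S *v v) = T *v (T *v v)" using eq by (metis matrix_vector_mul_assoc)
    then show "(S ** R + R ** T) *v v = 0 *v v"
      by (simp add: R_def matrix_vector_mult_add_rdistrib matrix_vector_mult_diff_rdistrib
        matrix_vector_mult_diff_distrib matrix_vector_mul_assoc[symmetric])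
  qed
  then have "trace (R ** (S ** R + R ** T)) = 0" by (simp add: trace_def)
  then have "trace (R ** (S ** R)) + trace (R ** (R ** T)) = 0" 
    by (simp add: matrix_add_ldistrib trace_add)
  moreover have "trace (R ** (R ** T)) = trace (R ** (T ** R))"
    by (metis matrix_mul_assoc trace_mul_sym)
  ultimately have "(\<Sum>i\<in>UNIV. column i R \<bullet> (S *v column i R)) + (\<Sum>i\<in>UNIV. column i R \<bullet> (T *v column i R)) = 0"
    by (simp add: tr)
  moreover have "(\<Sum>i\<in>UNIV. c * (norm (column i R))\<^sup>2) \<le> (\<Sum>i\<in>UNIV. column i R \<bullet> (S *v column i R))"
    by (intro sum_mono S)
  moreover have "0 \<le> (\<Sum>i\<in>UNIV. column i R \<bullet> (T *v column i R))" by (intro sum_nonneg T)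
  ultimately have "(\<Sum>i\<in>UNIV. c * (norm (column i R))\<^sup>2) \<le> 0" by simp
  moreover have "0 \<le> (\<Sum>i\<in>UNIV. c * (norm (column i R))\<^sup>2)" using S(2) by (intro sum_nonneg) auto
  ultimately have "(\<Sum>i\<in>UNIV. c * (norm (column i R))\<^sup>2) = 0" by simp
  then have "c * (norm (column i R))\<^sup>2 = 0" for i
    by (rule sum_nonneg_0[rotated 2]) (use S(2) in auto)
  then have col0: "column i R = 0" for i using S(2) by (metis mult_eq_0_iff norm_eq_zero order_less_irrefl zero_eq_power2)
  have "R = 0" using col0 by (simp add: vec_eq_iff column_def)
  then show ?thesis by (simp add: R_def)
qed

text \<open>The description operator in \<open>sqrt_mat\<close> calls for existence and uniqueness.
  For existence, A is rescaled to A / l = 1 - E with norm E < 1, and S = sqrt l (1 - B) with (1 -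
  B)^2 = 1 - E. As norm B < 1, this S is coercive, which is the hypothesis of
  \<open>psd_root_unique\<close>.\<close>

lemma sqrt_mat:
  fixes A :: "real ^ 'd ^ 'd"
  assumes sym: "transpose A = A" and pos: "\<And>v. v \<noteq> 0 \<Longrightarrow> 0 < v \<bullet> (A *v v)"
  shows "transpose (sqrt_mat A) = sqrt_mat A" "sqrt_mat A ** sqrt_mat A = A"
proof -
  define F where "F = Blinfun ((*v) A)"
  have F: "blinfun_apply F v = A *v v" for v
    by (simp add: F_def bounded_linear_Blinfun_apply matrix_vector_mul_bounded_linear)
  \<comment> \<open>Compactness of the unit sphere turns strict positivity into a uniform lower
    bound m for the quadratic form.\<close>
  have "\<exists>x\<in>sphere (0::real^'d) 1. \<forall>y\<in>sphere 0 1. x \<bullet> F x \<le> y \<bullet> F y"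
    by (intro continuous_attains_inf compact_sphere continuous_intros) simp
  then obtain x where x: "norm x = 1" "\<And>y. norm y = 1 \<Longrightarrow> x \<bullet> F x \<le> y \<bullet> F y" by auto
  define m where "m = x \<bullet> F x"
  define K where "K = norm F"
  have m: "m > 0" unfolding m_def F using x by (intro pos) auto
  have "m \<le> norm x * norm (F x)" unfolding m_def by (rule norm_cauchy_schwarz)
  also have "\<dots> \<le> K" using norm_blinfun[of F x] x by (simp add: K_def)
  finally have mK: "m \<le> K" .
  have mv: "m * (norm v)\<^sup>2 \<le> v \<bullet> F v" for v
  proof (cases "v = 0")
    case False
    have "m \<le> sgn v \<bullet> F (sgn v)" unfolding m_def using False by (intro x) (simp add: norm_sgn)
    also have "\<dots> = (v \<bullet> F v) / (norm v)\<^sup>2" 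
      by (simp add: sgn_div_norm blinfun.bilinear_simps power2_eq_square divide_inverse)
    finally show ?thesis using False by (simp add: field_simps)
  qed simp
  \<comment> \<open>Minimises 1 - 2 m / l + K^2 / l^2, the bound for the squared norm of E v
    relative to that of v; the minimum is 1 - m^2 / K^2 < 1.\<close>
  define l where "l = K\<^sup>2 / m"
  have l: "l > 0" using m mK by (simp add: l_def)
  define E where "E = id_blinfun - (1 / l) *\<^sub>R F"
  have E: "E v = v - (1 / l) *\<^sub>R (F v)" for v by (simp add: E_def blinfun.bilinear_simps)
  have q: "0 \<le> 1 - m\<^sup>2 / K\<^sup>2" "1 - m\<^sup>2 / K\<^sup>2 < 1" using m mK by (auto simp: divide_le_eq power_mono)
  have "norm (E v) \<le> sqrt (1 - m\<^sup>2 / K\<^sup>2) * norm v" for v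
  proof (rule power2_le_imp_le)
    have "(norm (F v))\<^sup>2 \<le> (K * norm v)\<^sup>2" unfolding K_def by (intro power_mono norm_blinfun) auto
    then have 1: "(norm (F v))\<^sup>2 / l\<^sup>2 \<le> (K * norm v)\<^sup>2 / l\<^sup>2" by (intro divide_right_mono) auto
    have 2: "2 * m * (norm v)\<^sup>2 / l \<le> 2 * (v \<bullet> F v) / l" using mv[of v] l by (intro divide_right_mono) auto
    have "(norm (E v))\<^sup>2 = (norm v)\<^sup>2 - 2 * (v \<bullet> F v) / l + (norm (F v))\<^sup>2 / l\<^sup>2"
      unfolding E power2_norm_eq_inner by (simp add: inner_diff_left inner_diff_right inner_commute power2_eq_square)
    also have "\<dots> \<le> (norm v)\<^sup>2 - 2 * m * (norm v)\<^sup>2 / l + (K * norm v)\<^sup>2 / l\<^sup>2" using 1 2 by linarith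
    also have "\<dots> = (1 - m\<^sup>2 / K\<^sup>2) * (norm v)\<^sup>2" using m mK unfolding l_def
      by (simp add: field_simps power2_eq_square)
    also have "\<dots> = (sqrt (1 - m\<^sup>2 / K\<^sup>2) * norm v)\<^sup>2" using q by (simp add: power_mult_distrib)
    finally show "(norm (E v))\<^sup>2 \<le> (sqrt (1 - m\<^sup>2 / K\<^sup>2) * norm v)\<^sup>2" .
  qed (use q in simp)
  then have "norm E \<le> sqrt (1 - m\<^sup>2 / K\<^sup>2)" using q by (intro norm_blinfun_bound) auto
  also have "\<dots> < 1" using q by simp
  finally have nE: "norm E < 1" .
  have symF: "u \<bullet> F v = F u \<bullet> v" for u v using sym by (simp add: F symmetric_matrix_inner)
  have symE: "u \<bullet> E v = E u \<bullet> v" for u v by (simp add: E inner_diff_left inner_diff_right symF)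
  obtain B :: "(real^'d) \<Rightarrow>\<^sub>L (real^'d)" where B: "norm B < 1" "\<And>u v. u \<bullet> B v = B u \<bullet> v" "2 *\<^sub>R B = E + (B o\<^sub>L B)"
    using symmetric_contraction_root[OF nE symE] by blast
  define T where "T = sqrt l *\<^sub>R (id_blinfun - B)"
  define S where "S = matrix (blinfun_apply T)"
  have S: "S *v v = T v" for v
    unfolding S_def using fun_cong[OF matrix_vector_mul(3)[OF blinfun.bounded_linear_right], of T v] .
  have "transpose S = S"
    unfolding symmetric_matrix_inner S by (simp add: T_def blinfun.bilinear_simps inner_diff_left inner_diff_right B(2))
  moreover have "S ** S = A"
  proof (subst matrix_eq, rule allI)
    fix v
    have "2 *\<^sub>R B v = E v + B (B v)" using B(3) by (metis blinfun.add_left blinfun.scaleR_left blinfun_apply_blinfun_compose)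
    then have *: "v - 2 *\<^sub>R B v + B (B v) = (1 / l) *\<^sub>R F v" by (simp add: E)
    have "S ** S *v v = l *\<^sub>R (v - 2 *\<^sub>R B v + B (B v))"
      using l by (simp add: matrix_vector_mul_assoc[symmetric] S T_def blinfun.bilinear_simps algebra_simps scaleR_2)
    also have "\<dots> = A *v v" unfolding * using l by (simp add: F)
    finally show "S ** S *v v = A *v v" .
  qed
  moreover have coer: "sqrt l * (1 - norm B) * (norm v)\<^sup>2 \<le> v \<bullet> (S *v v)" for v
  proof -
    have "v \<bullet> B v \<le> norm v * norm (B v)" by (rule norm_cauchy_schwarz)
    also have "\<dots> \<le> norm v * (norm B * norm v)" by (intro mult_left_mono norm_blinfun) auto
    finally have "sqrt l * ((1 - norm B) * (norm v)\<^sup>2) \<le> sqrt l * (v \<bullet> v - v \<bullet> B v)" using l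
      by (intro mult_left_mono) (auto simp: power2_norm_eq_inner[symmetric] algebra_simps power2_eq_square)
    then show ?thesis by (simp add: S T_def blinfun.bilinear_simps inner_diff_right mult.assoc)
  qed
  moreover have "sqrt l * (1 - norm B) > 0" using l B by simp
  ultimately have *: "sqrt_mat A = S"
    unfolding sqrt_mat_def
  proof (intro the_equality conjI allI)
    fix v show "0 \<le> v \<bullet> (S *v v)"
      using coer[of v] \<open>sqrt l * (1 - norm B) > 0\<close> by (meson dual_order.trans less_imp_le mult_nonneg_nonneg zero_le_power2)
  next
    fix T assume T: "transpose T = T \<and> (\<forall>v. 0 \<le> v \<bullet> (T *v v)) \<and> T ** T = A"
    show "T = S"
      using T \<open>S ** S = A\<close> psd_root_unique[OF \<open>transpose S = S\<close> \<open>sqrt l * (1 - norm B) > 0\<close> coer, of T]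
      by auto
  qed auto
  show "transpose (sqrt_mat A) = sqrt_mat A" "sqrt_mat A ** sqrt_mat A = A"
    unfolding * by fact+
qed

subsection \<open>Independence from characteristic functions\<close>

lemma norm_iexp: "norm (iexp x) = 1" by simp

text \<open>Multivariate uniqueness is reduced to the one-dimensional theorem of Levy: a bounded weight is a
  change of measure, and the factorisation says that it does not change the characteristic function of \<open>U\<close>.\<close>

lemma (in prob_space) weight_indep_nonneg:
  fixes U w :: "'a \<Rightarrow> real"
  assumes U[measurable]: "random_variable borel U" and w[measurable]: "w \<in> borel_measurable M"
    and w0: "\<And>\<omega>. 0 \<le> w \<omega>" and wC: "\<And>\<omega>. w \<omega> \<le> C"
    and char: "\<And>u. (\<integral>\<omega>. complex_of_real (w \<omega>) * iexp (u * U \<omega>) \<partial>M) = complex_of_real (\<integral>\<omega>. w \<omega> \<partial>M) * (\<integral>\<omega>. iexp (u * U \<omega>) \<partial>M)"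
    and A[measurable]: "A \<in> sets borel"
  shows "(\<integral>\<omega>. w \<omega> * indicator A (U \<omega>) \<partial>M) = (\<integral>\<omega>. w \<omega> \<partial>M) * (\<integral>\<omega>. indicat_real A (U \<omega>) \<partial>M)"
proof -
  have int: "integrable M w" using w0 wC by (intro integrable_const_bound[of _ C]) auto
  define c where "c = (\<integral>\<omega>. w \<omega> \<partial>M)"
  have c0: "c \<ge> 0" unfolding c_def using w0 by simp
  show ?thesis
  proof (cases "c = 0")
    case True
    then have "AE \<omega> in M. w \<omega> = 0" using integral_nonneg_eq_0_iff_AE[OF int] w0 by (simp add: c_def)
    then have "(\<integral>\<omega>. w \<omega> * indicator A (U \<omega>) \<partial>M) = (\<integral>\<omega>. 0 \<partial>M)" by (intro integral_cong_AE) auto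
    then show ?thesis using True by (simp add: c_def)
  next
    case False
    with c0 have c: "c > 0" by simp
    define N where "N = density M (\<lambda>\<omega>. ennreal (w \<omega> / c))"
    have "emeasure N (space N) = (\<integral>\<^sup>+\<omega>. ennreal (w \<omega> / c) \<partial>M)" unfolding N_def by (simp add: emeasure_density)
    also have "\<dots> = ennreal (\<integral>\<omega>. w \<omega> / c \<partial>M)" using int w0 c by (intro nn_integral_eq_integral) auto
    also have "\<dots> = 1" using c by (simp add: c_def[symmetric])
    finally interpret N: prob_space N by (rule prob_spaceI)
    have [measurable]: "U \<in> borel_measurable N" unfolding N_def by simp
    have rd: "real_distribution (distr N borel U)" "real_distribution (distr M borel U)"
      by (auto intro!: N.real_distribution_distr real_distribution_distr)
    have "char (distr N borel U) = char (distr M borel U)"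
    proof
      fix u
      have "char (distr N borel U) u = (\<integral>\<omega>. iexp (u * U \<omega>) \<partial>N)"
        unfolding char_def by (subst integral_distr) auto
      also have "\<dots> = (\<integral>\<omega>. (w \<omega> / c) *\<^sub>R iexp (u * U \<omega>) \<partial>M)"
        unfolding N_def using w0 c by (intro integral_density) auto
      also have "\<dots> = (\<integral>\<omega>. (1 / complex_of_real c) * (complex_of_real (w \<omega>) * iexp (u * U \<omega>)) \<partial>M)"
        by (intro Bochner_Integration.integral_cong refl) (simp add: scaleR_conv_of_real)
      also have "\<dots> = (\<integral>\<omega>. iexp (u * U \<omega>) \<partial>M)"
        unfolding integral_mult_right_zero char c_def[symmetric] using c by simp
      also have "\<dots> = char (distr M borel U) u"
        unfolding char_def by (subst integral_distr) auto
      finally show "char (distr N borel U) u = char (distr M borel U) u" .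
    qed
    then have eq: "distr N borel U = distr M borel U" using Levy_uniqueness rd by blast
    have "(\<integral>\<omega>. indicat_real A (U \<omega>) \<partial>M) = (\<integral>x. indicat_real A x \<partial>distr M borel U)"
      by (subst integral_distr) auto
    also have "\<dots> = (\<integral>\<omega>. indicat_real A (U \<omega>) \<partial>N)" unfolding eq[symmetric] by (subst integral_distr) auto
    also have "\<dots> = (\<integral>\<omega>. (w \<omega> / c) *\<^sub>R indicat_real A (U \<omega>) \<partial>M)"
      unfolding N_def using w0 c by (intro integral_density) auto
    also have "\<dots> = (\<integral>\<omega>. w \<omega> * indicator A (U \<omega>) \<partial>M) / c" by simp
    finally show ?thesis using c by (simp add: c_def[symmetric])
  qed
qed

text \<open>Conjugation together with u -> -u shows that \<open>cnj g\<close> satisfies the same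
  factorisation, hence so do the real and imaginary parts of g. Adding C makes these nonnegative
  bounded weights.\<close>

lemma (in prob_space) weight_indep:
  fixes U :: "'a \<Rightarrow> real" and g :: "'a \<Rightarrow> complex"
  assumes U[measurable]: "random_variable borel U" and g[measurable]: "g \<in> borel_measurable M"
    and gC: "\<And>\<omega>. norm (g \<omega>) \<le> C"
    and char: "\<And>u. (\<integral>\<omega>. g \<omega> * iexp (u * U \<omega>) \<partial>M) = (\<integral>\<omega>. g \<omega> \<partial>M) * (\<integral>\<omega>. iexp (u * U \<omega>) \<partial>M)"
    and A[measurable]: "A \<in> sets borel"
  shows "(\<integral>\<omega>. g \<omega> * indicator A (U \<omega>) \<partial>M) = (\<integral>\<omega>. g \<omega> \<partial>M) * complex_of_real (\<integral>\<omega>. indicat_real A (U \<omega>) \<partial>M)"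
proof -
  have bdd: "integrable M h" if "h \<in> borel_measurable M" "\<And>\<omega>. norm (h \<omega>) \<le> B" for h :: "'a \<Rightarrow> 'c::{banach,second_countable_topology}" and B
    using that by (intro integrable_const_bound[of _ B]) auto
  have [measurable]: "(\<lambda>\<omega>. cnj (g \<omega>)) \<in> borel_measurable M"
    by (rule borel_measurable_continuous_on[OF _ g]) (intro continuous_intros)
  have C0: "0 \<le> C" using gC[of undefined] norm_ge_zero order_trans by blast
  have int: "integrable M g" using gC by (intro bdd[of _ C]) auto
  have inte: "integrable M (\<lambda>\<omega>. iexp (u * U \<omega>))" for u by (intro bdd[of _ 1]) auto
  have intge: "integrable M (\<lambda>\<omega>. g \<omega> * iexp (u * U \<omega>))" for u using gC by (intro bdd[of _ C]) (auto simp: norm_mult)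
  have intce: "integrable M (\<lambda>\<omega>. cnj (g \<omega>) * iexp (u * U \<omega>))" for u using gC by (intro bdd[of _ C]) (auto simp: norm_mult)
  have charc: "(\<integral>\<omega>. cnj (g \<omega>) * iexp (u * U \<omega>) \<partial>M) = cnj (\<integral>\<omega>. g \<omega> \<partial>M) * (\<integral>\<omega>. iexp (u * U \<omega>) \<partial>M)" for u
  proof -
    have "(\<integral>\<omega>. cnj (g \<omega>) * iexp (u * U \<omega>) \<partial>M) = (\<integral>\<omega>. cnj (g \<omega> * iexp (-u * U \<omega>)) \<partial>M)"
      by (intro Bochner_Integration.integral_cong refl) (simp add: exp_cnj)
    also have "\<dots> = cnj (\<integral>\<omega>. g \<omega> * iexp (-u * U \<omega>) \<partial>M)" by (rule Bochner_Integration.integral_cnj)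
    also have "\<dots> = cnj (\<integral>\<omega>. g \<omega> \<partial>M) * (\<integral>\<omega>. cnj (iexp (-u * U \<omega>)) \<partial>M)" unfolding char by (simp only: complex_cnj_mult Bochner_Integration.integral_cnj)
    also have "(\<integral>\<omega>. cnj (iexp (-u * U \<omega>)) \<partial>M) = (\<integral>\<omega>. iexp (u * U \<omega>) \<partial>M)"
      by (intro Bochner_Integration.integral_cong refl) (simp add: exp_cnj)
    finally show ?thesis .
  qed
  have real_case: "(\<integral>\<omega>. w \<omega> * indicator A (U \<omega>) \<partial>M) = (\<integral>\<omega>. w \<omega> \<partial>M) * (\<integral>\<omega>. indicat_real A (U \<omega>) \<partial>M)"
    if w[measurable]: "w \<in> borel_measurable M" and wC: "\<And>\<omega>. \<bar>w \<omega>\<bar> \<le> C"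
     and wchar: "\<And>u. (\<integral>\<omega>. complex_of_real (w \<omega>) * iexp (u * U \<omega>) \<partial>M) = complex_of_real (\<integral>\<omega>. w \<omega> \<partial>M) * (\<integral>\<omega>. iexp (u * U \<omega>) \<partial>M)"
    for w :: "'a \<Rightarrow> real"
  proof -
    have iw: "integrable M w" using wC by (intro bdd[of _ C]) auto
    have iwe: "integrable M (\<lambda>\<omega>. complex_of_real (w \<omega>) * iexp (u * U \<omega>))" for u using wC by (intro bdd[of _ C]) (auto simp: norm_mult)
    have iA: "integrable M (\<lambda>\<omega>. indicator A (U \<omega>) :: real)" by (intro bdd[of _ 1]) auto
    have iwA: "integrable M (\<lambda>\<omega>. w \<omega> * indicator A (U \<omega>))" using wC C0 by (intro bdd[of _ C]) (auto simp: indicator_def)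
    have "(\<integral>\<omega>. (w \<omega> + C) * indicator A (U \<omega>) \<partial>M) = (\<integral>\<omega>. w \<omega> + C \<partial>M) * (\<integral>\<omega>. indicat_real A (U \<omega>) \<partial>M)"
    proof (rule weight_indep_nonneg)
      show "0 \<le> w \<omega> + C" "w \<omega> + C \<le> 2 * C" for \<omega> using wC[of \<omega>] by auto
      show "(\<integral>\<omega>. complex_of_real (w \<omega> + C) * iexp (u * U \<omega>) \<partial>M) = complex_of_real (\<integral>\<omega>. w \<omega> + C \<partial>M) * (\<integral>\<omega>. iexp (u * U \<omega>) \<partial>M)" for u
        using iw iwe[of u] inte[of u] wchar[of u] by (simp add: distrib_right prob_space)
    qed auto
    then show ?thesis using iw iwA iA by (simp add: distrib_right prob_space)
  qed
  have gint: "(\<integral>\<omega>. g \<omega> \<partial>M) = Complex (\<integral>\<omega>. Re (g \<omega>) \<partial>M) (\<integral>\<omega>. Im (g \<omega>) \<partial>M)"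
    using int by (simp add: complex_eq_iff)
  have re: "(\<integral>\<omega>. Re (g \<omega>) * indicator A (U \<omega>) \<partial>M) = (\<integral>\<omega>. Re (g \<omega>) \<partial>M) * (\<integral>\<omega>. indicat_real A (U \<omega>) \<partial>M)"
  proof (rule real_case)
    show "\<bar>Re (g \<omega>)\<bar> \<le> C" for \<omega> using abs_Re_le_cmod[of "g \<omega>"] gC[of \<omega>] by linarith
    fix u
    have "(\<integral>\<omega>. complex_of_real (Re (g \<omega>)) * iexp (u * U \<omega>) \<partial>M) = (\<integral>\<omega>. (g \<omega> * iexp (u * U \<omega>) + cnj (g \<omega>) * iexp (u * U \<omega>)) / 2 \<partial>M)"
      by (intro Bochner_Integration.integral_cong refl) (simp add: distrib_right[symmetric] complex_add_cnj)
    also have "\<dots> = ((\<integral>\<omega>. g \<omega> \<partial>M) + cnj (\<integral>\<omega>. g \<omega> \<partial>M)) / 2 * (\<integral>\<omega>. iexp (u * U \<omega>) \<partial>M)"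
      using intge[of u] intce[of u] by (simp add: char charc distrib_right del: of_real_mult)
    also have "((\<integral>\<omega>. g \<omega> \<partial>M) + cnj (\<integral>\<omega>. g \<omega> \<partial>M)) / 2 = complex_of_real (\<integral>\<omega>. Re (g \<omega>) \<partial>M)"
      by (simp add: complex_add_cnj gint)
    finally show "(\<integral>\<omega>. complex_of_real (Re (g \<omega>)) * iexp (u * U \<omega>) \<partial>M) = complex_of_real (\<integral>\<omega>. Re (g \<omega>) \<partial>M) * (\<integral>\<omega>. iexp (u * U \<omega>) \<partial>M)" .
  qed simp
  have Im_cnj: "complex_of_real (Im z) = (z - cnj z) / (2 * \<i>)" for z by (simp add: complex_eq_iff)
  have im: "(\<integral>\<omega>. Im (g \<omega>) * indicator A (U \<omega>) \<partial>M) = (\<integral>\<omega>. Im (g \<omega>) \<partial>M) * (\<integral>\<omega>. indicat_real A (U \<omega>) \<partial>M)"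
  proof (rule real_case)
    show "\<bar>Im (g \<omega>)\<bar> \<le> C" for \<omega> using abs_Im_le_cmod[of "g \<omega>"] gC[of \<omega>] by linarith
    fix u
    have "(\<integral>\<omega>. complex_of_real (Im (g \<omega>)) * iexp (u * U \<omega>) \<partial>M) = (\<integral>\<omega>. (g \<omega> * iexp (u * U \<omega>) - cnj (g \<omega>) * iexp (u * U \<omega>)) / (2 * \<i>) \<partial>M)"
      by (intro Bochner_Integration.integral_cong refl) (simp add: Im_cnj left_diff_distrib diff_divide_distrib)
    also have "\<dots> = ((\<integral>\<omega>. g \<omega> \<partial>M) - cnj (\<integral>\<omega>. g \<omega> \<partial>M)) / (2 * \<i>) * (\<integral>\<omega>. iexp (u * U \<omega>) \<partial>M)"
      using intge[of u] intce[of u] by (simp add: char charc left_diff_distrib del: of_real_mult)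
    also have "((\<integral>\<omega>. g \<omega> \<partial>M) - cnj (\<integral>\<omega>. g \<omega> \<partial>M)) / (2 * \<i>) = complex_of_real (\<integral>\<omega>. Im (g \<omega>) \<partial>M)"
      by (simp only: Im_cnj[symmetric]) (simp add: gint)
    finally show "(\<integral>\<omega>. complex_of_real (Im (g \<omega>)) * iexp (u * U \<omega>) \<partial>M) = complex_of_real (\<integral>\<omega>. Im (g \<omega>) \<partial>M) * (\<integral>\<omega>. iexp (u * U \<omega>) \<partial>M)" .
  qed simp
  have igA: "integrable M (\<lambda>\<omega>. g \<omega> * indicator A (U \<omega>))" using gC C0 by (intro bdd[of _ C]) (auto simp: indicator_def)
  have reA: "Re (g \<omega> * indicator A (U \<omega>)) = Re (g \<omega>) * indicator A (U \<omega>)" "Im (g \<omega> * indicator A (U \<omega>)) = Im (g \<omega>) * indicator A (U \<omega>)" for \<omega>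
    by (auto simp: indicator_def)
  have "Re (\<integral>\<omega>. g \<omega> * indicator A (U \<omega>) \<partial>M) = Re (\<integral>\<omega>. g \<omega> \<partial>M) * (\<integral>\<omega>. indicat_real A (U \<omega>) \<partial>M)"
    using re unfolding reA(1)[symmetric] integral_Re[OF igA] integral_Re[OF int] .
  moreover have "Im (\<integral>\<omega>. g \<omega> * indicator A (U \<omega>) \<partial>M) = Im (\<integral>\<omega>. g \<omega> \<partial>M) * (\<integral>\<omega>. indicat_real A (U \<omega>) \<partial>M)"
    using im unfolding reA(2)[symmetric] integral_Im[OF igA] integral_Im[OF int] .
  ultimately show ?thesis by (simp add: complex_eq_iff)
qed

text \<open>Coordinates are converted from exponentials to indicators one at a time. At each stage
  everything except the exponential of the coordinate \<open>m\<close> is the weight of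
  \<open>weight_indep\<close>, and the induction hypothesis with frequency u at \<open>m\<close> is
  exactly the factorisation it asks for.\<close>

theorem (in prob_space) indep_vars_char:
  fixes U :: "'i::finite \<Rightarrow> 'a \<Rightarrow> real"
  assumes U[measurable]: "\<And>i. random_variable borel (U i)"
    and char: "\<And>v. (\<integral>\<omega>. iexp (\<Sum>i\<in>UNIV. v i * U i \<omega>) \<partial>M) = (\<Prod>i\<in>UNIV. \<integral>\<omega>. iexp (v i * U i \<omega>) \<partial>M)"
  shows "indep_vars (\<lambda>_. borel) U UNIV"
proof -
  define \<phi> where "\<phi> = (\<lambda>i v. \<integral>\<omega>. iexp (v * U i \<omega>) \<partial>M)"
  have \<phi>0: "\<phi> i 0 = 1" for i by (simp add: \<phi>_def prob_space)
  \<comment> \<open>K holds the coordinates already converted: K empty is the hypothesis on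
    characteristic functions, K = \<open>UNIV\<close> the product rule for probabilities.\<close>
  have claim: "(\<integral>\<omega>. (\<Prod>j\<in>K. indicator (A j) (U j \<omega>)) * iexp (\<Sum>j\<in>-K. v j * U j \<omega>) \<partial>M)
     = (\<Prod>j\<in>K. complex_of_real (\<integral>\<omega>. indicator (A j) (U j \<omega>) \<partial>M)) * (\<Prod>j\<in>-K. \<phi> j (v j))"
    if A[measurable]: "\<And>j. A j \<in> sets borel" for K A v
    using finite[of K]
  proof (induction K arbitrary: v rule: finite_induct)
    case empty
    then show ?case using char[of v] by (simp add: \<phi>_def Compl_empty_eq)
  next
    case (insert m K)
    define P where "P = (\<Prod>j\<in>K. complex_of_real (\<integral>\<omega>. indicator (A j) (U j \<omega>) \<partial>M))"
    define g where "g = (\<lambda>\<omega>. (\<Prod>j\<in>K. indicator (A j) (U j \<omega>)) * iexp (\<Sum>j\<in>-insert m K. v j * U j \<omega>))"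
    have [measurable]: "g \<in> borel_measurable M" unfolding g_def by measurable
    have split: "- K = insert m (- insert m K)" "m \<notin> - insert m K" "finite (- insert m K)" using insert by auto
    have 1: "(\<integral>\<omega>. g \<omega> * iexp (u * U m \<omega>) \<partial>M) = P * (\<phi> m u * (\<Prod>j\<in>-insert m K. \<phi> j (v j)))" for u
    proof -
      have *: "(\<Sum>j\<in>-K. (v(m:=u)) j * U j \<omega>) = u * U m \<omega> + (\<Sum>j\<in>-insert m K. v j * U j \<omega>)" for \<omega>
        unfolding split(1) using split(2,3) by (subst sum.insert) (auto intro!: sum.cong)
      have **: "(\<Prod>j\<in>-K. \<phi> j ((v(m:=u)) j)) = \<phi> m u * (\<Prod>j\<in>-insert m K. \<phi> j (v j))"
        unfolding split(1) using split(2,3) by (subst prod.insert) (auto intro!: prod.cong)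
      have "(\<integral>\<omega>. g \<omega> * iexp (u * U m \<omega>) \<partial>M) = (\<integral>\<omega>. (\<Prod>j\<in>K. indicator (A j) (U j \<omega>)) * iexp (\<Sum>j\<in>-K. (v(m:=u)) j * U j \<omega>) \<partial>M)"
        unfolding * by (intro Bochner_Integration.integral_cong refl) (simp add: g_def distrib_left exp_add)
      also have "\<dots> = P * (\<phi> m u * (\<Prod>j\<in>-insert m K. \<phi> j (v j)))"
        unfolding insert.IH ** P_def ..
      finally show ?thesis .
    qed
    have g: "(\<integral>\<omega>. g \<omega> \<partial>M) = P * (\<Prod>j\<in>-insert m K. \<phi> j (v j))"
      using 1[of 0] \<phi>0 by simp
    have "norm (g \<omega>) \<le> 1" for \<omega>
      unfolding g_def norm_mult norm_iexp prod_norm[symmetric]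
      by (simp add: prod_le_1 indicator_def)
    then have "(\<integral>\<omega>. g \<omega> * indicator (A m) (U m \<omega>) \<partial>M) = (\<integral>\<omega>. g \<omega> \<partial>M) * complex_of_real (\<integral>\<omega>. indicator (A m) (U m \<omega>) \<partial>M)"
      by (intro weight_indep[of _ _ 1]) (auto simp: 1 g \<phi>_def simp del: of_real_mult)
    moreover have "(\<integral>\<omega>. g \<omega> * indicator (A m) (U m \<omega>) \<partial>M) = (\<integral>\<omega>. (\<Prod>j\<in>insert m K. indicator (A j) (U j \<omega>)) * iexp (\<Sum>j\<in>-insert m K. v j * U j \<omega>) \<partial>M)"
      using insert.hyps by (intro Bochner_Integration.integral_cong refl) (simp add: g_def)
    ultimately show ?case using insert.hyps by (simp add: g P_def)
  qed
  show ?thesis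
    unfolding indep_vars_def2
  proof (intro conjI ballI)
    show "indep_sets (\<lambda>i. {U i -` A \<inter> space M |A. A \<in> sets borel}) UNIV"
    proof (subst indep_sets_finite; (intro ballI)?)
      fix B assume "B \<in> (\<Pi> i\<in>UNIV. {U i -` A \<inter> space M |A. A \<in> sets borel})"
      then have "\<forall>i. \<exists>A. A \<in> sets borel \<and> B i = U i -` A \<inter> space M" by (fastforce simp: Pi_iff)
      then obtain A where A: "\<And>i. A i \<in> sets borel" "\<And>i. B i = U i -` A i \<inter> space M" by metis
      note [measurable] = A(1)
      have pr: "(\<integral>\<omega>. indicator (A j) (U j \<omega>) \<partial>M) = prob (B j)" for j
      proof -
        have "(\<integral>\<omega>. indicator (A j) (U j \<omega>) \<partial>M) = (\<integral>\<omega>. indicator (B j) \<omega> \<partial>M)"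
          by (intro Bochner_Integration.integral_cong refl) (auto simp: A(2) indicator_def)
        also have "\<dots> = prob (B j)" using measurable_sets[OF U A(1), of j] by (simp add: A(2))
        finally show ?thesis .
      qed
      have "(\<integral>\<omega>. (\<Prod>j\<in>UNIV. indicator (A j) (U j \<omega>)) \<partial>M) = (\<integral>\<omega>. complex_of_real (indicator (\<Inter>j. B j) \<omega>) \<partial>M)"
        by (intro Bochner_Integration.integral_cong refl) (auto simp: A(2) indicator_def)
      also have "\<dots> = complex_of_real (prob (\<Inter>j. B j))"
      proof -
        have "(\<Inter>j. B j) \<in> events" unfolding A(2) by (intro sets.finite_INT) auto
        then show ?thesis by (subst integral_of_real) (auto simp: emeasure_eq_measure intro!: integrable_real_indicator)
      qed
      finally have "complex_of_real (prob (\<Inter>j. B j)) = complex_of_real (\<Prod>j\<in>UNIV. prob (B j))"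
        using claim[of A UNIV] A(1) by (simp add: pr)
      then show "prob (\<Inter>j\<in>UNIV. B j) = (\<Prod>j\<in>UNIV. prob (B j))" by (simp only: of_real_eq_iff)
    qed (auto intro!: exI[of _ UNIV])
  qed simp
qed

subsection \<open>Independent sub-sigma-algebras\<close>

text \<open>Freezing: the identity maps from M to A and from M to B are independent random
  variables, so their joint law, although carried by the diagonal, is a product measure, and
  Tonelli's theorem separates the two arguments.\<close>

lemma (in prob_space) nn_integral_indep_subalgebras:
  assumes sub: "space A = space M" "sets A \<subseteq> sets M" "space B = space M" "sets B \<subseteq> sets M"
    and ind: "indep_set (sets A) (sets B)"
    and F[measurable]: "F \<in> borel_measurable (A \<Otimes>\<^sub>M B)"
  shows "(\<integral>\<^sup>+\<omega>. F (\<omega>, \<omega>) \<partial>M) = (\<integral>\<^sup>+\<omega>. \<integral>\<^sup>+\<omega>'. F (\<omega>, \<omega>') \<partial>M \<partial>M)"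
proof -
  have id: "(\<lambda>x. x) \<in> measurable M A" "(\<lambda>x. x) \<in> measurable M B"
    using sub by (auto simp: measurable_def dest: sets.sets_into_space intro: sets.Int)
  have triv: "sigma_sets (space M) {(\<lambda>x. x) -` S \<inter> space M |S. S \<in> sets C} = sets C" if C: "space C = space M" for C :: "'a measure"
  proof -
    have "{(\<lambda>x. x) -` S \<inter> space M |S. S \<in> sets C} = (\<lambda>S. S \<inter> space C) ` sets C"
      unfolding C vimage_ident by (rule Setcompr_eq_image)
    also have "\<dots> = sets C"
      using sets.sets_into_space[of _ C] by (auto simp: Int_absorb2 image_iff)
    finally show ?thesis by (simp only: C[symmetric] sets.sigma_sets_eq)
  qed
  have "indep_var A (\<lambda>x. x) B (\<lambda>x. x)"
    unfolding indep_var_eq triv[OF sub(1)] triv[OF sub(3)] using id ind by blast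
  then have eq: "distr M A (\<lambda>x. x) \<Otimes>\<^sub>M distr M B (\<lambda>x. x) = distr M (A \<Otimes>\<^sub>M B) (\<lambda>x. (x, x))"
    by (simp add: indep_var_distribution_eq)
  interpret B: prob_space "distr M B (\<lambda>x. x)" by (rule prob_space_distr[OF id(2)])
  have pm: "(\<lambda>x. (x, x)) \<in> measurable M (A \<Otimes>\<^sub>M B)" using id by measurable
  have "(\<integral>\<^sup>+\<omega>. F (\<omega>, \<omega>) \<partial>M) = (\<integral>\<^sup>+z. F z \<partial>distr M (A \<Otimes>\<^sub>M B) (\<lambda>x. (x, x)))"
    by (subst nn_integral_distr[OF pm]) auto
  also have "\<dots> = (\<integral>\<^sup>+z. F z \<partial>(distr M A (\<lambda>x. x) \<Otimes>\<^sub>M distr M B (\<lambda>x. x)))" by (simp add: eq)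
  also have "\<dots> = (\<integral>\<^sup>+\<omega>. \<integral>\<^sup>+\<omega>'. F (\<omega>, \<omega>') \<partial>distr M B (\<lambda>x. x) \<partial>distr M A (\<lambda>x. x))"
    by (rule B.nn_integral_fst[symmetric]) (simp cong: measurable_cong_sets)
  also have "\<dots> = (\<integral>\<^sup>+\<omega>. \<integral>\<^sup>+\<omega>'. F (\<omega>, \<omega>') \<partial>distr M B (\<lambda>x. x) \<partial>M)"
    by (rule nn_integral_distr[OF id(1)], rule B.borel_measurable_nn_integral_fst) (simp cong: measurable_cong_sets)
  also have "\<dots> = (\<integral>\<^sup>+\<omega>. \<integral>\<^sup>+\<omega>'. F (\<omega>, \<omega>') \<partial>M \<partial>M)"
  proof (rule nn_integral_cong)
    fix \<omega> assume "\<omega> \<in> space M"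
    then have "\<omega> \<in> space A" using sub by simp
    then show "(\<integral>\<^sup>+\<omega>'. F (\<omega>, \<omega>') \<partial>distr M B (\<lambda>x. x)) = (\<integral>\<^sup>+\<omega>'. F (\<omega>, \<omega>') \<partial>M)"
      by (subst nn_integral_distr[OF id(2)]) auto
  qed
  finally show ?thesis .
qed

text \<open>Encoded as a measure rather than a set system so that it can be the source in
  \<open>measurable\<close> and a factor of a product space.\<close>

definition gen_algebra :: "'a measure \<Rightarrow> 'i set \<Rightarrow> ('i \<Rightarrow> 'a \<Rightarrow> 'b::topological_space) \<Rightarrow> 'a measure" where
  "gen_algebra M I V = sigma (space M) (\<Union>i\<in>I. {V i -` A \<inter> space M | A. A \<in> sets borel})"

lemma gen_algebra:
  shows space_gen_algebra: "space (gen_algebra M I V) = space M"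
    and sets_gen_algebra: "sets (gen_algebra M I V) = sigma_sets (space M) (\<Union>i\<in>I. {V i -` A \<inter> space M | A. A \<in> sets borel})"
  unfolding gen_algebra_def by (auto intro!: space_measure_of sets_measure_of)

lemma measurable_gen_algebra: "i \<in> I \<Longrightarrow> V i \<in> borel_measurable (gen_algebra M I V)"
  by (rule measurableI) (auto simp: gen_algebra intro!: sigma_sets.Basic)

lemma sets_gen_algebra_subset:
  assumes "\<And>i. i \<in> I \<Longrightarrow> V i \<in> borel_measurable M"
  shows "sets (gen_algebra M I V) \<subseteq> sets M"
  unfolding gen_algebra using assms by (intro sets.sigma_sets_subset) auto

lemma measurable_gen_algebra_subset:
  assumes "\<And>i. i \<in> I \<Longrightarrow> V i \<in> borel_measurable M" "f \<in> measurable (gen_algebra M I V) N"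
  shows "f \<in> measurable M N"
  using assms(2) sets_gen_algebra_subset[of I V M, OF assms(1)] unfolding measurable_def space_gen_algebra by auto

text \<open>Independence of the pairs across i, together with independence inside each pair, makes
  the double family sigma(V i), sigma(Z i) independent. Grouping it by the boolean coordinate gives
  the two sigma-algebras.\<close>

lemma (in prob_space) indep_set_gen_algebra:
  fixes V :: "'i \<Rightarrow> 'a \<Rightarrow> 'b::second_countable_topology" and Z :: "'i \<Rightarrow> 'a \<Rightarrow> 'c::second_countable_topology"
  assumes ind: "indep_vars (\<lambda>_. borel) (\<lambda>i \<omega>. (V i \<omega>, Z i \<omega>)) I"
    and VZ: "\<And>i. i \<in> I \<Longrightarrow> indep_set {V i -` A \<inter> space M |A. A \<in> sets borel} {Z i -` B \<inter> space M |B. B \<in> sets borel}"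
  shows "indep_set (sets (gen_algebra M I V)) (sets (gen_algebra M I Z))"
proof -
  define E where "E = (\<lambda>(i, b). if b then {V i -` A \<inter> space M | A. A \<in> sets borel} else {Z i -` A \<inter> space M | A. A \<in> sets borel})"
  have V: "V i \<in> borel_measurable M" "Z i \<in> borel_measurable M" if "i \<in> I" for i
  proof -
    have *: "(\<lambda>\<omega>. (V i \<omega>, Z i \<omega>)) \<in> borel_measurable M" using ind that unfolding indep_vars_def by blast
    show "V i \<in> borel_measurable M" "Z i \<in> borel_measurable M"
      using measurable_compose[OF * borel_measurable_continuous_onI[OF continuous_on_fst[OF continuous_on_id]]]
        measurable_compose[OF * borel_measurable_continuous_onI[OF continuous_on_snd[OF continuous_on_id]]]
      by simp_all
  qed
  have sub: "E (i, b) \<subseteq> events" if "i \<in> I" for i b using V[OF that] by (auto simp: E_def)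
  have sp: "space M \<in> E (i, b)" for i b by (auto simp: E_def intro!: exI[of _ UNIV])
  have stable: "Int_stable (E x)" for x
  proof (rule Int_stableI)
    fix P Q assume PQ: "P \<in> E x" "Q \<in> E x"
    obtain i b where x: "x = (i, b)" by (cases x)
    show "P \<inter> Q \<in> E x"
    proof (cases b)
      case True
      then obtain A B where "A \<in> sets borel" "B \<in> sets borel" "P = V i -` A \<inter> space M" "Q = V i -` B \<inter> space M"
        using PQ by (auto simp: E_def x)
      then show ?thesis using True by (auto simp: E_def x intro!: exI[of _ "A \<inter> B"])
    next
      case False
      then obtain A B where "A \<in> sets borel" "B \<in> sets borel" "P = Z i -` A \<inter> space M" "Q = Z i -` B \<inter> space M"
        using PQ by (auto simp: E_def x)
      then show ?thesis using False by (auto simp: E_def x intro!: exI[of _ "A \<inter> B"])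
    qed
  qed
  have "indep_sets E (\<Union>b\<in>UNIV. I \<times> {b})"
  proof (rule indep_setsI)
    show "E x \<subseteq> events" if "x \<in> (\<Union>b\<in>UNIV. I \<times> {b})" for x using that sub by auto
    fix C and J :: "('i \<times> bool) set"
    assume J: "J \<noteq> {}" "J \<subseteq> (\<Union>b\<in>UNIV. I \<times> {b})" "finite J" and C: "\<forall>j\<in>J. C j \<in> E j"
    define K where "K = fst ` J"
    \<comment> \<open>Missing coordinates are filled with the whole space, so that every i in K
      contributes a full rectangle \<open>A i \<times> B i\<close> for its pair.\<close>
    define D where "D = (\<lambda>j. if j \<in> J then C j else space M)"
    have K: "K \<noteq> {}" "finite K" "K \<subseteq> I" using J by (auto simp: K_def)
    have D: "D (i, b) \<in> E (i, b)" for i b using C sp by (auto simp: D_def)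
    have "\<exists>A B. A \<in> sets borel \<and> B \<in> sets borel \<and> D (i, True) = V i -` A \<inter> space M \<and> D (i, False) = Z i -` B \<inter> space M" for i
      using D[of i True] D[of i False] by (auto simp: E_def)
    then obtain A B where AB: "\<And>i. A i \<in> sets borel" "\<And>i. B i \<in> sets borel"
      "\<And>i. D (i, True) = V i -` A i \<inter> space M" "\<And>i. D (i, False) = Z i -` B i \<inter> space M" by metis
    have JK: "J \<subseteq> K \<times> UNIV" by (force simp: K_def)
    have Csp: "C j \<subseteq> space M" if "j \<in> J" for j
    proof -
      obtain i b where j: "j = (i, b)" by (cases j)
      with that J(2) have "i \<in> I" by auto
      moreover have "C j \<in> E (i, b)" using C that by (simp add: j)
      ultimately have "C j \<in> events" using sub by blast
      then show ?thesis by (rule sets.sets_into_space)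
    qed
    have "(\<Inter>j\<in>J. C j) = (\<Inter>j\<in>K \<times> UNIV. D j)"
    proof -
      have "(\<Inter>j\<in>K \<times> UNIV. D j) = (\<Inter>j\<in>J. D j) \<inter> (\<Inter>j\<in>K \<times> UNIV - J. D j)" using JK by blast
      moreover have "(\<Inter>j\<in>J. D j) = (\<Inter>j\<in>J. C j)" by (simp add: D_def)
      moreover have "(\<Inter>j\<in>J. C j) \<inter> (\<Inter>j\<in>K \<times> UNIV - J. D j) = (\<Inter>j\<in>J. C j)" using Csp J(1) by (auto simp: D_def)
      ultimately show ?thesis by simp
    qed
    also have "\<dots> = (\<Inter>i\<in>K. (\<lambda>\<omega>. (V i \<omega>, Z i \<omega>)) -` (A i \<times> B i) \<inter> space M)"
    proof -
      have "(\<Inter>j\<in>K \<times> UNIV. D j) = (\<Inter>i\<in>K. D (i, True) \<inter> D (i, False))"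
        by (auto simp: UNIV_bool)
      then show ?thesis by (auto simp: AB)
    qed
    finally have eq: "(\<Inter>j\<in>J. C j) = (\<Inter>i\<in>K. (\<lambda>\<omega>. (V i \<omega>, Z i \<omega>)) -` (A i \<times> B i) \<inter> space M)" .
    have "prob (\<Inter>j\<in>J. C j) = (\<Prod>i\<in>K. prob ((\<lambda>\<omega>. (V i \<omega>, Z i \<omega>)) -` (A i \<times> B i) \<inter> space M))"
      unfolding eq using K AB by (intro indep_varsD[OF ind]) (auto simp: borel_prod[symmetric])
    also have "\<dots> = (\<Prod>i\<in>K. prob (D (i, True)) * prob (D (i, False)))"
      proof (intro prod.cong refl)
      fix i assume "i \<in> K"
      then have "i \<in> I" using K by auto
      have "(\<lambda>\<omega>. (V i \<omega>, Z i \<omega>)) -` (A i \<times> B i) \<inter> space M = D (i, True) \<inter> D (i, False)" by (auto simp: AB)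
      moreover have "prob (D (i, True) \<inter> D (i, False)) = prob (D (i, True)) * prob (D (i, False))"
        using AB by (intro indep_setD[OF VZ[OF \<open>i \<in> I\<close>]]) auto
      ultimately show "prob ((\<lambda>\<omega>. (V i \<omega>, Z i \<omega>)) -` (A i \<times> B i) \<inter> space M) = prob (D (i, True)) * prob (D (i, False))"
        by (simp only:)
    qed
    also have "\<dots> = (\<Prod>i\<in>K. \<Prod>b\<in>UNIV. prob (D (i, b)))" by (simp add: UNIV_bool mult.commute)
    also have "\<dots> = (\<Prod>j\<in>K \<times> UNIV. prob (D j))" by (simp add: prod.cartesian_product)
    also have "\<dots> = (\<Prod>j\<in>J. prob (C j))"
      using JK K(2) by (intro prod.mono_neutral_cong_right) (auto simp: D_def prob_space)
    finally show "prob (\<Inter>j\<in>J. C j) = (\<Prod>j\<in>J. prob (C j))" .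
  qed
  then have "indep_sets (\<lambda>b. sigma_sets (space M) (\<Union>j\<in>I \<times> {b}. E j)) UNIV"
    by (rule indep_sets_collect_sigma) (auto simp: disjoint_family_on_def stable)
  moreover have "(\<lambda>b. sigma_sets (space M) (\<Union>j\<in>I \<times> {b}. E j)) = case_bool (sets (gen_algebra M I V)) (sets (gen_algebra M I Z))"
  proof -
    have "(\<Union>j\<in>I \<times> {True}. E j) = (\<Union>i\<in>I. {V i -` A \<inter> space M | A. A \<in> sets borel})"
      "(\<Union>j\<in>I \<times> {False}. E j) = (\<Union>i\<in>I. {Z i -` A \<inter> space M | A. A \<in> sets borel})"
    proof -
      have *: "(\<Union>j\<in>I \<times> {b}. E j) = (\<Union>i\<in>I. E (i, b))" for b by blast
      have **: "E (i, True) = {V i -` A \<inter> space M | A. A \<in> sets borel}" "E (i, False) = {Z i -` A \<inter> space M | A. A \<in> sets borel}" for i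
        unfolding E_def by (simp_all only: prod.case if_True if_False)
      show "(\<Union>j\<in>I \<times> {True}. E j) = (\<Union>i\<in>I. {V i -` A \<inter> space M | A. A \<in> sets borel})"
        "(\<Union>j\<in>I \<times> {False}. E j) = (\<Union>i\<in>I. {Z i -` A \<inter> space M | A. A \<in> sets borel})"
        unfolding * ** by (rule refl)+
    qed
    then show ?thesis by (simp add: fun_eq_iff gen_algebra split: bool.split)
  qed
  ultimately show ?thesis by (simp add: indep_set_def)
qed

text \<open>Indices and coefficients depend on V alone and can be frozen. The noise at fixed
  distinct indices is centred and uncorrelated, so all cross terms vanish. This is what isolates the
  residual variance in both error computations.\<close>

lemma (in prob_space) second_moment_indep_noise:
  fixes V :: "nat \<Rightarrow> 'a \<Rightarrow> 'b::second_countable_topology" and Z :: "nat \<Rightarrow> 'a \<Rightarrow> real"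
    and J :: "'l::finite \<Rightarrow> 'a \<Rightarrow> nat" and c :: "'l \<Rightarrow> 'a \<Rightarrow> real"
  assumes ind: "indep_vars (\<lambda>_. borel) (\<lambda>i \<omega>. (V i \<omega>, Z i \<omega>)) I"
    and VZ: "\<And>i. i \<in> I \<Longrightarrow> indep_set {V i -` A \<inter> space M |A. A \<in> sets borel} {Z i -` B \<inter> space M |B. B \<in> sets borel}"
    and Z: "\<And>i. i \<in> I \<Longrightarrow> integrable M (\<lambda>\<omega>. (Z i \<omega>)\<^sup>2)" "\<And>i. i \<in> I \<Longrightarrow> (\<integral>\<omega>. Z i \<omega> \<partial>M) = 0" 
      "\<And>i. i \<in> I \<Longrightarrow> (\<integral>\<omega>. (Z i \<omega>)\<^sup>2 \<partial>M) = s2"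
    and J: "\<And>l. J l \<in> measurable (gen_algebra M I V) (count_space UNIV)"
      "AE \<omega> in M. inj (\<lambda>l. J l \<omega>) \<and> (\<forall>l. J l \<omega> \<in> I)"
    and c: "\<And>l. c l \<in> borel_measurable (gen_algebra M I V)" "c0 \<in> borel_measurable (gen_algebra M I V)"
  shows "(\<integral>\<^sup>+\<omega>. ennreal ((c0 \<omega> + (\<Sum>l\<in>UNIV. c l \<omega> * Z (J l \<omega>) \<omega>))\<^sup>2) \<partial>M)
    = (\<integral>\<^sup>+\<omega>. ennreal ((c0 \<omega>)\<^sup>2 + s2 * (\<Sum>l\<in>UNIV. (c l \<omega>)\<^sup>2)) \<partial>M)"
proof -
  define A B where "A = gen_algebra M I V" and "B = gen_algebra M I Z"
  have rv: "V i \<in> borel_measurable M" "Z i \<in> borel_measurable M" if "i \<in> I" for i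
  proof -
    have *: "(\<lambda>\<omega>. (V i \<omega>, Z i \<omega>)) \<in> borel_measurable M" using ind that unfolding indep_vars_def by blast
    show "V i \<in> borel_measurable M" "Z i \<in> borel_measurable M"
      using measurable_compose[OF * borel_measurable_continuous_onI[OF continuous_on_fst[OF continuous_on_id]]]
        measurable_compose[OF * borel_measurable_continuous_onI[OF continuous_on_snd[OF continuous_on_id]]]
      by simp_all
  qed
  have iZ: "integrable M (Z i)" if "i \<in> I" for i
    using square_integrable_imp_integrable[OF rv(2)[OF that] Z(1)[OF that]] .
  have indZ: "indep_vars (\<lambda>_. borel) Z I"
    using indep_vars_compose2[OF ind, of "\<lambda>_. snd" "\<lambda>_. borel"] borel_measurable_continuous_onI[OF continuous_on_snd[OF continuous_on_id]]
    by simp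
  have ZZ: "integrable M (\<lambda>\<omega>. Z i \<omega> * Z j \<omega>)" "(\<integral>\<omega>. Z i \<omega> * Z j \<omega> \<partial>M) = (if i = j then s2 else 0)" if "i \<in> I" "j \<in> I" for i j
  proof -
    have "integrable M (\<lambda>\<omega>. Z i \<omega> * Z j \<omega>) \<and> (\<integral>\<omega>. Z i \<omega> * Z j \<omega> \<partial>M) = 0" if "i \<noteq> j"
    proof -
      have "indep_vars (\<lambda>_. borel) Z {i, j}" using \<open>i \<in> I\<close> \<open>j \<in> I\<close> by (intro indep_vars_subset[OF indZ]) auto
      moreover have "integrable M (Z k)" if "k \<in> {i, j}" for k using that iZ \<open>i \<in> I\<close> \<open>j \<in> I\<close> by auto
      ultimately have "(\<integral>\<omega>. (\<Prod>k\<in>{i, j}. Z k \<omega>) \<partial>M) = (\<Prod>k\<in>{i, j}. \<integral>\<omega>. Z k \<omega> \<partial>M)"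
        "integrable M (\<lambda>\<omega>. (\<Prod>k\<in>{i, j}. Z k \<omega>))"
        by (simp_all only: indep_vars_lebesgue_integral indep_vars_integrable finite.intros)
      then show ?thesis using that Z(2) \<open>i \<in> I\<close> \<open>j \<in> I\<close> by simp
    qed
    then show "integrable M (\<lambda>\<omega>. Z i \<omega> * Z j \<omega>)" "(\<integral>\<omega>. Z i \<omega> * Z j \<omega> \<partial>M) = (if i = j then s2 else 0)"
      using Z(1,3)[OF that(1)] by (auto simp: power2_eq_square)
  qed
  \<comment> \<open>The value 0 makes \<open>Z' i\<close> measurable for indices outside I as well;
    almost surely J stays in I, so the integral is unchanged.\<close>
  define Z' where "Z' = (\<lambda>i. if i \<in> I then Z i else (\<lambda>_. 0))"
  have Z'[measurable]: "Z' i \<in> borel_measurable B" for i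
    by (auto simp: Z'_def B_def intro: measurable_gen_algebra)
  note [measurable] = J(1)[folded A_def] c[folded A_def]
  define F where "F = (\<lambda>(\<omega>, \<omega>'). ennreal ((c0 \<omega> + (\<Sum>l\<in>UNIV. c l \<omega> * Z' (J l \<omega>) \<omega>'))\<^sup>2))"
  have FM: "F \<in> borel_measurable (A \<Otimes>\<^sub>M B)"
    unfolding F_def by measurable
  have "(\<integral>\<^sup>+\<omega>. ennreal ((c0 \<omega> + (\<Sum>l\<in>UNIV. c l \<omega> * Z (J l \<omega>) \<omega>))\<^sup>2) \<partial>M) = (\<integral>\<^sup>+\<omega>. F (\<omega>, \<omega>) \<partial>M)"
    using J(2) by (intro nn_integral_cong_AE) (auto simp: F_def Z'_def)
  also have "\<dots> = (\<integral>\<^sup>+\<omega>. \<integral>\<^sup>+\<omega>'. F (\<omega>, \<omega>') \<partial>M \<partial>M)"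
    using indep_set_gen_algebra[OF ind VZ] rv sets_gen_algebra_subset[of I V M] sets_gen_algebra_subset[of I Z M]
    by (intro nn_integral_indep_subalgebras[OF _ _ _ _ _ FM]) (simp_all add: A_def B_def space_gen_algebra)
  also have "\<dots> = (\<integral>\<^sup>+\<omega>. ennreal ((c0 \<omega>)\<^sup>2 + s2 * (\<Sum>l\<in>UNIV. (c l \<omega>)\<^sup>2)) \<partial>M)"
  proof (rule nn_integral_cong_AE)
    show "AE \<omega> in M. (\<integral>\<^sup>+\<omega>'. F (\<omega>, \<omega>') \<partial>M) = ennreal ((c0 \<omega>)\<^sup>2 + s2 * (\<Sum>l\<in>UNIV. (c l \<omega>)\<^sup>2))"
      using J(2)
    proof eventually_elim
      case (elim \<omega>)
      then have inj: "inj (\<lambda>l. J l \<omega>)" and JI: "\<And>l. J l \<omega> \<in> I" by auto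
      define y where "y = (\<lambda>l. Z (J l \<omega>))"
      have y: "integrable M (y l)" "(\<integral>\<omega>. y l \<omega> \<partial>M) = 0" "integrable M (\<lambda>\<omega>. y l \<omega> * y m \<omega>)"
        "(\<integral>\<omega>. y l \<omega> * y m \<omega> \<partial>M) = (if l = m then s2 else 0)" for l m
      proof -
        have "J l \<omega> = J m \<omega> \<longleftrightarrow> l = m" using inj by (auto dest: injD)
        then show "integrable M (y l)" "(\<integral>\<omega>. y l \<omega> \<partial>M) = 0" "integrable M (\<lambda>\<omega>. y l \<omega> * y m \<omega>)"
          "(\<integral>\<omega>. y l \<omega> * y m \<omega> \<partial>M) = (if l = m then s2 else 0)"
          using iZ[OF JI] Z(2)[OF JI] ZZ[OF JI JI] by (simp_all add: y_def)
      qed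
      define C where "C = (\<lambda>l. c l \<omega>)"
      have sq: "(c0 \<omega> + (\<Sum>l\<in>UNIV. C l * y l \<omega>'))\<^sup>2 = (c0 \<omega>)\<^sup>2 + (\<Sum>l\<in>UNIV. 2 * c0 \<omega> * C l * y l \<omega>')
         + (\<Sum>l\<in>UNIV. \<Sum>m\<in>UNIV. C l * C m * (y l \<omega>' * y m \<omega>'))" for \<omega>'
      proof -
        define S where "S = (\<Sum>l\<in>UNIV. C l * y l \<omega>')"
        have "(c0 \<omega> + S)\<^sup>2 = (c0 \<omega>)\<^sup>2 + 2 * c0 \<omega> * S + S * S" by (simp add: power2_eq_square algebra_simps)
        moreover have "2 * c0 \<omega> * S = (\<Sum>l\<in>UNIV. 2 * c0 \<omega> * C l * y l \<omega>')"
          unfolding S_def sum_distrib_left by (intro sum.cong refl) simp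
        moreover have "S * S = (\<Sum>l\<in>UNIV. \<Sum>m\<in>UNIV. C l * C m * (y l \<omega>' * y m \<omega>'))"
          unfolding S_def sum_product by (intro sum.cong refl) simp
        ultimately show ?thesis by (simp only: S_def)
      qed
      have "(\<integral>\<^sup>+\<omega>'. F (\<omega>, \<omega>') \<partial>M) = (\<integral>\<^sup>+\<omega>'. ennreal ((c0 \<omega> + (\<Sum>l\<in>UNIV. C l * y l \<omega>'))\<^sup>2) \<partial>M)"
        using JI by (simp add: F_def Z'_def C_def y_def)
      also have "\<dots> = ennreal (\<integral>\<omega>'. (c0 \<omega> + (\<Sum>l\<in>UNIV. C l * y l \<omega>'))\<^sup>2 \<partial>M)"
      proof (rule nn_integral_eq_integral)
        show "integrable M (\<lambda>\<omega>'. (c0 \<omega> + (\<Sum>l\<in>UNIV. C l * y l \<omega>'))\<^sup>2)" unfolding sq using y by auto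
      qed simp
      also have "(\<integral>\<omega>'. (c0 \<omega> + (\<Sum>l\<in>UNIV. C l * y l \<omega>'))\<^sup>2 \<partial>M) = (c0 \<omega>)\<^sup>2 + (\<Sum>l\<in>UNIV. \<Sum>m\<in>UNIV. C l * C m * (if l = m then s2 else 0))"
        unfolding sq using y by (simp add: prob_space)
      also have "(\<Sum>l\<in>UNIV. \<Sum>m\<in>UNIV. C l * C m * (if l = m then s2 else 0)) = s2 * (\<Sum>l\<in>UNIV. (C l)\<^sup>2)"
        by (simp add: sum_distrib_left power2_eq_square mult.commute if_distrib cong: if_cong)
      finally show ?case by (simp add: C_def)
    qed
  qed
  finally show ?thesis .
qed

subsection \<open>Stopped samples\<close>

lemma (in prob_space) indep_set_gen_algebra_disjoint:
  fixes V :: "'i \<Rightarrow> 'a \<Rightarrow> 'b::second_countable_topology"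
  assumes ind: "indep_vars (\<lambda>_. borel) V I" and K: "K \<subseteq> I" "L \<subseteq> I" "K \<inter> L = {}"
  shows "indep_set (sets (gen_algebra M K V)) (sets (gen_algebra M L V))"
proof -
  have "indep_sets (\<lambda>i. {V i -` A \<inter> space M |A. A \<in> sets borel}) (\<Union>b\<in>UNIV. case_bool K L b)"
  proof (rule indep_sets_mono_index)
    show "(\<Union>b\<in>UNIV. case_bool K L b) \<subseteq> I" using K by (auto split: bool.splits)
    show "indep_sets (\<lambda>i. {V i -` A \<inter> space M |A. A \<in> sets borel}) I" using ind unfolding indep_vars_def2 by blast
  qed
  then have "indep_sets (\<lambda>b. sigma_sets (space M) (\<Union>i\<in>case_bool K L b. {V i -` A \<inter> space M |A. A \<in> sets borel})) UNIV"
  proof (rule indep_sets_collect_sigma)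
    fix i
    show "Int_stable {V i -` A \<inter> space M |A. A \<in> sets borel}"
    proof (rule Int_stableI)
      fix P Q assume "P \<in> {V i -` A \<inter> space M |A. A \<in> sets borel}" "Q \<in> {V i -` A \<inter> space M |A. A \<in> sets borel}"
      then obtain A B where "A \<in> sets borel" "B \<in> sets borel" "P = V i -` A \<inter> space M" "Q = V i -` B \<inter> space M"
        by auto
      then show "P \<inter> Q \<in> {V i -` A \<inter> space M |A. A \<in> sets borel}" by (auto intro!: exI[of _ "A \<inter> B"])
    qed
  next
    show "disjoint_family_on (case_bool K L) UNIV"
      using K(3) by (auto simp: disjoint_family_on_def split: bool.splits)
  qed
  moreover have "(\<lambda>b. sigma_sets (space M) (\<Union>i\<in>case_bool K L b. {V i -` A \<inter> space M |A. A \<in> sets borel}))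
    = case_bool (sets (gen_algebra M K V)) (sets (gen_algebra M L V))"
    by (simp add: fun_eq_iff gen_algebra split: bool.split)
  ultimately show ?thesis by (simp add: indep_set_def)
qed

text \<open>Freezing once more: an event decided without looking at sample i leaves the law of that
  sample unchanged.\<close>

lemma (in prob_space) nn_integral_past_independent:
  fixes V :: "'i \<Rightarrow> 'a \<Rightarrow> 'b::second_countable_topology"
  assumes ind: "indep_vars (\<lambda>_. borel) V I" and K: "K \<subseteq> I" "i \<in> I" "i \<notin> K"
    and Q[measurable]: "Q \<in> sets (gen_algebra M K V)" and h[measurable]: "h \<in> borel_measurable borel"
  shows "(\<integral>\<^sup>+\<omega>. indicator Q \<omega> * h (V i \<omega>) \<partial>M) = emeasure M Q * (\<integral>\<^sup>+x. h x \<partial>distr M borel (V i))"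
proof -
  have V: "V j \<in> borel_measurable M" if "j \<in> I" for j using ind that unfolding indep_vars_def2 by blast
  note sub = sets_gen_algebra_subset[of _ V M]
  define B where "B = gen_algebra M {i} V"
  have Vi[measurable]: "V i \<in> borel_measurable B" unfolding B_def by (rule measurable_gen_algebra) simp
  have QM: "Q \<in> sets M" using Q sub[of K] V K by blast
  define F where "F = (\<lambda>(\<omega>, \<omega>'). indicator Q \<omega> * h (V i \<omega>') :: ennreal)"
  have FM: "F \<in> borel_measurable (gen_algebra M K V \<Otimes>\<^sub>M B)" unfolding F_def by measurable
  have "(\<integral>\<^sup>+\<omega>. indicator Q \<omega> * h (V i \<omega>) \<partial>M) = (\<integral>\<^sup>+\<omega>. F (\<omega>, \<omega>) \<partial>M)" by (simp add: F_def)
  also have "\<dots> = (\<integral>\<^sup>+\<omega>. \<integral>\<^sup>+\<omega>'. F (\<omega>, \<omega>') \<partial>M \<partial>M)"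
    using indep_set_gen_algebra_disjoint[OF ind, of K "{i}"] K V sub[of K] sub[of "{i}"]
    by (intro nn_integral_indep_subalgebras[OF _ _ _ _ _ FM]) (auto simp: space_gen_algebra B_def)
  also have "\<dots> = (\<integral>\<^sup>+\<omega>. indicator Q \<omega> * (\<integral>\<^sup>+x. h x \<partial>distr M borel (V i)) \<partial>M)"
    using V[OF K(2)] by (intro nn_integral_cong) (simp add: F_def nn_integral_cmult nn_integral_distr)
  also have "\<dots> = emeasure M Q * (\<integral>\<^sup>+x. h x \<partial>distr M borel (V i))"
    using QM by (simp add: nn_integral_multc)
  finally show ?thesis .
qed

text \<open>As in Wald's identity, the sum over \<open>i\<close> of the probabilities of \<open>Q i\<close> (sample \<open>i\<close> is examined) is at most
  \<open>1 / D(A)\<close>, since at most one examined sample lies in \<open>A\<close>; and \<open>Q i\<close> is independent of sample \<open>i\<close>.\<close>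

lemma (in prob_space) nn_integral_stopped_sample_le:
  fixes V :: "nat \<Rightarrow> 'a \<Rightarrow> 'b::second_countable_topology"
  assumes ind: "indep_vars (\<lambda>_. borel) V I" and D: "\<And>i. i \<in> I \<Longrightarrow> distr M borel (V i) = D"
    and Q: "\<And>i. i \<in> I \<Longrightarrow> Q i \<in> sets (gen_algebra M (I \<inter> {..<i}) V)"
    and A[measurable]: "A \<in> sets borel" and g[measurable]: "g \<in> borel_measurable borel"
    and once: "\<And>\<omega> i j. i \<in> I \<Longrightarrow> j \<in> I \<Longrightarrow> \<omega> \<in> Q i \<Longrightarrow> V i \<omega> \<in> A \<Longrightarrow> \<omega> \<in> Q j \<Longrightarrow> V j \<omega> \<in> A \<Longrightarrow> i = j"
    and J: "AE \<omega> in M. J \<omega> \<in> I \<and> \<omega> \<in> Q (J \<omega>) \<and> V (J \<omega>) \<omega> \<in> A"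
  shows "(\<integral>\<^sup>+\<omega>. g (V (J \<omega>) \<omega>) \<partial>M) * emeasure D A \<le> (\<integral>\<^sup>+x. g x * indicator A x \<partial>D)"
proof -
  have V: "V j \<in> borel_measurable M" if "j \<in> I" for j using ind that unfolding indep_vars_def2 by blast
  \<comment> \<open>\<open>R\<close> and \<open>W\<close> extend \<open>Q\<close> and
    \<open>V\<close> trivially off I, so that the series run over all natural numbers.\<close>
  define R where "R = (\<lambda>i. if i \<in> I then Q i else {})"
  define W where "W = (\<lambda>i. if i \<in> I then V i else (\<lambda>_. undefined))"
  have W[measurable]: "W i \<in> borel_measurable M" for i using V by (simp add: W_def)
  have RM[measurable]: "R i \<in> sets M" for i
    using Q[of i] sets_gen_algebra_subset[of "I \<inter> {..<i}" V M] V by (auto simp: R_def)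
  have step: "(\<integral>\<^sup>+\<omega>. indicator (R i) \<omega> * (h (W i \<omega>) * indicator A (W i \<omega>)) \<partial>M) = emeasure M (R i) * (\<integral>\<^sup>+x. h x * indicator A x \<partial>D)"
    if [measurable]: "h \<in> borel_measurable borel" for h :: "'b \<Rightarrow> ennreal" and i
  proof (cases "i \<in> I")
    case True
    then show ?thesis
      using nn_integral_past_independent[OF ind, of "I \<inter> {..<i}" i "Q i" "\<lambda>x. h x * indicator A x"] Q[OF True] D[OF True]
      by (simp add: R_def W_def)
  qed (simp add: R_def)
  \<comment> \<open>Expected number of examined samples. The identity \<open>sum\<close> is used
    twice: with h = 1 it bounds q by 1 / D(A), with h = g it evaluates the integral over the
    selected sample.\<close>
  define q where "q = (\<Sum>i. emeasure M (R i))"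
  have sum: "(\<integral>\<^sup>+\<omega>. (\<Sum>i. indicator (R i) \<omega> * (h (W i \<omega>) * indicator A (W i \<omega>))) \<partial>M) = q * (\<integral>\<^sup>+x. h x * indicator A x \<partial>D)"
    if [measurable]: "h \<in> borel_measurable borel" for h :: "'b \<Rightarrow> ennreal"
    by (simp add: nn_integral_suminf step q_def)
  have single: "(\<Sum>i. indicator (R i) \<omega> * (h (W i \<omega>) * indicator A (W i \<omega>))) = h (W j \<omega>)"
    if "j \<in> I" "\<omega> \<in> Q j" "V j \<omega> \<in> A" for h :: "'b \<Rightarrow> ennreal" and \<omega> j
  proof -
    have "(\<Sum>i. indicator (R i) \<omega> * (h (W i \<omega>) * indicator A (W i \<omega>))) = (\<Sum>i\<in>{j}. indicator (R i) \<omega> * (h (W i \<omega>) * indicator A (W i \<omega>)))"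
    proof (rule suminf_finite)
      fix i assume "i \<notin> {j}"
      then have "\<not> (i \<in> I \<and> \<omega> \<in> Q i \<and> V i \<omega> \<in> A)" using once[of i j \<omega>] that by blast
      then show "indicator (R i) \<omega> * (h (W i \<omega>) * indicator A (W i \<omega>)) = 0"
        by (cases "i \<in> I") (simp_all add: R_def W_def indicator_def)
    qed simp
    then show ?thesis using that by (simp add: R_def W_def)
  qed
  have "q * emeasure D A \<le> 1"
  proof -

    have "q * emeasure D A = (\<integral>\<^sup>+\<omega>. (\<Sum>i. indicator (R i) \<omega> * (1 * indicator A (W i \<omega>))) \<partial>M)"
    proof (cases "I = {}")
      case False
      then have "sets D = sets borel" using D by fastforce
      then show ?thesis using sum[of "\<lambda>_. 1"] by simp
    qed (simp add: q_def R_def)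
    also have "\<dots> \<le> (\<integral>\<^sup>+\<omega>. 1 \<partial>M)"
    proof (rule nn_integral_mono)
      fix \<omega>
      show "(\<Sum>i. indicator (R i) \<omega> * (1 * indicator A (W i \<omega>))) \<le> (1::ennreal)"
      proof (cases "\<exists>j\<in>I. \<omega> \<in> Q j \<and> V j \<omega> \<in> A")
        case True
        then obtain j where j: "j \<in> I" "\<omega> \<in> Q j" "V j \<omega> \<in> A" by auto
        show ?thesis using single[OF j, of "\<lambda>_. 1"] by simp
      next
        case False
        then have "(\<lambda>i. indicator (R i) \<omega> * (1 * indicator A (W i \<omega>))) = (\<lambda>_. 0::ennreal)"
          by (auto simp: R_def W_def indicator_def fun_eq_iff)
        then show ?thesis by simp
      qed
    qed
    also have "\<dots> = 1" by (simp add: emeasure_space_1)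
    finally show ?thesis .
  qed
  have "(\<integral>\<^sup>+\<omega>. g (V (J \<omega>) \<omega>) \<partial>M) = (\<integral>\<^sup>+\<omega>. (\<Sum>i. indicator (R i) \<omega> * (g (W i \<omega>) * indicator A (W i \<omega>))) \<partial>M)"
  proof (rule nn_integral_cong_AE)
    show "AE \<omega> in M. g (V (J \<omega>) \<omega>) = (\<Sum>i. indicator (R i) \<omega> * (g (W i \<omega>) * indicator A (W i \<omega>)))"
      using J
    proof eventually_elim
      case (elim \<omega>)
      then have "W (J \<omega>) = V (J \<omega>)" by (simp add: W_def)
      then show ?case using single[of "J \<omega>" \<omega> g] elim by simp
    qed
  qed
  then have "(\<integral>\<^sup>+\<omega>. g (V (J \<omega>) \<omega>) \<partial>M) * emeasure D A = (q * emeasure D A) * (\<integral>\<^sup>+x. g x * indicator A x \<partial>D)"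
    using sum[OF g] by (simp add: ac_simps)
  also have "\<dots> \<le> 1 * (\<integral>\<^sup>+x. g x * indicator A x \<partial>D)" using \<open>q * emeasure D A \<le> 1\<close> by (rule mult_right_mono) simp
  finally show ?thesis by simp
qed

text \<open>Any m samples beyond n all miss A with probability p^m, where p < 1 and m is arbitrary.
  Such visits ensure that the \<open>LEAST\<close> in the stopping rules is attained.\<close>

lemma (in prob_space) AE_infinitely_often:
  fixes V :: "nat \<Rightarrow> 'a \<Rightarrow> 'b::second_countable_topology"
  assumes ind: "indep_vars (\<lambda>_. borel) V I" and D: "\<And>i. i \<in> I \<Longrightarrow> distr M borel (V i) = D"
    and I: "infinite I" and A[measurable]: "A \<in> sets borel" and pos: "emeasure D A > 0"
  shows "AE \<omega> in M. \<forall>n. \<exists>i\<in>I. n < i \<and> V i \<omega> \<in> A"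
proof (subst AE_all_countable, rule allI)
  fix n
  have V: "V j \<in> borel_measurable M" if "j \<in> I" for j using ind that unfolding indep_vars_def2 by blast
  define p where "p = measure D (- A)"
  obtain i0 where i0: "i0 \<in> I" using I by fastforce
  have "D = distr M borel (V i0)" using D[OF i0] by simp
  then interpret D: prob_space D using V[OF i0] by (simp add: prob_space_distr)
  have setsD: "sets D = sets borel" "space D = UNIV" using D[OF i0] by auto
  have "p = 1 - measure D A" unfolding p_def using D.prob_compl[of A] setsD by (simp add: Compl_eq_Diff_UNIV)
  moreover have "measure D A > 0" using pos by (simp add: D.emeasure_eq_measure)
  moreover have "p \<ge> 0" by (simp add: p_def)
  ultimately have p: "0 \<le> p" "p < 1" by auto
  define N where "N = {\<omega>\<in>space M. \<forall>i\<in>I. n < i \<longrightarrow> V i \<omega> \<notin> A}"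
  define W where "W = (\<lambda>i. if i \<in> I then V i else V i0)"
  have [measurable]: "W i \<in> borel_measurable M" for i using V i0 by (simp add: W_def)
  have N: "N = {\<omega>\<in>space M. \<forall>i. i \<in> I \<and> n < i \<longrightarrow> W i \<omega> \<notin> A}" by (auto simp: N_def W_def)
  have NM: "N \<in> sets M" unfolding N by measurable
  have bound: "prob N \<le> p ^ m" for m
  proof (cases "m = 0")
    case False
    have "infinite (I \<inter> {n<..})"
    proof
      assume "finite (I \<inter> {n<..})"
      then have "finite (I \<inter> {n<..} \<union> {..n})" by simp
      moreover have "I \<subseteq> I \<inter> {n<..} \<union> {..n}" by auto
      ultimately have "finite I" by (rule finite_subset[rotated])
      then show False using I by contradiction
    qed
    then obtain K where K: "K \<subseteq> I \<inter> {n<..}" "finite K" "card K = m" by (meson infinite_arbitrarily_large)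
    then have "K \<noteq> {}" using False by auto
    have "prob N \<le> prob (\<Inter>i\<in>K. V i -` (- A) \<inter> space M)"
    proof (rule finite_measure_mono)
      show "N \<subseteq> (\<Inter>i\<in>K. V i -` (- A) \<inter> space M)" using K by (auto simp: N_def)
      show "(\<Inter>i\<in>K. V i -` (- A) \<inter> space M) \<in> events"
        using K \<open>K \<noteq> {}\<close> V by (intro sets.finite_INT measurable_sets[OF V]) auto
    qed
    also have "\<dots> = (\<Prod>i\<in>K. prob (V i -` (- A) \<inter> space M))"
      using K \<open>K \<noteq> {}\<close> by (intro indep_varsD[OF ind]) auto
    also have "\<dots> = (\<Prod>i\<in>K. p)"
    proof (rule prod.cong)
      fix i assume "i \<in> K"
      then have "i \<in> I" using K by auto
      then show "prob (V i -` (- A) \<inter> space M) = p"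
        unfolding p_def D[OF \<open>i \<in> I\<close>, symmetric] using V[OF \<open>i \<in> I\<close>] by (subst measure_distr) auto
    qed simp
    finally show ?thesis using K by simp
  qed simp
  have "(\<lambda>m. p ^ m) \<longlonglongrightarrow> 0" using p by (intro LIMSEQ_power_zero) auto
  then have "prob N \<le> 0" using bound by (intro LIMSEQ_le_const) auto
  then have "emeasure M N = 0" by (simp add: emeasure_eq_measure measure_le_0_iff)
  then have "AE \<omega> in M. \<omega> \<notin> N" using NM by (intro AE_not_in) (simp add: null_sets_def)
  then show "AE \<omega> in M. \<exists>i\<in>I. n < i \<and> V i \<omega> \<in> A" using AE_space by eventually_elim (auto simp: N_def)
qed

subsection \<open>The selected scalar sample\<close>

lemma max_index:
  fixes x :: "nat \<Rightarrow> real"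
  assumes "N > 0"
  shows "max_index N x < N" "i < N \<Longrightarrow> x i \<le> x (max_index N x)"
proof -
  have "finite (x ` {..<N})" "x ` {..<N} \<noteq> {}" using assms by auto
  then have "Max (x ` {..<N}) \<in> x ` {..<N}" "\<And>i. i < N \<Longrightarrow> x i \<le> Max (x ` {..<N})"
    using Max_in[of "x ` {..<N}"] by auto
  then obtain j where "j < N" "\<forall>i<N. x i \<le> x j" by (metis imageE lessThan_iff)
  then have "max_index N x < N \<and> (\<forall>i<N. x i \<le> x (max_index N x))"
    unfolding max_index_def by (intro LeastI[of "\<lambda>j. j < N \<and> (\<forall>i<N. x i \<le> x j)"] conjI) auto
  then show "max_index N x < N" "i < N \<Longrightarrow> x i \<le> x (max_index N x)" by auto
qed

lemma gauss_second_moment: "(\<integral>\<^sup>+x. ennreal (a + b * x\<^sup>2) \<partial>gauss) = ennreal (a + b)" if "a \<ge> 0" "b \<ge> 0"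
proof -
  have i: "integrable lborel (\<lambda>x. std_normal_density x * x\<^sup>2)" using integrable_std_normal_moment[of 2] .
  have m: "(\<integral>x. std_normal_density x * x\<^sup>2 \<partial>lborel) = 1" using integral_std_normal_moment_even[of 1] by simp
  have "(\<integral>\<^sup>+x. ennreal (a + b * x\<^sup>2) \<partial>gauss) = (\<integral>\<^sup>+x. ennreal (std_normal_density x * (a + b * x\<^sup>2)) \<partial>lborel)"
    using that by (subst nn_integral_density) (auto simp: ennreal_mult)
  also have "\<dots> = ennreal (\<integral>x. std_normal_density x * (a + b * x\<^sup>2) \<partial>lborel)"
  proof (rule nn_integral_eq_integral)
    have "integrable lborel (\<lambda>x. a * std_normal_density x + b * (std_normal_density x * x\<^sup>2))" using i by auto
    then show "integrable lborel (\<lambda>x. std_normal_density x * (a + b * x\<^sup>2))" by (simp add: algebra_simps)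
  qed (use that in auto)
  also have "(\<integral>x. std_normal_density x * (a + b * x\<^sup>2) \<partial>lborel) = (\<integral>x. a * std_normal_density x + b * (std_normal_density x * x\<^sup>2) \<partial>lborel)"
    by (intro Bochner_Integration.integral_cong refl) (simp add: algebra_simps)
  also have "\<dots> = a + b" using i m by simp
  finally show ?thesis .
qed

text \<open>An instance of \<open>nn_integral_stopped_sample_le\<close> with A = (t, inf) and
  \<open>Q i\<close> the event that no sample before i exceeds t. The factor D(A) = Q(t) cancels
  against the one in \<open>truncated_second_moment\<close>.\<close>

lemma (in prob_space) second_moment_threshold:
  fixes x :: "nat \<Rightarrow> 'a \<Rightarrow> real"
  assumes ind: "indep_vars (\<lambda>_. borel) x UNIV" and D: "\<And>j. distr M borel (x j) = gauss" and t: "t \<ge> 1"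
  shows "(\<integral>\<^sup>+\<omega>. ennreal ((x (threshold_index t (\<lambda>j. x j \<omega>)) \<omega> - t)\<^sup>2) \<partial>M) \<le> ennreal (4 / t\<^sup>2)"
proof -
  define Q where "Q = (\<lambda>i. {\<omega>\<in>space M. \<forall>n<i. x n \<omega> \<le> t})"
  have D': "\<And>j. j \<in> UNIV \<Longrightarrow> distr M borel (x j) = gauss" using D by simp
  have eA: "emeasure gauss {t<..} = ennreal (Qfun t)"
    using measure_gauss_greater[of t] prob_space.finite_measure[OF prob_space_gauss] by (simp add: finite_measure.emeasure_eq_measure)
  have "AE \<omega> in M. \<forall>n. \<exists>i\<in>UNIV. n < i \<and> x i \<omega> \<in> {t<..}"
    using eA Qfun_pos[of t] by (intro AE_infinitely_often[OF ind D']) auto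
  then have J: "AE \<omega> in M. threshold_index t (\<lambda>j. x j \<omega>) \<in> UNIV \<and> \<omega> \<in> Q (threshold_index t (\<lambda>j. x j \<omega>)) \<and> x (threshold_index t (\<lambda>j. x j \<omega>)) \<omega> \<in> {t<..}"
    using AE_space
  proof eventually_elim
    case (elim \<omega>)
    then have ex: "\<exists>i. x i \<omega> > t" by auto
    have "x (threshold_index t (\<lambda>j. x j \<omega>)) \<omega> > t"
      unfolding threshold_index_def by (rule LeastI_ex[OF ex])
    moreover have "\<forall>n<threshold_index t (\<lambda>j. x j \<omega>). x n \<omega> \<le> t"
      unfolding threshold_index_def by (auto dest: not_less_Least)
    ultimately show ?case using elim by (simp add: Q_def)
  qed
  have QM: "Q i \<in> sets (gen_algebra M (UNIV \<inter> {..<i}) x)" for i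
  proof -
    define G where "G = gen_algebra M (UNIV \<inter> {..<i}) x"
    have xG: "x n \<in> borel_measurable G" if "n < i" for n unfolding G_def using that by (intro measurable_gen_algebra) auto
    have "{\<omega>\<in>space G. \<forall>n\<in>{..<i}. x n \<omega> \<le> t} \<in> sets G"
    proof (rule sets.sets_Collect_finite_All)
      fix n assume "n \<in> {..<i}"
      then have [measurable]: "x n \<in> borel_measurable G" by (simp add: xG)
      show "{\<omega>\<in>space G. x n \<omega> \<le> t} \<in> sets G" by measurable
    qed simp
    moreover have "Q i = {\<omega>\<in>space G. \<forall>n\<in>{..<i}. x n \<omega> \<le> t}" unfolding G_def Q_def space_gen_algebra by auto
    ultimately show ?thesis unfolding G_def by (simp only:)
  qed
  have "(\<integral>\<^sup>+\<omega>. ennreal ((x (threshold_index t (\<lambda>j. x j \<omega>)) \<omega> - t)\<^sup>2) \<partial>M) * emeasure gauss {t<..}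
    \<le> (\<integral>\<^sup>+y. ennreal ((y - t)\<^sup>2) * indicator {t<..} y \<partial>gauss)"
  proof (rule nn_integral_stopped_sample_le[OF ind D' QM _ _ _ J])
    fix \<omega> i j assume *: "\<omega> \<in> Q i" "x i \<omega> \<in> {t<..}" "\<omega> \<in> Q j" "x j \<omega> \<in> {t<..}"
    then show "i = j" by (cases i j rule: linorder_cases) (auto simp: Q_def not_le[symmetric])
  qed auto
  also have "\<dots> \<le> (\<integral>\<^sup>+y. ennreal ((y - t)\<^sup>2) * indicator {t..} y \<partial>gauss)"
    by (intro nn_integral_mono) (auto split: split_indicator)
  also have "\<dots> \<le> ennreal (4 / t\<^sup>2 * Qfun t)" by (rule truncated_second_moment[OF t])
  finally have "(\<integral>\<^sup>+\<omega>. ennreal ((x (threshold_index t (\<lambda>j. x j \<omega>)) \<omega> - t)\<^sup>2) \<partial>M) * ennreal (Qfun t) \<le> ennreal (4 / t\<^sup>2) * ennreal (Qfun t)"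
    using t Qfun_pos[of t] unfolding eA by (simp add: ennreal_mult[symmetric])
  then show ?thesis
    using Qfun_pos[of t] ennreal_mult_le_mult_iff[of "ennreal (Qfun t)"] by (simp add: mult.commute)
qed

text \<open>If all samples lie below \<open>t - \<epsilon>\<close>, the maximum is bounded below by the first sample, which is
  independent of the other \<open>N - 1\<close>.\<close>

lemma (in prob_space) second_moment_max:
  fixes x :: "nat \<Rightarrow> 'a \<Rightarrow> real"
  assumes ind: "indep_vars (\<lambda>_. borel) x UNIV" and D: "\<And>j. distr M borel (x j) = gauss" 
    and t: "t \<ge> 1" and N: "N \<ge> 2" "Qfun t = 1 / real N" and e: "0 \<le> \<epsilon>"
  shows "(\<integral>\<^sup>+\<omega>. ennreal ((x (max_index N (\<lambda>j. x j \<omega>)) \<omega> - t)\<^sup>2) \<partial>M) 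
    \<le> ennreal (4 / t\<^sup>2 + \<epsilon>\<^sup>2 + (2 * t\<^sup>2 + 2) * (1 - Qfun (t - \<epsilon>)) ^ (N - 1))"
proof -
  have xM[measurable]: "x j \<in> borel_measurable M" for j using ind unfolding indep_vars_def2 by blast
  have xint: "(\<integral>\<^sup>+\<omega>. h (x j \<omega>) \<partial>M) = (\<integral>\<^sup>+y. h y \<partial>gauss)" if [measurable]: "h \<in> borel_measurable borel" for h :: "real \<Rightarrow> ennreal" and j
    unfolding D[symmetric, of j] by (subst nn_integral_distr) auto
  \<comment> \<open>One factor per sample: the first carries (t - x 0)^2 <= 2 t^2 + 2 (x 0)^2, the
    others indicate values of at most t - eps. By independence the product has expectation (2 t^2 +
    2) q^(N-1).\<close>
  define u where "u = (\<lambda>i::nat. if i = 0 then (\<lambda>y. ennreal (2 * t\<^sup>2 + 2 * y\<^sup>2)) else (\<lambda>y::real. indicator {..t-\<epsilon>} y :: ennreal))"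
  have [measurable]: "u i \<in> borel_measurable borel" for i :: nat by (simp add: u_def)
  define q where "q = 1 - Qfun (t - \<epsilon>)"
  have q: "q \<ge> 0" unfolding q_def measure_gauss_atMost[symmetric] by simp
  have "(\<integral>\<^sup>+\<omega>. ennreal ((x (max_index N (\<lambda>j. x j \<omega>)) \<omega> - t)\<^sup>2) \<partial>M) 
    \<le> (\<integral>\<^sup>+\<omega>. (\<Sum>i<N. ennreal ((x i \<omega> - t)\<^sup>2) * indicator {t..} (x i \<omega>)) + ennreal (\<epsilon>\<^sup>2) + (\<Prod>i<N. u i (x i \<omega>)) \<partial>M)"
  proof (rule nn_integral_mono)
    fix \<omega>
    define m where "m = max_index N (\<lambda>j. x j \<omega>)"
    have m: "m < N" "\<And>i. i < N \<Longrightarrow> x i \<omega> \<le> x m \<omega>"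
      using max_index(1)[of N "\<lambda>j. x j \<omega>"] max_index(2)[of N _ "\<lambda>j. x j \<omega>"] N unfolding m_def by auto
    \<comment> \<open>An overshoot is charged to the sum over all samples, which costs N Q(t) 4/t^2
      = 4/t^2; a shortfall below eps costs eps^2; a larger one forces all samples to be at most t -
      eps and is charged to the product.\<close>
    consider "x m \<omega> \<ge> t" | "t - \<epsilon> < x m \<omega>" "x m \<omega> < t" | "x m \<omega> < t" "x m \<omega> \<le> t - \<epsilon>" by linarith
    then have "ennreal ((x m \<omega> - t)\<^sup>2) \<le> (\<Sum>i<N. ennreal ((x i \<omega> - t)\<^sup>2) * indicator {t..} (x i \<omega>)) + ennreal (\<epsilon>\<^sup>2) + (\<Prod>i<N. u i (x i \<omega>))"
    proof cases
      case 1
      then have "ennreal ((x m \<omega> - t)\<^sup>2) \<le> (\<Sum>i<N. ennreal ((x i \<omega> - t)\<^sup>2) * indicator {t..} (x i \<omega>))"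
        using m member_le_sum[of m "{..<N}" "\<lambda>i. ennreal ((x i \<omega> - t)\<^sup>2) * indicator {t..} (x i \<omega>)"] by simp
      then show ?thesis by (meson add_increasing2 order_trans zero_le)
    next
      case 2
      then have "\<bar>x m \<omega> - t\<bar> \<le> \<bar>\<epsilon>\<bar>" by simp
      then have "(x m \<omega> - t)\<^sup>2 \<le> \<epsilon>\<^sup>2" by (simp only: abs_le_square_iff)
      then have "ennreal ((x m \<omega> - t)\<^sup>2) \<le> ennreal (\<epsilon>\<^sup>2)" by (rule ennreal_leI)
      also have "\<dots> \<le> (\<Sum>i<N. ennreal ((x i \<omega> - t)\<^sup>2) * indicator {t..} (x i \<omega>)) + ennreal (\<epsilon>\<^sup>2)"
        by (rule add_increasing) simp_all
      also have "\<dots> \<le> (\<Sum>i<N. ennreal ((x i \<omega> - t)\<^sup>2) * indicator {t..} (x i \<omega>)) + ennreal (\<epsilon>\<^sup>2) + (\<Prod>i<N. u i (x i \<omega>))"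
        by (rule add_increasing2) simp_all
      finally show ?thesis .
    next
      case 3
      have "x 0 \<omega> \<le> x m \<omega>" using m N by auto
      then have "(t - x m \<omega>)\<^sup>2 \<le> (t - x 0 \<omega>)\<^sup>2" using 3 by (intro power_mono) auto
      also have "\<dots> \<le> 2 * t\<^sup>2 + 2 * (x 0 \<omega>)\<^sup>2"
        using zero_le_power2[of "t + x 0 \<omega>"] by (simp add: power2_eq_square algebra_simps)
      finally have "ennreal ((x m \<omega> - t)\<^sup>2) \<le> ennreal (2 * t\<^sup>2 + 2 * (x 0 \<omega>)\<^sup>2)" by (intro ennreal_leI) (simp add: power2_commute)
      also have "\<dots> = (\<Prod>i<N. u i (x i \<omega>))"
      proof -
        have "{..<N} = insert 0 {1..<N}" using N by auto
        then have "(\<Prod>i<N. u i (x i \<omega>)) = u 0 (x 0 \<omega>) * (\<Prod>i\<in>{1..<N}. u i (x i \<omega>))" by simp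
        moreover have "(\<Prod>i\<in>{1..<N}. u i (x i \<omega>)) = 1"
          using m(2) 3 by (intro prod.neutral) (force simp: u_def)
        ultimately show ?thesis by (simp add: u_def)
      qed
      finally show ?thesis by (rule add_increasing[rotated]) simp
    qed
    then show "ennreal ((x (max_index N (\<lambda>j. x j \<omega>)) \<omega> - t)\<^sup>2) \<le> (\<Sum>i<N. ennreal ((x i \<omega> - t)\<^sup>2) * indicator {t..} (x i \<omega>)) + ennreal (\<epsilon>\<^sup>2) + (\<Prod>i<N. u i (x i \<omega>))"
      by (simp add: m_def)
  qed
  also have "\<dots> = (\<Sum>i<N. \<integral>\<^sup>+\<omega>. ennreal ((x i \<omega> - t)\<^sup>2) * indicator {t..} (x i \<omega>) \<partial>M) + ennreal (\<epsilon>\<^sup>2) + (\<integral>\<^sup>+\<omega>. (\<Prod>i<N. u i (x i \<omega>)) \<partial>M)"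
  proof -
    define h where "h = (\<lambda>i \<omega>. ennreal ((x i \<omega> - t)\<^sup>2) * indicator {t..} (x i \<omega>))"
    have [measurable]: "h i \<in> borel_measurable M" for i unfolding h_def by measurable
    have "(\<integral>\<^sup>+\<omega>. (\<Sum>i<N. h i \<omega>) + ennreal (\<epsilon>\<^sup>2) + (\<Prod>i<N. u i (x i \<omega>)) \<partial>M)
      = (\<Sum>i<N. \<integral>\<^sup>+\<omega>. h i \<omega> \<partial>M) + ennreal (\<epsilon>\<^sup>2) + (\<integral>\<^sup>+\<omega>. (\<Prod>i<N. u i (x i \<omega>)) \<partial>M)"
      by (simp add: nn_integral_add nn_integral_sum emeasure_space_1)
    then show ?thesis by (simp only: h_def)
  qed
  finally have main: "(\<integral>\<^sup>+\<omega>. ennreal ((x (max_index N (\<lambda>j. x j \<omega>)) \<omega> - t)\<^sup>2) \<partial>M) \<le>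
    (\<Sum>i<N. \<integral>\<^sup>+\<omega>. ennreal ((x i \<omega> - t)\<^sup>2) * indicator {t..} (x i \<omega>) \<partial>M) + ennreal (\<epsilon>\<^sup>2) + (\<integral>\<^sup>+\<omega>. (\<Prod>i<N. u i (x i \<omega>)) \<partial>M)" .
  have "(\<integral>\<^sup>+\<omega>. (\<Prod>i<N. u i (x i \<omega>)) \<partial>M) = (\<Prod>i<N. \<integral>\<^sup>+\<omega>. u i (x i \<omega>) \<partial>M)"
    by (intro indep_vars_nn_integral indep_vars_compose2[OF indep_vars_subset[OF ind]]) auto
  also have "\<dots> = ennreal ((2 * t\<^sup>2 + 2) * q ^ (N - 1))"
  proof -
    have "{..<N} = insert 0 {1..<N}" using N by auto
    then have split: "(\<Prod>i<N. \<integral>\<^sup>+\<omega>. u i (x i \<omega>) \<partial>M) = (\<integral>\<^sup>+\<omega>. u 0 (x 0 \<omega>) \<partial>M) * (\<Prod>i\<in>{1..<N}. \<integral>\<^sup>+\<omega>. u i (x i \<omega>) \<partial>M)" by simp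
    have u0: "(\<integral>\<^sup>+\<omega>. u 0 (x 0 \<omega>) \<partial>M) = ennreal (2 * t\<^sup>2 + 2)"
      using xint[of "u 0" 0] gauss_second_moment[of "2 * t\<^sup>2" 2] by (simp add: u_def)
    have "(\<Prod>i\<in>{1..<N}. \<integral>\<^sup>+\<omega>. u i (x i \<omega>) \<partial>M) = (\<Prod>i\<in>{1..<N}. ennreal q)"
    proof (rule prod.cong)
      fix i assume "i \<in> {1..<N}"
      then have "(\<integral>\<^sup>+\<omega>. u i (x i \<omega>) \<partial>M) = (\<integral>\<^sup>+y. indicator {..t-\<epsilon>} y \<partial>gauss)"
        using xint[of "u i" i] by (simp add: u_def)
      also have "\<dots> = emeasure gauss {..t-\<epsilon>}" by (rule nn_integral_indicator) simp
      also have "\<dots> = ennreal q"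
        using measure_gauss_atMost[of "t-\<epsilon>"] prob_space.finite_measure[OF prob_space_gauss]
        by (simp add: finite_measure.emeasure_eq_measure q_def)
      finally show "(\<integral>\<^sup>+\<omega>. u i (x i \<omega>) \<partial>M) = ennreal q" .
    qed simp
    also have "\<dots> = ennreal (q ^ (N - 1))" using q by (simp add: ennreal_power)
    finally show ?thesis using q unfolding split u0 by (simp add: ennreal_mult)
  qed
  finally have P: "(\<integral>\<^sup>+\<omega>. (\<Prod>i<N. u i (x i \<omega>)) \<partial>M) = ennreal ((2 * t\<^sup>2 + 2) * q ^ (N - 1))" .
  have "(\<Sum>i<N. \<integral>\<^sup>+\<omega>. ennreal ((x i \<omega> - t)\<^sup>2) * indicator {t..} (x i \<omega>) \<partial>M) \<le> (\<Sum>i<N. ennreal (4 / t\<^sup>2 * Qfun t))"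
  proof (rule sum_mono)
    fix i
    have "(\<integral>\<^sup>+\<omega>. ennreal ((x i \<omega> - t)\<^sup>2) * indicator {t..} (x i \<omega>) \<partial>M) = (\<integral>\<^sup>+y. ennreal ((y - t)\<^sup>2) * indicator {t..} y \<partial>gauss)"
      by (rule xint) simp
    then show "(\<integral>\<^sup>+\<omega>. ennreal ((x i \<omega> - t)\<^sup>2) * indicator {t..} (x i \<omega>) \<partial>M) \<le> ennreal (4 / t\<^sup>2 * Qfun t)"
      using truncated_second_moment[OF t] by simp
  qed
  also have "(\<Sum>i<N. ennreal (4 / t\<^sup>2 * Qfun t)) = ennreal (4 / t\<^sup>2)"
    using N t by (simp add: ennreal_of_nat_eq_real_of_nat ennreal_mult[symmetric])
  finally have S: "(\<Sum>i<N. \<integral>\<^sup>+\<omega>. ennreal ((x i \<omega> - t)\<^sup>2) * indicator {t..} (x i \<omega>) \<partial>M) \<le> ennreal (4 / t\<^sup>2)" .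
  have "(\<integral>\<^sup>+\<omega>. ennreal ((x (max_index N (\<lambda>j. x j \<omega>)) \<omega> - t)\<^sup>2) \<partial>M) \<le> ennreal (4 / t\<^sup>2) + ennreal (\<epsilon>\<^sup>2) + ennreal ((2 * t\<^sup>2 + 2) * q ^ (N - 1))"
    using main S unfolding P by (meson add_right_mono order_trans)
  also have "\<dots> = ennreal (4 / t\<^sup>2 + \<epsilon>\<^sup>2 + (2 * t\<^sup>2 + 2) * q ^ (N - 1))"
    using q by (simp add: ennreal_plus[symmetric] del: ennreal_plus)
  finally show ?thesis by (simp only: q_def)
qed

subsection \<open>Gaussian vectors\<close>

lemma borel_measurable_vecI:
  fixes f :: "'a \<Rightarrow> real ^ 'd"
  assumes "\<And>i. (\<lambda>x. f x $ i) \<in> borel_measurable N"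
  shows "f \<in> borel_measurable N"
proof (subst borel_measurable_euclidean_space, rule ballI)
  fix b :: "real^'d" assume "b \<in> Basis"
  then obtain i where "b = axis i 1" by (auto simp: Basis_vec_def)
  then show "(\<lambda>x. f x \<bullet> b) \<in> borel_measurable N" using assms[of i] by (simp add: inner_axis)
qed

lemma borel_measurable_vec_nth[measurable]: "(\<lambda>w::real^'d. w $ j) \<in> borel_measurable borel"
  by (intro borel_measurable_continuous_onI continuous_intros)

text \<open>The point mass obeys the same formulas with \<sigma> = 0, so degenerate functionals need
  no separate treatment afterwards.\<close>

lemma (in prob_space) gaussian_rv_moments:
  assumes "gaussian_rv M \<mu> \<sigma> Z"
  shows "integrable M (\<lambda>\<omega>. (Z \<omega>)\<^sup>2)" "(\<integral>\<omega>. Z \<omega> \<partial>M) = \<mu>" "(\<integral>\<omega>. (Z \<omega> - \<mu>)\<^sup>2 \<partial>M) = \<sigma>\<^sup>2"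
    "(\<integral>\<omega>. iexp (Z \<omega>) \<partial>M) = exp (\<i> * \<mu> - \<sigma>\<^sup>2 / 2)"
proof -
  have [measurable]: "Z \<in> borel_measurable M" using assms by (simp add: gaussian_rv_def)
  consider "\<sigma> = 0" "AE \<omega> in M. Z \<omega> = \<mu>" | "\<sigma> > 0" "distributed M lborel Z (normal_density \<mu> \<sigma>)"
    using assms by (auto simp: gaussian_rv_def)
  then have "integrable M (\<lambda>\<omega>. (Z \<omega>)\<^sup>2) \<and> (\<integral>\<omega>. Z \<omega> \<partial>M) = \<mu> \<and> (\<integral>\<omega>. (Z \<omega> - \<mu>)\<^sup>2 \<partial>M) = \<sigma>\<^sup>2
    \<and> (\<integral>\<omega>. iexp (Z \<omega>) \<partial>M) = exp (\<i> * \<mu> - \<sigma>\<^sup>2 / 2)"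
  proof cases
    case 1
    have "integrable M (\<lambda>\<omega>. (Z \<omega>)\<^sup>2)"
    proof (rule integrable_cong_AE_imp[where g = "\<lambda>_. \<mu>\<^sup>2"])
      show "AE \<omega> in M. \<mu>\<^sup>2 = (Z \<omega>)\<^sup>2" using 1(2) by eventually_elim simp
    qed simp_all
    moreover have "(\<integral>\<omega>. Z \<omega> \<partial>M) = (\<integral>\<omega>. \<mu> \<partial>M)" "(\<integral>\<omega>. (Z \<omega> - \<mu>)\<^sup>2 \<partial>M) = (\<integral>\<omega>. 0 \<partial>M)"
      "(\<integral>\<omega>. iexp (Z \<omega>) \<partial>M) = (\<integral>\<omega>. iexp \<mu> \<partial>M)"
      by (rule integral_cong_AE; use 1 in auto)+
    ultimately show ?thesis using 1(1) by (simp add: prob_space)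
  next
    case 2
    define N where "N = (\<lambda>\<omega>. (Z \<omega> - \<mu>) / \<sigma>)"
    have N: "distributed M lborel N std_normal_density"
      using 2 normal_standard_normal_convert[OF 2(1), of Z \<mu>] by (simp add: N_def)
    have ZN: "Z \<omega> = \<mu> + \<sigma> * N \<omega>" for \<omega> using 2(1) by (simp add: N_def)
    have [measurable]: "N \<in> borel_measurable M" unfolding N_def by measurable
    have i2: "integrable M (\<lambda>\<omega>. (N \<omega>)\<^sup>2)"
      using distributed_integrable[OF N, of "\<lambda>x. x\<^sup>2"] integrable_std_normal_moment[of 2] by simp
    have i1: "integrable M N"
      using distributed_integrable[OF N, of "\<lambda>x. x"] integrable_std_normal_moment[of 1] by simp
    have e1: "(\<integral>\<omega>. N \<omega> \<partial>M) = 0"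
      using distributed_integral[OF N, of "\<lambda>x. x"] integral_std_normal_moment_odd[of 0] by simp
    have e2: "(\<integral>\<omega>. (N \<omega>)\<^sup>2 \<partial>M) = 1"
      using distributed_integral[OF N, of "\<lambda>x. x\<^sup>2"] integral_std_normal_moment_even[of 1] by simp
    have dN: "distr M borel N = std_normal_distribution"
    proof -
      have "distr M borel N = distr M lborel N" by (rule distr_cong) auto
      then show ?thesis using distributed_distr_eq_density[OF N] by simp
    qed
    have "(\<integral>\<omega>. iexp (Z \<omega>) \<partial>M) = (\<integral>\<omega>. iexp \<mu> * iexp (\<sigma> * N \<omega>) \<partial>M)"
      by (intro Bochner_Integration.integral_cong refl) (simp add: ZN distrib_left exp_add)
    also have "\<dots> = iexp \<mu> * char (distr M borel N) \<sigma>"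
      unfolding char_def by (simp add: integral_distr del: of_real_mult)
    also have "\<dots> = exp (\<i> * \<mu> - \<sigma>\<^sup>2 / 2)"
      unfolding dN char_std_normal_distribution by (simp add: exp_of_real[symmetric] exp_add[symmetric])
    finally have "(\<integral>\<omega>. iexp (Z \<omega>) \<partial>M) = exp (\<i> * \<mu> - \<sigma>\<^sup>2 / 2)" .
    moreover have "integrable M (\<lambda>\<omega>. (Z \<omega>)\<^sup>2)"
      unfolding ZN power2_sum power_mult_distrib using i1 i2 by (auto simp: mult.assoc)
    moreover have "(\<integral>\<omega>. Z \<omega> \<partial>M) = \<mu>" unfolding ZN using i1 e1 by (simp add: prob_space)
    moreover have "(\<integral>\<omega>. (Z \<omega> - \<mu>)\<^sup>2 \<partial>M) = \<sigma>\<^sup>2" unfolding ZN using e2 by (simp add: power_mult_distrib)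
    ultimately show ?thesis by simp
  qed
  then show "integrable M (\<lambda>\<omega>. (Z \<omega>)\<^sup>2)" "(\<integral>\<omega>. Z \<omega> \<partial>M) = \<mu>" "(\<integral>\<omega>. (Z \<omega> - \<mu>)\<^sup>2 \<partial>M) = \<sigma>\<^sup>2"
    "(\<integral>\<omega>. iexp (Z \<omega>) \<partial>M) = exp (\<i> * \<mu> - \<sigma>\<^sup>2 / 2)" by auto
qed

lemma (in prob_space) gaussian_rv_standard:
  assumes "gaussian_rv M \<mu> \<sigma> Z" "(\<integral>\<omega>. Z \<omega> \<partial>M) = 0" "(\<integral>\<omega>. (Z \<omega>)\<^sup>2 \<partial>M) = 1"
  shows "distr M borel Z = gauss"
proof -
  have "\<mu> = 0" using gaussian_rv_moments(2)[OF assms(1)] assms(2) by simp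
  then have "\<sigma>\<^sup>2 = 1" using gaussian_rv_moments(3)[OF assms(1)] assms(3) by simp
  then have "\<sigma> \<noteq> 0" "\<sigma> > 0 \<Longrightarrow> \<sigma> = 1" by (auto simp: power2_eq_1_iff)
  then have "distributed M lborel Z std_normal_density"
    using assms(1) \<open>\<mu> = 0\<close> by (auto simp: gaussian_rv_def)
  then have "distr M lborel Z = gauss" by (rule distributed_distr_eq_density)
  moreover have "distr M borel Z = distr M lborel Z" by (rule distr_cong) auto
  ultimately show ?thesis by simp
qed

lemma (in prob_space) indep_set_vimage:
  assumes ind: "indep_set (sets A) (sets B)" and sp: "space A = space M" "space B = space M"
    and f: "f \<in> measurable A N" and g: "g \<in> measurable B K"
  shows "indep_set {f -` C \<inter> space M |C. C \<in> sets N} {g -` C \<inter> space M |C. C \<in> sets K}"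
proof -
  have 1: "{f -` C \<inter> space M |C. C \<in> sets N} \<subseteq> sets A" using measurable_sets[OF f] sp by auto
  have 2: "{g -` C \<inter> space M |C. C \<in> sets K} \<subseteq> sets B" using measurable_sets[OF g] sp by auto
  show ?thesis
  proof (rule indep_setI)
    show "{f -` C \<inter> space M |C. C \<in> sets N} \<subseteq> events" using 1 indep_setD_ev1[OF ind] by (rule subset_trans)
    show "{g -` C \<inter> space M |C. C \<in> sets K} \<subseteq> events" using 2 indep_setD_ev2[OF ind] by (rule subset_trans)
  qed (rule indep_setD[OF ind subsetD[OF 1] subsetD[OF 2]])
qed

section \<open>Linear functionals of a centred Gaussian vector\<close>

locale centered_gaussian = prob_space +
  fixes V :: "'a \<Rightarrow> 'v::euclidean_space"
  assumes gaussian: "jointly_gaussian M V" and centered: "\<And>u. (\<integral>\<omega>. u \<bullet> V \<omega> \<partial>M) = 0"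
begin

lemma measurable_V[measurable]: "V \<in> borel_measurable M"
  using gaussian by (simp add: jointly_gaussian_def)

lemma gaussian_inner: obtains \<mu> \<sigma> where "gaussian_rv M \<mu> \<sigma> (\<lambda>\<omega>. u \<bullet> V \<omega>)"
  using gaussian unfolding jointly_gaussian_def by blast

lemma integrable_square: "integrable M (\<lambda>\<omega>. (u \<bullet> V \<omega>)\<^sup>2)"
  by (rule gaussian_inner[of u]) (rule gaussian_rv_moments(1))

text \<open>Polarisation reduces products to squares of single functionals, which Gaussianity
  controls.\<close>

lemma integrable_prod: "integrable M (\<lambda>\<omega>. (u \<bullet> V \<omega>) * (v \<bullet> V \<omega>))"
proof -
  have "(\<lambda>\<omega>. (u \<bullet> V \<omega>) * (v \<bullet> V \<omega>)) = (\<lambda>\<omega>. (((u + v) \<bullet> V \<omega>)\<^sup>2 - (u \<bullet> V \<omega>)\<^sup>2 - (v \<bullet> V \<omega>)\<^sup>2) / 2)"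
    by (auto simp: inner_add_left power2_eq_square algebra_simps)
  then show ?thesis using integrable_square by simp
qed

lemma char_inner: "(\<integral>\<omega>. iexp (u \<bullet> V \<omega>) \<partial>M) = exp (- complex_of_real (\<integral>\<omega>. (u \<bullet> V \<omega>)\<^sup>2 \<partial>M) / 2)"
proof -
  obtain \<mu> \<sigma> where g: "gaussian_rv M \<mu> \<sigma> (\<lambda>\<omega>. u \<bullet> V \<omega>)" by (rule gaussian_inner)
  have "\<mu> = 0" using gaussian_rv_moments(2)[OF g] centered by simp
  then show ?thesis using gaussian_rv_moments(3,4)[OF g] by simp
qed

lemma distr_inner_gauss:
  assumes "(\<integral>\<omega>. (u \<bullet> V \<omega>)\<^sup>2 \<partial>M) = 1"
  shows "distr M borel (\<lambda>\<omega>. u \<bullet> V \<omega>) = gauss"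
  by (rule gaussian_inner[of u]) (rule gaussian_rv_standard, use centered assms in auto)

text \<open>The characteristic function of a linear combination is exp (-variance / 2), and
  variances of uncorrelated functionals add, so it factorises. The argument covers degenerate
  functionals because no density enters.\<close>

lemma indep_vars_inner:
  fixes L :: "'i::finite \<Rightarrow> 'v"
  assumes L: "\<And>i j. i \<noteq> j \<Longrightarrow> (\<integral>\<omega>. (L i \<bullet> V \<omega>) * (L j \<bullet> V \<omega>) \<partial>M) = 0"
  shows "indep_vars (\<lambda>_. borel) (\<lambda>i \<omega>. L i \<bullet> V \<omega>) UNIV"
proof (rule indep_vars_char)
  fix v :: "'i \<Rightarrow> real"
  define K where "K = (\<lambda>i. (\<integral>\<omega>. (L i \<bullet> V \<omega>)\<^sup>2 \<partial>M))"
  have inner: "(\<Sum>i\<in>UNIV. v i * (L i \<bullet> V \<omega>)) = (\<Sum>i\<in>UNIV. v i *\<^sub>R L i) \<bullet> V \<omega>" for \<omega>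
    by (simp add: inner_sum_left)
  have sq: "(\<integral>\<omega>. ((\<Sum>i\<in>UNIV. v i *\<^sub>R L i) \<bullet> V \<omega>)\<^sup>2 \<partial>M) = (\<Sum>i\<in>UNIV. (v i)\<^sup>2 * K i)"
  proof -
    have "(\<integral>\<omega>. ((\<Sum>i\<in>UNIV. v i *\<^sub>R L i) \<bullet> V \<omega>)\<^sup>2 \<partial>M) = (\<integral>\<omega>. (\<Sum>i\<in>UNIV. \<Sum>j\<in>UNIV. v i * v j * ((L i \<bullet> V \<omega>) * (L j \<bullet> V \<omega>))) \<partial>M)"
      unfolding inner[symmetric] power2_eq_square sum_product
      by (intro Bochner_Integration.integral_cong refl sum.cong) simp
    also have "\<dots> = (\<Sum>i\<in>UNIV. \<Sum>j\<in>UNIV. v i * v j * (\<integral>\<omega>. (L i \<bullet> V \<omega>) * (L j \<bullet> V \<omega>) \<partial>M))"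
      using integrable_prod by simp
    also have "\<dots> = (\<Sum>i\<in>UNIV. \<Sum>j\<in>UNIV. if i = j then (v i)\<^sup>2 * K i else 0)"
      using L by (intro sum.cong refl) (simp add: K_def power2_eq_square)
    finally show ?thesis by simp
  qed
  have "(\<integral>\<omega>. iexp (\<Sum>i\<in>UNIV. v i * (L i \<bullet> V \<omega>)) \<partial>M) = exp (- complex_of_real (\<Sum>i\<in>UNIV. (v i)\<^sup>2 * K i) / 2)"
    unfolding inner char_inner sq ..
  also have "\<dots> = (\<Prod>i\<in>UNIV. exp (- complex_of_real ((v i)\<^sup>2 * K i) / 2))"
  proof -
    have "- complex_of_real (\<Sum>i\<in>UNIV. (v i)\<^sup>2 * K i) / 2 = (\<Sum>i\<in>UNIV. - complex_of_real ((v i)\<^sup>2 * K i) / 2)"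
      unfolding of_real_sum by (simp only: sum_negf[symmetric] sum_divide_distrib)
    then show ?thesis by (simp only: exp_sum finite)
  qed
  also have "\<dots> = (\<Prod>i\<in>UNIV. \<integral>\<omega>. iexp (v i * (L i \<bullet> V \<omega>)) \<partial>M)"
  proof (rule prod.cong)
    fix i
    have "(\<integral>\<omega>. iexp ((v i *\<^sub>R L i) \<bullet> V \<omega>) \<partial>M) = exp (- complex_of_real (\<integral>\<omega>. ((v i *\<^sub>R L i) \<bullet> V \<omega>)\<^sup>2 \<partial>M) / 2)"
      by (rule char_inner)
    then show "exp (- complex_of_real ((v i)\<^sup>2 * K i) / 2) = (\<integral>\<omega>. iexp (v i * (L i \<bullet> V \<omega>)) \<partial>M)"
      by (simp add: power_mult_distrib K_def)
  qed simp
  finally show "(\<integral>\<omega>. iexp (\<Sum>i\<in>UNIV. v i * (L i \<bullet> V \<omega>)) \<partial>M) = (\<Prod>i\<in>UNIV. \<integral>\<omega>. iexp (v i * (L i \<bullet> V \<omega>)) \<partial>M)" .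
qed simp

lemma indep_set_inner2:
  assumes "(\<integral>\<omega>. (u \<bullet> V \<omega>) * (v \<bullet> V \<omega>) \<partial>M) = 0"
  shows "indep_set {(\<lambda>\<omega>. u \<bullet> V \<omega>) -` A \<inter> space M |A. A \<in> sets borel} {(\<lambda>\<omega>. v \<bullet> V \<omega>) -` B \<inter> space M |B. B \<in> sets borel}"
proof -
  define U where "U = (\<lambda>b \<omega>. (if b then u else v) \<bullet> V \<omega>)"
  have "indep_vars (\<lambda>_. borel) U UNIV"
    unfolding U_def
  proof (rule indep_vars_inner)
    fix i j :: bool assume "i \<noteq> j"
    then show "(\<integral>\<omega>. ((if i then u else v) \<bullet> V \<omega>) * ((if j then u else v) \<bullet> V \<omega>) \<partial>M) = 0"
      using assms by (cases i; cases j) (auto simp: mult.commute)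
  qed
  then have ind: "indep_set (sets (gen_algebra M {True} U)) (sets (gen_algebra M {False} U))"
    by (rule indep_set_gen_algebra_disjoint) auto
  have m: "(\<lambda>\<omega>. u \<bullet> V \<omega>) \<in> borel_measurable (gen_algebra M {True} U)"
    using measurable_gen_algebra[of True "{True}" U M] by (simp add: U_def)
  have m0: "(\<lambda>\<omega>. v \<bullet> V \<omega>) \<in> borel_measurable (gen_algebra M {False} U)"
    using measurable_gen_algebra[of False "{False}" U M] by (simp add: U_def)
  show ?thesis by (rule indep_set_vimage[OF ind _ _ m m0]) (simp_all add: space_gen_algebra)
qed

text \<open>\<open>None\<close> indexes the extra functional and \<open>Some i\<close> the
  components of the vector; joint independence over the option type then separates the whole vector
  from the extra functional.\<close>

lemma indep_set_inner:
  fixes L :: "'i::finite \<Rightarrow> 'v"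
  assumes L: "\<And>i j. i \<noteq> j \<Longrightarrow> (\<integral>\<omega>. (L i \<bullet> V \<omega>) * (L j \<bullet> V \<omega>) \<partial>M) = 0"
    and L0: "\<And>i. (\<integral>\<omega>. (L i \<bullet> V \<omega>) * (l \<bullet> V \<omega>) \<partial>M) = 0"
  shows "indep_set {(\<lambda>\<omega>. \<chi> i. L i \<bullet> V \<omega>) -` A \<inter> space M |A. A \<in> sets borel} {(\<lambda>\<omega>. l \<bullet> V \<omega>) -` B \<inter> space M |B. B \<in> sets borel}"
proof -
  define U where "U = (\<lambda>i \<omega>. case_option l L i \<bullet> V \<omega>)"
  have "indep_vars (\<lambda>_. borel) U UNIV"
    unfolding U_def
  proof (rule indep_vars_inner)
    fix i j :: "'i option" assume "i \<noteq> j"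
    then show "(\<integral>\<omega>. (case_option l L i \<bullet> V \<omega>) * (case_option l L j \<bullet> V \<omega>) \<partial>M) = 0"
      using L L0 by (cases i; cases j) (auto simp: mult.commute)
  qed
  then have ind: "indep_set (sets (gen_algebra M (range Some) U)) (sets (gen_algebra M {None} U))"
    by (rule indep_set_gen_algebra_disjoint) auto
  have m: "(\<lambda>\<omega>. \<chi> i. L i \<bullet> V \<omega>) \<in> borel_measurable (gen_algebra M (range Some) U)"
  proof (rule borel_measurable_vecI)
    fix i
    have "U (Some i) \<in> borel_measurable (gen_algebra M (range Some) U)" by (rule measurable_gen_algebra) simp
    then show "(\<lambda>\<omega>. (\<chi> i. L i \<bullet> V \<omega>) $ i) \<in> borel_measurable (gen_algebra M (range Some) U)" by (simp add: U_def)
  qed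
  have m0: "(\<lambda>\<omega>. l \<bullet> V \<omega>) \<in> borel_measurable (gen_algebra M {None} U)"
    using measurable_gen_algebra[of None "{None}" U M] by (simp add: U_def)
  show ?thesis by (rule indep_set_vimage[OF ind _ _ m m0]) (simp_all add: space_gen_algebra)
qed

end

text \<open>Quantified over all i.i.d. standard normal sequences, because the reserved subsequence
  may change with the number of bits while the rate \<open>b\<close> must not depend on it.\<close>

definition (in prob_space) concentrates :: "scalar_method \<Rightarrow> real \<Rightarrow> real \<Rightarrow> real \<Rightarrow> bool" where
  "concentrates meth \<kappa> t b \<longleftrightarrow> (\<forall>x :: nat \<Rightarrow> 'a \<Rightarrow> real. indep_vars (\<lambda>_. borel) x UNIV \<longrightarrow> (\<forall>j. distr M borel (x j) = gauss) \<longrightarrow>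
      (\<integral>\<^sup>+\<omega>. ennreal ((x (scalar_index meth \<kappa> (\<lambda>j. x j \<omega>)) \<omega> - t)\<^sup>2) \<partial>M) \<le> ennreal b)"

text \<open>All that the limit needs from a method: the selected sample is within o(1), in mean
  square, of a level t with t^2 ~ 2 ln 2 \<kappa>. For the threshold method t is the threshold, for
  the maximum method the 1/N quantile; from here on both are treated alike.\<close>

lemma (in prob_space) scalar_index_concentration:
  obtains t b :: "real \<Rightarrow> real" where "filterlim t at_top at_top" "((\<lambda>\<kappa>. (t \<kappa>)\<^sup>2 / \<kappa>) \<longlongrightarrow> 2 * ln 2) at_top"
    "(b \<longlongrightarrow> 0) at_top" "\<forall>\<^sub>F \<kappa> in at_top. concentrates meth \<kappa> (t \<kappa>) (b \<kappa>)"
proof (cases meth)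
  case Threshold
  define t where "t = (\<lambda>\<kappa>. Qinv (geom_entropy_inv \<kappa>))"
  have lims: "filterlim t at_top at_top" "((\<lambda>\<kappa>. (t \<kappa>)\<^sup>2 / \<kappa>) \<longlongrightarrow> 2 * ln 2) at_top"
    using Qinv_geom_asymp[OF filterlim_ident[of at_top], of 1] by (simp_all add: t_def[abs_def])
  show ?thesis
  proof (rule that[of t "\<lambda>\<kappa>. 4 / (t \<kappa>)\<^sup>2"])
    have "((\<lambda>y::real. 4 / y\<^sup>2) \<longlongrightarrow> 0) at_top" by real_asymp
    then show "((\<lambda>\<kappa>. 4 / (t \<kappa>)\<^sup>2) \<longlongrightarrow> 0) at_top" by (rule filterlim_compose[OF _ lims(1)])
    have "\<forall>\<^sub>F \<kappa> in at_top. t \<kappa> \<ge> 1" using lims(1) by (simp add: filterlim_at_top)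
    then show "\<forall>\<^sub>F \<kappa> in at_top. concentrates meth \<kappa> (t \<kappa>) (4 / (t \<kappa>)\<^sup>2)"
    proof eventually_elim
      case (elim \<kappa>)
      show ?case
        unfolding concentrates_def
      proof (intro allI impI)
        fix x :: "nat \<Rightarrow> 'a \<Rightarrow> real" assume x: "indep_vars (\<lambda>_. borel) x UNIV" "\<forall>j. distr M borel (x j) = gauss"
        show "(\<integral>\<^sup>+\<omega>. ennreal ((x (scalar_index meth \<kappa> (\<lambda>j. x j \<omega>)) \<omega> - t \<kappa>)\<^sup>2) \<partial>M) \<le> ennreal (4 / (t \<kappa>)\<^sup>2)"
          using second_moment_threshold[OF x(1) _ elim] x(2) by (simp add: scalar_index_def Threshold t_def)
      qed
    qed
  qed (use lims in auto)
next
  case Maximum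
  define N where "N = (\<lambda>\<kappa>::real. nat \<lfloor>2 powr \<kappa>\<rfloor>)"
  define t where "t = (\<lambda>\<kappa>. Qinv (1 / real (N \<kappa>)))"
  have lims: "filterlim t at_top at_top" "((\<lambda>\<kappa>. (t \<kappa>)\<^sup>2 / \<kappa>) \<longlongrightarrow> 2 * ln 2) at_top"
     "\<forall>\<^sub>F \<kappa> in at_top. Qfun (t \<kappa>) = 1 / real (N \<kappa>)" "\<forall>\<^sub>F \<kappa> in at_top. N \<kappa> \<ge> 2"
    using Qinv_samples_asymp[OF filterlim_ident] by (simp_all add: t_def[abs_def] N_def[abs_def])
  \<comment> \<open>Allowed shortfall below the level t: eps = t^(-1/2) tends to 0, while eps t =
    sqrt t still makes the doubly exponential term beat the factor 2 t^2 + 2.\<close>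
  define e where "e = (\<lambda>y::real. y powr (-1/2))"
  define B where "B = (\<lambda>y::real. 4 / y\<^sup>2 + (e y)\<^sup>2 + (2 * y\<^sup>2 + 2) * exp (- exp (e y * y - (e y)\<^sup>2 / 2) / 2))"
  show ?thesis
  proof (rule that[of t "\<lambda>\<kappa>. B (t \<kappa>)"])
    have "(B \<longlongrightarrow> 0) at_top" unfolding B_def e_def by real_asymp
    then show "((\<lambda>\<kappa>. B (t \<kappa>)) \<longlongrightarrow> 0) at_top" by (rule filterlim_compose[OF _ lims(1)])
    have "\<forall>\<^sub>F \<kappa> in at_top. t \<kappa> \<ge> 1" using lims(1) by (simp add: filterlim_at_top)
    then show "\<forall>\<^sub>F \<kappa> in at_top. concentrates meth \<kappa> (t \<kappa>) (B (t \<kappa>))"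
      using lims(3,4)
    proof eventually_elim
      case (elim \<kappa>)
      define y where "y = t \<kappa>"
      define n where "n = N \<kappa>"
      have y: "y \<ge> 1" "Qfun y = 1 / real n" "n \<ge> 2" using elim by (auto simp: y_def n_def)
      have e: "e y \<ge> 0" by (simp add: e_def)
      have "1 - Qfun (y - e y) \<le> exp (- Qfun (y - e y))" using exp_ge_add_one_self[of "- Qfun (y - e y)"] by simp
      moreover have "0 \<le> 1 - Qfun (y - e y)" unfolding measure_gauss_atMost[symmetric] by simp
      ultimately have "(1 - Qfun (y - e y)) ^ (n - 1) \<le> exp (- Qfun (y - e y)) ^ (n - 1)" by (intro power_mono)
      also have "\<dots> = exp (- (real (n - 1) * Qfun (y - e y)))" by (simp add: exp_of_nat_mult[symmetric])
      also have "\<dots> \<le> exp (- exp (e y * y - (e y)\<^sup>2 / 2) / 2)"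
      proof -
        \<comment> \<open>The first sample was set aside for the second moment, leaving n - 1; with
          n >= 2 this is at least n / 2, so only a factor 2 is lost in the exponent.\<close>
        have "real n / 2 \<le> real (n - 1)" using y(3) by simp
        have "exp (e y * y - (e y)\<^sup>2 / 2) / 2 = real n / 2 * (exp (e y * y - (e y)\<^sup>2 / 2) * Qfun y)" using y by simp
        also have "\<dots> \<le> real (n - 1) * Qfun (y - e y)"
          using \<open>real n / 2 \<le> real (n - 1)\<close> Qfun_shift[OF e, of y] Qfun_nonneg[of y] by (intro mult_mono) auto
        finally show ?thesis by simp
      qed
      finally have "(2 * y\<^sup>2 + 2) * (1 - Qfun (y - e y)) ^ (n - 1) \<le> (2 * y\<^sup>2 + 2) * exp (- exp (e y * y - (e y)\<^sup>2 / 2) / 2)"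
        by (intro mult_left_mono) auto
      then have le: "4 / y\<^sup>2 + (e y)\<^sup>2 + (2 * y\<^sup>2 + 2) * (1 - Qfun (y - e y)) ^ (n - 1) \<le> B y" by (simp add: B_def)
      show ?case
        unfolding concentrates_def
      proof (intro allI impI)
        fix x :: "nat \<Rightarrow> 'a \<Rightarrow> real" assume x: "indep_vars (\<lambda>_. borel) x UNIV" "\<forall>j. distr M borel (x j) = gauss"
        have "(\<integral>\<^sup>+\<omega>. ennreal ((x (max_index n (\<lambda>j. x j \<omega>)) \<omega> - y)\<^sup>2) \<partial>M) \<le> ennreal (B y)"
          using x(2) by (intro order_trans[OF second_moment_max[OF x(1) _ y(1,3,2) e] ennreal_leI[OF le]]) auto
        then show "(\<integral>\<^sup>+\<omega>. ennreal ((x (scalar_index meth \<kappa> (\<lambda>j. x j \<omega>)) \<omega> - t \<kappa>)\<^sup>2) \<partial>M) \<le> ennreal (B (t \<kappa>))"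
          by (simp add: scalar_index_def Maximum y_def n_def N_def)
      qed
    qed
  qed (use lims in auto)
qed

subsection \<open>The scalar estimator\<close>

locale sampling = prob_space +
  fixes Xs :: "nat \<Rightarrow> 'a \<Rightarrow> real ^ 'd" and Ys :: "nat \<Rightarrow> 'a \<Rightarrow> real"
    and \<Sigma> :: "real ^ 'd ^ 'd" and \<rho> :: "real ^ 'd"
  assumes ind: "indep_vars (\<lambda>_. borel) (\<lambda>i \<omega>. (Xs i \<omega>, Ys i \<omega>)) {1..}"
    and gauss: "\<And>i. i \<ge> 1 \<Longrightarrow> centered_gaussian M (\<lambda>\<omega>. (Xs i \<omega>, Ys i \<omega>))"
    and cov: "\<And>i a b. i \<ge> 1 \<Longrightarrow> (\<integral>\<omega>. Xs i \<omega> $ a * Xs i \<omega> $ b \<partial>M) = \<Sigma> $ a $ b"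
      "\<And>i l. i \<ge> 1 \<Longrightarrow> (\<integral>\<omega>. Ys i \<omega> * Xs i \<omega> $ l \<partial>M) = \<rho> $ l"
      "\<And>i. i \<ge> 1 \<Longrightarrow> (\<integral>\<omega>. (Ys i \<omega>)\<^sup>2 \<partial>M) = 1"
    and diag: "\<And>l. \<Sigma> $ l $ l = 1"
begin

lemma inner_pair: "(a, b) \<bullet> (Xs i \<omega>, Ys i \<omega>) = (\<Sum>j\<in>UNIV. a $ j * Xs i \<omega> $ j) + b * Ys i \<omega>"
  by (simp add: inner_vec_def)

lemma integrable_components:
  assumes "i \<ge> 1"
  shows "integrable M (\<lambda>\<omega>. Xs i \<omega> $ a * Xs i \<omega> $ b)" "integrable M (\<lambda>\<omega>. Ys i \<omega> * Xs i \<omega> $ b)"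
    "integrable M (\<lambda>\<omega>. (Ys i \<omega>)\<^sup>2)"
proof -
  interpret centered_gaussian M "\<lambda>\<omega>. (Xs i \<omega>, Ys i \<omega>)" using gauss[OF assms] .
  show "integrable M (\<lambda>\<omega>. Xs i \<omega> $ a * Xs i \<omega> $ b)"
    using integrable_prod[of "(axis a 1, 0)" "(axis b 1, 0)"] by (simp add: inner_axis')
  show "integrable M (\<lambda>\<omega>. Ys i \<omega> * Xs i \<omega> $ b)"
    using integrable_prod[of "(0, 1)" "(axis b 1, 0)"] by (simp add: inner_axis')
  show "integrable M (\<lambda>\<omega>. (Ys i \<omega>)\<^sup>2)"
    using integrable_prod[of "(0, 1)" "(0, 1)"] by (simp add: power2_eq_square)
qed

text \<open>Every second-order computation below is an instance, since the scalar sample, the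
  whitened coordinates and both residuals are linear functionals of the pair (X, Y).\<close>

lemma covariance:
  assumes "i \<ge> 1"
  shows "(\<integral>\<omega>. ((a, b) \<bullet> (Xs i \<omega>, Ys i \<omega>)) * ((a', b') \<bullet> (Xs i \<omega>, Ys i \<omega>)) \<partial>M)
    = a \<bullet> (\<Sigma> *v a') + b * (a' \<bullet> \<rho>) + b' * (a \<bullet> \<rho>) + b * b'"
proof -
  note I = integrable_components[OF assms]
  have eq: "((a, b) \<bullet> (Xs i \<omega>, Ys i \<omega>)) * ((a', b') \<bullet> (Xs i \<omega>, Ys i \<omega>)) =
      (\<Sum>p\<in>UNIV. \<Sum>q\<in>UNIV. a $ p * a' $ q * (Xs i \<omega> $ p * Xs i \<omega> $ q))
      + (\<Sum>q\<in>UNIV. b * a' $ q * (Ys i \<omega> * Xs i \<omega> $ q)) + (\<Sum>p\<in>UNIV. b' * a $ p * (Ys i \<omega> * Xs i \<omega> $ p)) + b * b' * (Ys i \<omega>)\<^sup>2" for \<omega>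
  proof -
    define A A' where "A = (\<Sum>j\<in>UNIV. a $ j * Xs i \<omega> $ j)" and "A' = (\<Sum>j\<in>UNIV. a' $ j * Xs i \<omega> $ j)"
    have "A * A' = (\<Sum>p\<in>UNIV. \<Sum>q\<in>UNIV. a $ p * a' $ q * (Xs i \<omega> $ p * Xs i \<omega> $ q))"
      unfolding A_def A'_def sum_product by (intro sum.cong refl) simp
    moreover have "b * Ys i \<omega> * A' = (\<Sum>q\<in>UNIV. b * a' $ q * (Ys i \<omega> * Xs i \<omega> $ q))"
      unfolding A'_def sum_distrib_left by (intro sum.cong refl) simp
    moreover have "b' * Ys i \<omega> * A = (\<Sum>q\<in>UNIV. b' * a $ q * (Ys i \<omega> * Xs i \<omega> $ q))"
      unfolding A_def sum_distrib_left by (intro sum.cong refl) simp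
    moreover have "(A + b * Ys i \<omega>) * (A' + b' * Ys i \<omega>) = A * A' + b * Ys i \<omega> * A' + b' * Ys i \<omega> * A + b * b' * (Ys i \<omega>)\<^sup>2"
      by (simp add: algebra_simps power2_eq_square)
    ultimately show ?thesis unfolding inner_pair by (simp only: A_def[symmetric] A'_def[symmetric])
  qed
  have "(\<integral>\<omega>. ((a, b) \<bullet> (Xs i \<omega>, Ys i \<omega>)) * ((a', b') \<bullet> (Xs i \<omega>, Ys i \<omega>)) \<partial>M)
     = (\<Sum>p\<in>UNIV. \<Sum>q\<in>UNIV. a $ p * a' $ q * \<Sigma> $ p $ q) + (\<Sum>q\<in>UNIV. b * a' $ q * \<rho> $ q) + (\<Sum>p\<in>UNIV. b' * a $ p * \<rho> $ p) + b * b'"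
    unfolding eq using I by (simp add: cov[OF assms])
  also have "(\<Sum>p\<in>UNIV. \<Sum>q\<in>UNIV. a $ p * a' $ q * \<Sigma> $ p $ q) = a \<bullet> (\<Sigma> *v a')"
    by (simp add: inner_vec_def matrix_vector_mult_def sum_distrib_left ac_simps)
  finally show ?thesis by (simp add: inner_vec_def sum_distrib_left mult.assoc)
qed

text \<open>The difference of the two sides is the variance of the residual of Y after subtracting
  its regression on the l-th coordinate.\<close>

lemma rho_le_1: "(\<rho> $ l)\<^sup>2 \<le> 1"
proof -
  have "(\<integral>\<omega>. ((- \<rho> $ l *\<^sub>R axis l 1, 1) \<bullet> (Xs 1 \<omega>, Ys 1 \<omega>)) * ((- \<rho> $ l *\<^sub>R axis l 1, 1) \<bullet> (Xs 1 \<omega>, Ys 1 \<omega>)) \<partial>M) \<ge> 0"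
    by (intro integral_nonneg_AE) simp
  then show ?thesis
    unfolding covariance[OF order_refl]
    by (simp add: inner_axis' matrix_vector_mult_basis column_def diag power2_eq_square
        matrix_vector_mult_scaleR flip: scaleR_minus_left)
qed

text \<open>Write Y = rho_l X_l + Z with Z independent of X_l. The error is then rho_l (X_J - m)/m +
  Z_J/m, and freezing gives its mean square exactly, with v the variance of X_J. The mean square
  distance of X_J from t controls both v and m - t, and sqrt b < t makes the divisor m
  positive.\<close>

lemma scalar_error:
  fixes s :: "nat \<Rightarrow> nat"
  assumes s: "strict_mono s" "range s \<subseteq> {1..}"
    and conc: "(\<integral>\<^sup>+\<omega>. ennreal ((Xs (s (scalar_index meth \<kappa> (\<lambda>j. Xs (s j) \<omega> $ l))) \<omega> $ l - t)\<^sup>2) \<partial>M) \<le> ennreal b" and b: "0 \<le> b"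
    and t: "sqrt b < t"
  defines "J \<equiv> \<lambda>\<omega>. s (scalar_index meth \<kappa> (\<lambda>j. Xs (s j) \<omega> $ l))"
  defines "m \<equiv> (\<integral>\<omega>. Xs (J \<omega>) \<omega> $ l \<partial>M)"
  shows "\<bar>m - t\<bar> \<le> sqrt b"
    "\<exists>v. 0 \<le> v \<and> v \<le> b \<and> (\<integral>\<^sup>+\<omega>. ennreal ((Ys (J \<omega>) \<omega> / m - \<rho> $ l)\<^sup>2) \<partial>M) = ennreal (((\<rho> $ l)\<^sup>2 * v + (1 - (\<rho> $ l)\<^sup>2)) / m\<^sup>2)"
proof -
  define V where "V = (\<lambda>i \<omega>. Xs i \<omega> $ l)"
  define Z where "Z = (\<lambda>i \<omega>. Ys i \<omega> - \<rho> $ l * Xs i \<omega> $ l)"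
  define G where "G = gen_algebra M {1..} V"
  have s1: "s j \<ge> 1" for j using s(2) by auto
  have VZpair: "V i = (\<lambda>\<omega>. (axis l 1, 0) \<bullet> (Xs i \<omega>, Ys i \<omega>))" "Z i = (\<lambda>\<omega>. (- \<rho> $ l *\<^sub>R axis l 1, 1) \<bullet> (Xs i \<omega>, Ys i \<omega>))" for i
    by (auto simp: V_def Z_def inner_axis' fun_eq_iff)
  have VM: "V i \<in> borel_measurable M" if "i \<in> {1..}" for i
  proof -
    interpret centered_gaussian M "\<lambda>\<omega>. (Xs i \<omega>, Ys i \<omega>)" using gauss that by simp
    show ?thesis unfolding VZpair by measurable
  qed
  have VG[measurable]: "V (s j) \<in> borel_measurable G" for j
    unfolding G_def using s1 by (intro measurable_gen_algebra) simp
  define idx where "idx = (\<lambda>\<omega>. scalar_index meth \<kappa> (\<lambda>j. V (s j) \<omega>))"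
  have Jidx: "J \<omega> = s (idx \<omega>)" for \<omega> by (simp add: J_def idx_def V_def)
  have idx[measurable]: "idx \<in> measurable G (count_space UNIV)"
    unfolding idx_def scalar_index_def by (cases meth) (simp_all add: threshold_index_def max_index_def)
  have JG: "J \<in> measurable G (count_space UNIV)" unfolding Jidx[abs_def] by measurable
  define XJ where "XJ = (\<lambda>\<omega>. V (s (idx \<omega>)) \<omega>)"
  have XJ[measurable]: "XJ \<in> borel_measurable G"
    unfolding XJ_def by (rule measurable_compose_countable[OF VG idx])
  have XJM[measurable]: "XJ \<in> borel_measurable M"
    using measurable_gen_algebra_subset[OF VM XJ[unfolded G_def]] .
  have XJ_eq: "Xs (J \<omega>) \<omega> $ l = XJ \<omega>" for \<omega> by (simp add: XJ_def Jidx V_def)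
  have conc': "(\<integral>\<^sup>+\<omega>. ennreal ((XJ \<omega> - t)\<^sup>2) \<partial>M) \<le> ennreal b" using conc by (simp add: XJ_eq[symmetric] J_def)
  have i2: "integrable M (\<lambda>\<omega>. (XJ \<omega> - t)\<^sup>2)"
    using conc' by (intro integrableI_bounded) (auto intro: le_less_trans)
  have i1: "integrable M (\<lambda>\<omega>. XJ \<omega> - t)" by (rule square_integrable_imp_integrable[OF _ i2]) simp
  have iX: "integrable M XJ" using Bochner_Integration.integrable_add[OF i1 integrable_const[of t]] by simp
  have mt: "m - t = (\<integral>\<omega>. XJ \<omega> - t \<partial>M)" using iX by (simp add: m_def XJ_eq prob_space)
  define w where "w = (\<integral>\<omega>. (XJ \<omega> - t)\<^sup>2 \<partial>M)"
  have "ennreal w \<le> ennreal b" unfolding w_def using conc' by (subst nn_integral_eq_integral[OF i2, symmetric]) auto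
  then have wb: "w \<le> b" using b by simp
  have exp: "(XJ \<omega> - m)\<^sup>2 = (XJ \<omega> - t)\<^sup>2 - 2 * (m - t) * (XJ \<omega> - t) + (m - t)\<^sup>2" for \<omega>
    by (simp add: power2_eq_square algebra_simps)
  have im: "integrable M (\<lambda>\<omega>. (XJ \<omega> - m)\<^sup>2)" unfolding exp using i1 i2 by simp
  define v where "v = (\<integral>\<omega>. (XJ \<omega> - m)\<^sup>2 \<partial>M)"
  have v0: "v \<ge> 0" unfolding v_def by simp
  \<comment> \<open>Bias-variance identity: as v >= 0 and w <= b, it yields both (m - t)^2 <= b and
    v <= b.\<close>
  have v: "v = w - (m - t)\<^sup>2"
  proof -
    have "v = w - 2 * (m - t) * (m - t) + (m - t)\<^sup>2"
      unfolding v_def exp using i1 i2 iX by (simp add: w_def prob_space mt)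
    then show ?thesis by (simp add: power2_eq_square)
  qed
  have vb: "v \<le> b" using v wb zero_le_power2[of "m - t"] by linarith
  have "(m - t)\<^sup>2 \<le> b" using v v0 wb by linarith
  then show mtb: "\<bar>m - t\<bar> \<le> sqrt b" using real_le_rsqrt[of "\<bar>m - t\<bar>" b] by simp
  then have m0: "m > 0" using t by simp
  \<comment> \<open>The single noise term is written as a sum over the type \<open>unit\<close>, to
    fit the lemma for finitely many noise terms.\<close>
  have "(\<integral>\<^sup>+\<omega>. ennreal ((Ys (J \<omega>) \<omega> / m - \<rho> $ l)\<^sup>2) \<partial>M)
    = (\<integral>\<^sup>+\<omega>. ennreal (((\<rho> $ l * (XJ \<omega> - m) / m) + (\<Sum>u\<in>(UNIV::unit set). 1 / m * Z (J \<omega>) \<omega>))\<^sup>2) \<partial>M)"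
    using m0 by (intro nn_integral_cong) (simp add: Z_def XJ_eq field_simps)
  also have "\<dots> = (\<integral>\<^sup>+\<omega>. ennreal ((\<rho> $ l * (XJ \<omega> - m) / m)\<^sup>2 + (1 - (\<rho> $ l)\<^sup>2) * (\<Sum>u\<in>(UNIV::unit set). (1 / m)\<^sup>2)) \<partial>M)"
  proof (rule second_moment_indep_noise[where V = V and I = "{1..}" and J = "\<lambda>_. J"])
    show "indep_vars (\<lambda>_. borel) (\<lambda>i \<omega>. (V i \<omega>, Z i \<omega>)) {1..}"
    proof -
      have "(\<lambda>z::(real^'d) \<times> real. (fst z $ l, snd z - \<rho> $ l * fst z $ l)) \<in> borel_measurable borel"
        by (intro borel_measurable_continuous_onI continuous_intros)
      then show ?thesis using indep_vars_compose2[OF ind, of "\<lambda>_ z. (fst z $ l, snd z - \<rho> $ l * fst z $ l)" "\<lambda>_. borel"]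
        by (simp add: V_def Z_def)
    qed
    show "J \<in> measurable (gen_algebra M {1..} V) (count_space UNIV)" using JG by (simp only: G_def)
    have "(\<lambda>\<omega>. \<rho> $ l * (XJ \<omega> - m) / m) \<in> borel_measurable G" by measurable
    then show "(\<lambda>\<omega>. \<rho> $ l * (XJ \<omega> - m) / m) \<in> borel_measurable (gen_algebra M {1..} V)" by (simp only: G_def)
    show "AE \<omega> in M. inj (\<lambda>u::unit. J \<omega>) \<and> (\<forall>u::unit. J \<omega> \<in> {1..})" using s1 by (simp add: Jidx inj_def)
    fix i :: nat assume "i \<in> {1..}"
    then have i: "i \<ge> 1" by simp
    interpret centered_gaussian M "\<lambda>\<omega>. (Xs i \<omega>, Ys i \<omega>)" using gauss[OF i] .
    note axis_simps = inner_axis' matrix_vector_mult_basis column_def diag power2_eq_square matrix_vector_mult_scaleR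
    show "integrable M (\<lambda>\<omega>. (Z i \<omega>)\<^sup>2)" unfolding VZpair by (rule integrable_square)
    show "(\<integral>\<omega>. Z i \<omega> \<partial>M) = 0" unfolding VZpair by (rule centered)
    show "(\<integral>\<omega>. (Z i \<omega>)\<^sup>2 \<partial>M) = 1 - (\<rho> $ l)\<^sup>2"
      unfolding VZpair power2_eq_square covariance[OF i]
      by (simp add: axis_simps flip: scaleR_minus_left)
    show "indep_set {V i -` A \<inter> space M |A. A \<in> sets borel} {Z i -` B \<inter> space M |B. B \<in> sets borel}"
      unfolding VZpair
    proof (rule indep_set_inner2)
      show "(\<integral>\<omega>. ((axis l 1, 0) \<bullet> (Xs i \<omega>, Ys i \<omega>)) * ((- \<rho> $ l *\<^sub>R axis l 1, 1) \<bullet> (Xs i \<omega>, Ys i \<omega>)) \<partial>M) = 0"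
        unfolding covariance[OF i] by (simp add: axis_simps flip: scaleR_minus_left)
    qed
  qed simp
  also have "\<dots> = (\<integral>\<^sup>+\<omega>. ennreal (((\<rho> $ l)\<^sup>2 * (XJ \<omega> - m)\<^sup>2 + (1 - (\<rho> $ l)\<^sup>2)) / m\<^sup>2) \<partial>M)"
    by (intro nn_integral_cong) (simp add: power_divide power_mult_distrib add_divide_distrib)
  also have "\<dots> = ennreal (\<integral>\<omega>. ((\<rho> $ l)\<^sup>2 * (XJ \<omega> - m)\<^sup>2 + (1 - (\<rho> $ l)\<^sup>2)) / m\<^sup>2 \<partial>M)"
    using im rho_le_1[of l] by (intro nn_integral_eq_integral) auto
  also have "(\<integral>\<omega>. ((\<rho> $ l)\<^sup>2 * (XJ \<omega> - m)\<^sup>2 + (1 - (\<rho> $ l)\<^sup>2)) / m\<^sup>2 \<partial>M) = ((\<rho> $ l)\<^sup>2 * v + (1 - (\<rho> $ l)\<^sup>2)) / m\<^sup>2"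
    using im by (simp add: v_def prob_space)
  finally show "\<exists>v. 0 \<le> v \<and> v \<le> b \<and> (\<integral>\<^sup>+\<omega>. ennreal ((Ys (J \<omega>) \<omega> / m - \<rho> $ l)\<^sup>2) \<partial>M) = ennreal (((\<rho> $ l)\<^sup>2 * v + (1 - (\<rho> $ l)\<^sup>2)) / m\<^sup>2)"
    using v0 vb by blast
qed

end

text \<open>Passes from the numbered samples to the subsequence reserved for one
  correlation.\<close>

lemma (in prob_space) indep_vars_reindex:
  assumes f: "inj_on f I" and X: "indep_vars M' X (f ` I)"
  shows "indep_vars (\<lambda>i. M' (f i)) (\<lambda>i. X (f i)) I"
  unfolding indep_vars_def2
proof (intro conjI ballI)
  show "random_variable (M' (f i)) (X (f i))" if "i \<in> I" for i
    using X that unfolding indep_vars_def2 by blast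
  have F: "indep_sets (\<lambda>i. {X i -` A \<inter> space M |A. A \<in> sets (M' i)}) (f ` I)"
    using X unfolding indep_vars_def2 by blast
  show "indep_sets (\<lambda>i. {X (f i) -` A \<inter> space M |A. A \<in> sets (M' (f i))}) I"
  proof (rule indep_setsI)
    show "{X (f i) -` A \<inter> space M |A. A \<in> sets (M' (f i))} \<subseteq> events" if "i \<in> I" for i
      using F that unfolding indep_sets_def by blast
    fix A J assume J: "J \<noteq> {}" "J \<subseteq> I" "finite J" and A: "\<forall>j\<in>J. A j \<in> {X (f j) -` A \<inter> space M |A. A \<in> sets (M' (f j))}"
    have inj: "inj_on f J" using f J(2) by (rule inj_on_subset)
    define B where "B = (\<lambda>j. A (the_inv_into J f j))"
    have B: "B (f j) = A j" if "j \<in> J" for j using that inj by (simp add: B_def the_inv_into_f_f)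
    have "prob (\<Inter>j\<in>f ` J. B j) = (\<Prod>j\<in>f ` J. prob (B j))"
      using J A B by (intro indep_setsD[OF F]) auto
    moreover have "(\<Prod>j\<in>f ` J. prob (B j)) = (\<Prod>j\<in>J. prob (A j))"
      using inj B by (simp add: prod.reindex)
    moreover have "(\<Inter>j\<in>f ` J. B j) = (\<Inter>j\<in>J. A j)" using B by auto
    ultimately show "prob (\<Inter>j\<in>J. A j) = (\<Prod>j\<in>J. prob (A j))" by simp
  qed
qed

context sampling
begin

text \<open>As m - t tends to 0 and t to infinity, m ~ t, and t^2 ~ 2 ln 2 w k gives k / m^2 -> 1 /
  (2 ln 2 w). The variance of the selected sample vanishes in the limit, so only the residual
  variance survives. The real-valued witness f keeps the limit argument out of
  \<open>ennreal\<close>.\<close>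

lemma scalar_limit:
  assumes s: "\<And>k::real. strict_mono (s k)" "\<And>k. range (s k) \<subseteq> {1..}" and w: "w > 0"
  shows "\<exists>f. (f \<longlongrightarrow> (1 - (\<rho> $ l)\<^sup>2) / (2 * ln 2 * w)) at_top \<and> (\<forall>\<^sub>F k in at_top. f k \<ge> 0 \<and>
    ennreal k * (\<integral>\<^sup>+\<omega>. ennreal ((let J = (\<lambda>\<omega>. s k (scalar_index meth (w * k) (\<lambda>j. Xs (s k j) \<omega> $ l))) in
       Ys (J \<omega>) \<omega> / (\<integral>\<omega>'. Xs (J \<omega>') \<omega>' $ l \<partial>M) - \<rho> $ l)\<^sup>2) \<partial>M) = ennreal (f k))"
proof -
  obtain t b :: "real \<Rightarrow> real" where tb: "filterlim t at_top at_top" "((\<lambda>\<kappa>. (t \<kappa>)\<^sup>2 / \<kappa>) \<longlongrightarrow> 2 * ln 2) at_top"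
    "(b \<longlongrightarrow> 0) at_top" and conc: "\<forall>\<^sub>F \<kappa> in at_top. concentrates meth \<kappa> (t \<kappa>) (b \<kappa>)"
    by (rule scalar_index_concentration[of meth])
  \<comment> \<open>Concentration says nothing about the sign of \<open>b\<close>, and
    \<open>scalar_error\<close> takes its square root.\<close>
  define b' where "b' = (\<lambda>\<kappa>. max 0 (b \<kappa>))"
  have b': "(b' \<longlongrightarrow> 0) at_top" unfolding b'_def using tendsto_max[OF tendsto_const tb(3), of 0] by simp
  have wk: "filterlim (\<lambda>k. w * k) at_top at_top" using w by real_asymp
  define J where "J = (\<lambda>k \<omega>. s k (scalar_index meth (w * k) (\<lambda>j. Xs (s k j) \<omega> $ l)))"
  define m where "m = (\<lambda>k. \<integral>\<omega>. Xs (J k \<omega>) \<omega> $ l \<partial>M)"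
  have ok: "\<forall>\<^sub>F k in at_top. \<bar>m k - t (w * k)\<bar> \<le> sqrt (b' (w * k)) \<and> (\<exists>v. 0 \<le> v \<and> v \<le> b' (w * k) \<and>
      (\<integral>\<^sup>+\<omega>. ennreal ((Ys (J k \<omega>) \<omega> / m k - \<rho> $ l)\<^sup>2) \<partial>M) = ennreal (((\<rho> $ l)\<^sup>2 * v + (1 - (\<rho> $ l)\<^sup>2)) / (m k)\<^sup>2))"
  proof -
    have "\<forall>\<^sub>F \<kappa> in at_top. b' \<kappa> < 1" using b' by (rule order_tendstoD) simp
    moreover have "\<forall>\<^sub>F \<kappa> in at_top. t \<kappa> \<ge> 1" using tb(1) by (simp add: filterlim_at_top)
    ultimately have "\<forall>\<^sub>F \<kappa> in at_top. b' \<kappa> < 1 \<and> t \<kappa> \<ge> 1 \<and> (concentrates meth \<kappa> (t \<kappa>) (b \<kappa>))"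
      using conc by eventually_elim simp
    then have "\<forall>\<^sub>F k in at_top. b' (w * k) < 1 \<and> t (w * k) \<ge> 1 \<and> (concentrates meth (w * k) (t (w * k)) (b (w * k)))"
      by (rule eventually_compose_filterlim[OF _ wk])
    then show ?thesis
    proof eventually_elim
      case (elim k)
      define x where "x = (\<lambda>j \<omega>. Xs (s k j) \<omega> $ l)"
      have s1: "s k j \<ge> 1" for j using s(2)[of k] by auto
      have "indep_vars (\<lambda>_. borel) (\<lambda>i \<omega>. Xs i \<omega> $ l) {1..}"
      proof -
        have "(\<lambda>z::(real^'d) \<times> real. fst z $ l) \<in> borel_measurable borel"
          by (intro borel_measurable_continuous_onI continuous_intros)
        then show ?thesis using indep_vars_compose2[OF ind, of "\<lambda>_ z. fst z $ l" "\<lambda>_. borel"] by simp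
      qed
      then have "indep_vars (\<lambda>_. borel) (\<lambda>i \<omega>. Xs i \<omega> $ l) (range (s k))"
        using s(2)[of k] by (rule indep_vars_subset)
      then have xi: "indep_vars (\<lambda>_. borel) x UNIV"
        using indep_vars_reindex[OF strict_mono_imp_inj_on[OF s(1)[of k]], of "\<lambda>_. borel" "\<lambda>i \<omega>. Xs i \<omega> $ l"]
        by (simp add: x_def comp_def)
      have "distr M borel (x j) = gauss" for j
      proof -
        interpret centered_gaussian M "\<lambda>\<omega>. (Xs (s k j) \<omega>, Ys (s k j) \<omega>)" using gauss[OF s1] .
        have "distr M borel (\<lambda>\<omega>. (axis l 1, 0) \<bullet> (Xs (s k j) \<omega>, Ys (s k j) \<omega>)) = gauss"
          by (rule distr_inner_gauss) (simp add: inner_axis' power2_eq_square cov(1)[OF s1] diag)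
        then show ?thesis by (simp add: x_def inner_axis')
      qed
      with xi elim have "(\<integral>\<^sup>+\<omega>. ennreal ((x (scalar_index meth (w * k) (\<lambda>j. x j \<omega>)) \<omega> - t (w * k))\<^sup>2) \<partial>M) \<le> ennreal (b (w * k))"
        unfolding concentrates_def by blast
      also have "\<dots> \<le> ennreal (b' (w * k))" by (intro ennreal_leI) (simp add: b'_def)
      finally have c: "(\<integral>\<^sup>+\<omega>. ennreal ((Xs (s k (scalar_index meth (w * k) (\<lambda>j. Xs (s k j) \<omega> $ l))) \<omega> $ l - t (w * k))\<^sup>2) \<partial>M) \<le> ennreal (b' (w * k))"
        by (simp add: x_def)
      have "sqrt (b' (w * k)) < t (w * k)" using elim by (smt (verit) real_sqrt_lt_1_iff)
      from scalar_error[OF s(1,2) c _ this] show ?case by (simp add: J_def m_def b'_def)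
    qed
  qed
  \<comment> \<open>Choosing the variance for each k turns pointwise existence into a function whose
    limit can be taken.\<close>
  define v where "v = (\<lambda>k. SOME v. 0 \<le> v \<and> v \<le> b' (w * k) \<and>
      (\<integral>\<^sup>+\<omega>. ennreal ((Ys (J k \<omega>) \<omega> / m k - \<rho> $ l)\<^sup>2) \<partial>M) = ennreal (((\<rho> $ l)\<^sup>2 * v + (1 - (\<rho> $ l)\<^sup>2)) / (m k)\<^sup>2))"
  have ok2: "\<forall>\<^sub>F k in at_top. \<bar>m k - t (w * k)\<bar> \<le> sqrt (b' (w * k)) \<and> 0 \<le> v k \<and> v k \<le> b' (w * k) \<and>
      (\<integral>\<^sup>+\<omega>. ennreal ((Ys (J k \<omega>) \<omega> / m k - \<rho> $ l)\<^sup>2) \<partial>M) = ennreal (((\<rho> $ l)\<^sup>2 * v k + (1 - (\<rho> $ l)\<^sup>2)) / (m k)\<^sup>2)"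
    using ok
  proof eventually_elim
    case (elim k)
    have "0 \<le> v k \<and> v k \<le> b' (w * k) \<and>
      (\<integral>\<^sup>+\<omega>. ennreal ((Ys (J k \<omega>) \<omega> / m k - \<rho> $ l)\<^sup>2) \<partial>M) = ennreal (((\<rho> $ l)\<^sup>2 * v k + (1 - (\<rho> $ l)\<^sup>2)) / (m k)\<^sup>2)"
      unfolding v_def by (rule someI_ex) (rule conjunct2[OF elim])
    then show ?case using elim by blast
  qed
  have bw: "((\<lambda>k. b' (w * k)) \<longlongrightarrow> 0) at_top" by (rule filterlim_compose[OF b' wk])
  have vlim: "(v \<longlongrightarrow> 0) at_top"
    by (rule tendsto_sandwich[OF _ _ tendsto_const bw]; use ok2 in eventually_elim; simp)
  have tw: "filterlim (\<lambda>k. t (w * k)) at_top at_top" by (rule filterlim_compose[OF tb(1) wk])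
  have mt: "((\<lambda>k. m k - t (w * k)) \<longlongrightarrow> 0) at_top"
  proof (rule Lim_null_comparison)
    show "\<forall>\<^sub>F k in at_top. norm (m k - t (w * k)) \<le> sqrt (b' (w * k))" using ok2 by eventually_elim simp
    show "((\<lambda>k. sqrt (b' (w * k))) \<longlongrightarrow> 0) at_top" using tendsto_real_sqrt[OF bw] by simp
  qed
  have "((\<lambda>k. 1 + (m k - t (w * k)) / t (w * k)) \<longlongrightarrow> 1 + 0) at_top"
    by (intro tendsto_add tendsto_const real_tendsto_divide_at_top[OF mt tw])
  moreover have "\<forall>\<^sub>F k in at_top. 1 + (m k - t (w * k)) / t (w * k) = m k / t (w * k)"
  proof -
    have "\<forall>\<^sub>F k in at_top. t (w * k) > 0" using tw by (simp add: filterlim_at_top_dense)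
    then show ?thesis by eventually_elim (simp add: field_simps)
  qed
  ultimately have mdt: "((\<lambda>k. m k / t (w * k)) \<longlongrightarrow> 1) at_top" by (simp add: Lim_transform_eventually)
  have tk: "((\<lambda>k. (t (w * k))\<^sup>2 / (w * k)) \<longlongrightarrow> 2 * ln 2) at_top" by (rule filterlim_compose[OF tb(2) wk])
  have "((\<lambda>k. 1 / ((m k / t (w * k))\<^sup>2 * ((t (w * k))\<^sup>2 / (w * k)) * w)) \<longlongrightarrow> 1 / (1\<^sup>2 * (2 * ln 2) * w)) at_top"
    using w by (intro tendsto_intros mdt tk) auto
  moreover have "\<forall>\<^sub>F k in at_top. 1 / ((m k / t (w * k))\<^sup>2 * ((t (w * k))\<^sup>2 / (w * k)) * w) = k / (m k)\<^sup>2"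
  proof -
    have "\<forall>\<^sub>F k in at_top. t (w * k) > 0" using tw by (simp add: filterlim_at_top_dense)
    then show ?thesis using eventually_gt_at_top[of 0] by eventually_elim (use w in \<open>simp add: field_simps power_divide\<close>)
  qed
  ultimately have km: "((\<lambda>k. k / (m k)\<^sup>2) \<longlongrightarrow> 1 / (2 * ln 2 * w)) at_top" by (simp add: Lim_transform_eventually)
  define f where "f = (\<lambda>k. ((\<rho> $ l)\<^sup>2 * v k + (1 - (\<rho> $ l)\<^sup>2)) * (k / (m k)\<^sup>2))"
  have "(f \<longlongrightarrow> ((\<rho> $ l)\<^sup>2 * 0 + (1 - (\<rho> $ l)\<^sup>2)) * (1 / (2 * ln 2 * w))) at_top"
    unfolding f_def by (intro tendsto_intros vlim km)
  moreover have "\<forall>\<^sub>F k in at_top. f k \<ge> 0 \<and> ennreal k * (\<integral>\<^sup>+\<omega>. ennreal ((Ys (J k \<omega>) \<omega> / m k - \<rho> $ l)\<^sup>2) \<partial>M) = ennreal (f k)"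
    using ok2 eventually_gt_at_top[of 0]
  proof eventually_elim
    case (elim k)
    have c: "(\<rho> $ l)\<^sup>2 * v k + (1 - (\<rho> $ l)\<^sup>2) \<ge> 0" using elim rho_le_1[of l] by simp
    have "ennreal k * ennreal (((\<rho> $ l)\<^sup>2 * v k + (1 - (\<rho> $ l)\<^sup>2)) / (m k)\<^sup>2) = ennreal (f k)"
      using elim c by (subst ennreal_mult[symmetric]) (auto simp: f_def mult.commute)
    then show ?case using elim c by (auto simp: f_def)
  qed
  ultimately show ?thesis
    by (intro exI[of _ f]) (simp add: Let_def J_def m_def)
qed

end

subsection \<open>Quantisation and perturbed diagonal matrices\<close>

lemma quantize:
  assumes n: "n > 0" and lo: "lo < hi" and x: "lo \<le> x" "x \<le> hi" and th: "\<And>j. 0 \<le> \<theta> j \<and> \<theta> j \<le> 1"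
  shows "lo \<le> quantize lo hi n \<theta> x" "quantize lo hi n \<theta> x \<le> hi" "\<bar>x - quantize lo hi n \<theta> x\<bar> \<le> (hi - lo) / n"
proof -
  define D where "D = (hi - lo) / real n"
  define y where "y = (x - lo) / D"
  define j where "j = min (nat \<lfloor>y\<rfloor>) (n - 1)"
  have D: "D > 0" using n lo by (simp add: D_def)
  have y: "0 \<le> y" "y \<le> n" using n lo x by (auto simp: y_def D_def field_simps)
  have q: "quantize lo hi n \<theta> x = lo + (real j + \<theta> j) * D" by (simp add: quantize_def Let_def j_def y_def D_def)
  have xy: "x = lo + y * D" using D by (simp add: y_def)
  have hi: "hi = lo + real n * D" using n by (simp add: D_def)
  have fl: "real (nat \<lfloor>y\<rfloor>) \<le> y" "y \<le> real (nat \<lfloor>y\<rfloor>) + 1" using y by linarith+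
  have j1: "real j \<le> y" using fl(1) unfolding j_def by linarith
  \<comment> \<open>The cap n - 1 acts only at the right endpoint, where y = n and the last cell is
    closed.\<close>
  have j2: "y \<le> real j + 1"
  proof (cases "nat \<lfloor>y\<rfloor> \<le> n - 1")
    case False
    then have "real j = real n - 1" using n by (simp add: j_def of_nat_diff)
    then show ?thesis using y by simp
  qed (use fl in \<open>simp add: j_def\<close>)
  have j3: "real j + 1 \<le> n" using n unfolding j_def by (simp add: min_def) linarith
  note t = th[of j]
  show "lo \<le> quantize lo hi n \<theta> x" unfolding q using D t by simp
  have "(real j + \<theta> j) * D \<le> real n * D" using j3 t D by (intro mult_right_mono) auto
  then have "quantize lo hi n \<theta> x \<le> lo + real n * D" unfolding q by simp
  then show "quantize lo hi n \<theta> x \<le> hi" by (simp only: hi[symmetric])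
  have "x - quantize lo hi n \<theta> x = (y - (real j + \<theta> j)) * D" unfolding q by (subst xy) (simp add: algebra_simps)
  then have "\<bar>x - quantize lo hi n \<theta> x\<bar> = \<bar>y - (real j + \<theta> j)\<bar> * D" using D by (simp add: abs_mult)
  also have "\<dots> \<le> 1 * D" using j1 j2 t D by (intro mult_right_mono) auto
  finally show "\<bar>x - quantize lo hi n \<theta> x\<bar> \<le> (hi - lo) / n" by (simp add: D_def)
qed

text \<open>The error splits into one cell, of length (c - a)/n with n cells on each side, and the
  part cut off by truncation. Quantised values avoid (-a, a), and this is what the lower bound for
  the quantised matrix rests on.\<close>

lemma quantize_diag:
  assumes n: "n > 0" and ac: "0 < a" "a < c" and x: "a \<le> \<bar>x\<bar>" and th: "\<And>j. 0 \<le> \<theta> j \<and> \<theta> j \<le> 1"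
  shows "a \<le> \<bar>quantize_diag a c (2 * n) \<theta> x\<bar>" "\<bar>x - quantize_diag a c (2 * n) \<theta> x\<bar> \<le> (c - a) / n + max 0 (\<bar>x\<bar> - c)"
proof -
  define x' where "x' = (if \<bar>x\<bar> > c then sgn x * c else x)"
  define q where "q = quantize_diag a c (2 * n) \<theta> x"
  have x': "\<bar>x - x'\<bar> = max 0 (\<bar>x\<bar> - c)" "a \<le> \<bar>x'\<bar>" "\<bar>x'\<bar> \<le> c"
    using ac x by (auto simp: x'_def sgn_if abs_if split: if_splits)
  have q: "q = (if x' < 0 then quantize (- c) (- a) n \<theta> x' else quantize a c n (\<lambda>j. \<theta> (n + j)) x')"
    by (simp add: q_def quantize_diag_def Let_def x'_def)
  have "a \<le> \<bar>q\<bar> \<and> \<bar>x' - q\<bar> \<le> (c - a) / n"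
  proof (cases "x' < 0")
    case True
    then show ?thesis using quantize[of n "-c" "-a" x' \<theta>] n ac x' th by (simp add: q)
  next
    case False
    then show ?thesis using quantize[of n a c x' "\<lambda>j. \<theta> (n + j)"] n ac x' th by (simp add: q)
  qed
  then show "a \<le> \<bar>quantize_diag a c (2 * n) \<theta> x\<bar>" "\<bar>x - quantize_diag a c (2 * n) \<theta> x\<bar> \<le> (c - a) / n + max 0 (\<bar>x\<bar> - c)"
    using x'(1) by (auto simp: q_def[symmetric])
qed

lemma measurable_quantize: "quantize lo hi n \<theta> \<in> borel_measurable borel"
  unfolding quantize_def[abs_def] Let_def by measurable

lemma measurable_quantize_diag: "quantize_diag a c n \<theta> \<in> borel_measurable borel"
proof -
  note [measurable] = measurable_quantize
  show ?thesis unfolding quantize_diag_def[abs_def] Let_def by measurable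
qed

lemma measurable_det:
  fixes F :: "'a \<Rightarrow> real ^ 'd ^ 'd"
  assumes [measurable]: "\<And>i j. (\<lambda>\<omega>. F \<omega> $ i $ j) \<in> borel_measurable N"
  shows "(\<lambda>\<omega>. det (F \<omega>)) \<in> borel_measurable N"
  unfolding det_def by measurable

lemma matrix_inv_mult:
  fixes A :: "real ^ 'd ^ 'd"
  assumes "invertible A" shows "A ** matrix_inv A = mat 1" "matrix_inv A ** A = mat 1"
  using someI_ex[OF assms[unfolded invertible_def]] unfolding matrix_inv_def by auto

text \<open>Cramer's rule expresses the entries through determinants where the matrix is regular. On
  singular matrices \<open>matrix_inv\<close> selects from an empty predicate, so it has one
  constant value there.\<close>

lemma measurable_matrix_inv:
  fixes F :: "'a \<Rightarrow> real ^ 'd ^ 'd"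
  assumes [measurable]: "\<And>i j. (\<lambda>\<omega>. F \<omega> $ i $ j) \<in> borel_measurable N"
  shows "(\<lambda>\<omega>. matrix_inv (F \<omega>) $ p $ q) \<in> borel_measurable N"
proof -
  have inv: "matrix_inv A $ p $ q = det (\<chi> i j. if j = p then axis q 1 $ i else A $ i $ j) / det A" if "det A \<noteq> 0" for A :: "real^'d^'d"
  proof -
    have "A ** matrix_inv A = mat 1" using that by (simp add: invertible_det_nz matrix_inv_mult)
    then have "A *v (matrix_inv A *v axis q 1) = axis q 1" by (simp add: matrix_vector_mul_assoc)
    then have "matrix_inv A *v axis q 1 = (\<chi> k. det (\<chi> i j. if j = k then axis q 1 $ i else A $ i $ j) / det A)"
      using cramer[OF that] by blast
    then have "(matrix_inv A *v axis q 1) $ p = det (\<chi> i j. if j = p then axis q 1 $ i else A $ i $ j) / det A" by simp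
    then show ?thesis by (simp add: matrix_vector_mult_basis column_def)
  qed
  define K :: "real^'d^'d" where "K = (SOME A'. False)"
  have sing: "matrix_inv A = K" if "det A = 0" for A :: "real^'d^'d"
  proof -
    have "\<not> (A ** A' = mat 1 \<and> A' ** A = mat 1)" for A'
      using that invertible_det_nz[of A] by (auto simp: invertible_def)
    then have "(\<lambda>A'. A ** A' = mat 1 \<and> A' ** A = mat 1) = (\<lambda>_. False)" by blast
    then show ?thesis unfolding matrix_inv_def K_def by (simp only:)
  qed
  have "(\<lambda>\<omega>. matrix_inv (F \<omega>) $ p $ q) = (\<lambda>\<omega>. if det (F \<omega>) = 0 then K $ p $ q
     else det (\<chi> i j. if j = p then axis q 1 $ i else F \<omega> $ i $ j) / det (F \<omega>))"
    by (auto simp: inv sing fun_eq_iff)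
  also have "\<dots> \<in> borel_measurable N"
  proof -
    have [measurable]: "(\<lambda>\<omega>. det (F \<omega>)) \<in> borel_measurable N" by (rule measurable_det) measurable
    have [measurable]: "(\<lambda>\<omega>. det (\<chi> i j. if j = p then axis q 1 $ i else F \<omega> $ i $ j)) \<in> borel_measurable N"
      by (rule measurable_det) simp
    show ?thesis by measurable
  qed
  finally show ?thesis .
qed

lemma norm_vec_square: "(norm (x :: real ^ 'd))\<^sup>2 = (\<Sum>i\<in>UNIV. (x $ i)\<^sup>2)"
  unfolding power2_norm_eq_inner by (simp add: inner_vec_def power2_eq_square)

text \<open>A u splits into the diagonal part, of norm at least a |u|, and the rest, of norm at most
  d^2 b |u|. The constant is crude, but it stays fixed while a tends to infinity.\<close>

lemma diagonally_dominant_bound: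
  fixes A :: "real ^ 'd ^ 'd"
  assumes diag: "\<And>i. a \<le> \<bar>A $ i $ i\<bar>" and off: "\<And>i j. i \<noteq> j \<Longrightarrow> \<bar>A $ i $ j\<bar> \<le> b" and a: "0 \<le> a" "0 \<le> b"
  shows "(a - (real CARD('d))\<^sup>2 * b) * norm u \<le> norm (A *v u)"
proof -
  define D :: "real^'d" where "D = (\<chi> i. A $ i $ i * u $ i)"
  define R where "R = (\<chi> i. \<Sum>j\<in>UNIV - {i}. A $ i $ j * u $ j)"
  have "A *v u = D + R"
  proof (subst vec_eq_iff, rule allI)
    fix i
    have "(\<Sum>j\<in>UNIV. A $ i $ j * u $ j) = A $ i $ i * u $ i + (\<Sum>j\<in>UNIV - {i}. A $ i $ j * u $ j)"
      by (subst sum.remove[of _ i]) auto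
    then show "(A *v u) $ i = (D + R) $ i" by (simp add: D_def R_def matrix_vector_mult_def)
  qed
  moreover have "a * norm u \<le> norm D"
  proof (rule power2_le_imp_le)
    have "(a * norm u)\<^sup>2 = (\<Sum>i\<in>UNIV. a\<^sup>2 * (u $ i)\<^sup>2)"
      by (simp only: power_mult_distrib norm_vec_square sum_distrib_left)
    also have "\<dots> \<le> (\<Sum>i\<in>UNIV. (A $ i $ i)\<^sup>2 * (u $ i)\<^sup>2)"
      using a by (intro sum_mono mult_right_mono) (auto simp: abs_le_square_iff[symmetric] diag)
    also have "\<dots> = (norm D)\<^sup>2" by (simp add: D_def norm_vec_square power_mult_distrib)
    finally show "(a * norm u)\<^sup>2 \<le> (norm D)\<^sup>2" .
  qed simp
  moreover have "norm R \<le> (real CARD('d))\<^sup>2 * b * norm u"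
  proof -
    have "norm R \<le> (\<Sum>i\<in>UNIV. \<bar>R $ i\<bar>)" by (rule norm_le_l1_cart)
    also have "\<dots> \<le> (\<Sum>i\<in>(UNIV::'d set). real CARD('d) * (b * norm u))"
    proof (rule sum_mono)
      fix i
      have "\<bar>R $ i\<bar> \<le> (\<Sum>j\<in>UNIV - {i}. \<bar>A $ i $ j * u $ j\<bar>)" unfolding R_def by simp
      also have "\<dots> \<le> (\<Sum>j\<in>UNIV - {i}. b * norm u)"
        using off[of i] a component_le_norm_cart[of u] by (intro sum_mono) (auto simp: abs_mult intro!: mult_mono)
      also have "\<dots> \<le> (\<Sum>j\<in>(UNIV::'d set). b * norm u)" using a by (intro sum_mono2) auto
      finally show "\<bar>R $ i\<bar> \<le> real CARD('d) * (b * norm u)" by simp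
    qed
    finally show ?thesis by (simp add: power2_eq_square mult.assoc)
  qed
  moreover have "norm D \<le> norm (D + R) + norm R" using norm_triangle_ineq4[of "D + R" R] by simp
  ultimately show ?thesis by (simp add: left_diff_distrib)
qed

lemma bounded_below_invertible:
  fixes A :: "real ^ 'd ^ 'd"
  assumes "g > 0" "\<And>u. g * norm u \<le> norm (A *v u)"
  shows "invertible A" "norm (matrix_inv A *v v) \<le> norm v / g"
proof -
  have "A *v u = 0 \<Longrightarrow> u = 0" for u using assms(2)[of u] assms(1) by (simp add: mult_le_0_iff)
  then show inv: "invertible A" by (metis invertible_left_inverse matrix_left_invertible_ker)
  have "g * norm (matrix_inv A *v v) \<le> norm (A *v (matrix_inv A *v v))" by (rule assms(2))
  also have "A *v (matrix_inv A *v v) = v" using inv by (simp add: matrix_vector_mul_assoc matrix_inv_mult)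
  finally show "norm (matrix_inv A *v v) \<le> norm v / g" using assms(1) by (simp add: field_simps)
qed

subsection \<open>The stopping-set estimator\<close>

text \<open>Unlike \<open>stop_index\<close>, whose \<open>LEAST\<close> is unspecified when a set is never visited, \<open>stops_at A w n i\<close> depends
  on \<open>w 1, \<dots>, w i\<close> only.\<close>

fun stops_at :: "(nat \<Rightarrow> 'b set) \<Rightarrow> (nat \<Rightarrow> 'b) \<Rightarrow> nat \<Rightarrow> nat \<Rightarrow> bool" where
  "stops_at A w 0 i \<longleftrightarrow> i = 0"
| "stops_at A w (Suc n) i \<longleftrightarrow> w i \<in> A (Suc n) \<and> (\<exists>m<i. stops_at A w n m \<and> (\<forall>p. m < p \<and> p < i \<longrightarrow> w p \<notin> A (Suc n)))"

lemma stops_at_unique: "stops_at A w n i \<Longrightarrow> stops_at A w n j \<Longrightarrow> i = j"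
proof (induction n arbitrary: i j)
  case (Suc n)
  then obtain m m' where "m < i" "m' < j" "stops_at A w n m" "stops_at A w n m'"
    "\<forall>p. m < p \<and> p < i \<longrightarrow> w p \<notin> A (Suc n)" "\<forall>p. m' < p \<and> p < j \<longrightarrow> w p \<notin> A (Suc n)" "w i \<in> A (Suc n)" "w j \<in> A (Suc n)" by auto
  moreover from this have "m = m'" using Suc.IH by blast
  ultimately show ?case by (metis linorder_neqE_nat)
qed simp

text \<open>When every set is visited infinitely often, each \<open>LEAST\<close> is attained, and
  the indices satisfy the recursive description that can be tested on past samples.\<close>

lemma stop_index_stops:
  assumes io: "\<And>n m. \<exists>i>m. w i \<in> stop_set a b (e n)"
  shows "stops_at (\<lambda>n. stop_set a b (e n)) w n (stop_index e a b w n)"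
    "stop_index e a b w n < stop_index e a b w (Suc n)" "w (stop_index e a b w (Suc n)) \<in> stop_set a b (e (Suc n))"
proof -
  have *: "stop_index e a b w n < stop_index e a b w (Suc n) \<and> w (stop_index e a b w (Suc n)) \<in> stop_set a b (e (Suc n))" for n
    unfolding stop_index.simps using io[of "stop_index e a b w n" "Suc n"] by (rule LeastI_ex)
  then show "stop_index e a b w n < stop_index e a b w (Suc n)" "w (stop_index e a b w (Suc n)) \<in> stop_set a b (e (Suc n))" by auto
  show "stops_at (\<lambda>n. stop_set a b (e n)) w n (stop_index e a b w n)"
  proof (induction n)
    case (Suc n)
    have "w p \<notin> stop_set a b (e (Suc n))" if "stop_index e a b w n < p" "p < stop_index e a b w (Suc n)" for p
      using that not_less_Least[of p "\<lambda>i. i > stop_index e a b w n \<and> w i \<in> stop_set a b (e (Suc n))"] by auto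
    then show ?case using Suc *[of n] by (auto simp del: stop_index.simps intro!: exI[of _ "stop_index e a b w n"])
  qed simp
qed

text \<open>Searches start strictly after index 0, so entry 0 is never inspected. This permits
  replacing the unspecified sample 0 by the zero vector.\<close>

lemma stop_index_cong:
  assumes "\<And>i. i \<ge> 1 \<Longrightarrow> w i = w' i"
  shows "stop_index e a b w n = stop_index e a b w' n"
proof (induction n)
  case (Suc n)
  have "(i > stop_index e a b w n \<and> w i \<in> stop_set a b (e (Suc n))) = (i > stop_index e a b w' n \<and> w' i \<in> stop_set a b (e (Suc n)))" for i
    using assms[of i] Suc by (cases "i = 0") auto
  then show ?case by simp
qed simp

lemma measurable_stops_at:
  fixes W :: "nat \<Rightarrow> 'a \<Rightarrow> 'b::topological_space"
  assumes W: "\<And>p. 1 \<le> p \<Longrightarrow> p \<le> i \<Longrightarrow> W p \<in> borel_measurable N" and A: "\<And>n. A n \<in> sets borel"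
  shows "Measurable.pred N (\<lambda>\<omega>. stops_at A (\<lambda>p. W p \<omega>) n i)"
  using W
proof (induction n arbitrary: i)
  case (Suc n)
  show ?case
  proof (cases "i = 0")
    case False
    have wp: "Measurable.pred N (\<lambda>\<omega>. W p \<omega> \<in> A (Suc n))" if "1 \<le> p" "p \<le> i" for p
      using measurable_sets[OF Suc.prems[OF that] A[of "Suc n"]]
      by (simp add: pred_def vimage_def Int_def conj_commute)
    have IH: "Measurable.pred N (\<lambda>\<omega>. stops_at A (\<lambda>p. W p \<omega>) n m)" if "m < i" for m
      using that Suc.prems by (intro Suc.IH) auto
    have eq: "(\<forall>p. m < p \<and> p < i \<longrightarrow> W p \<omega> \<notin> A (Suc n)) \<longleftrightarrow> (\<forall>p\<in>{m<..<i}. \<not> W p \<omega> \<in> A (Suc n))" for m \<omega> by auto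
    have eq2: "(\<exists>m<i. P m) \<longleftrightarrow> (\<exists>m\<in>{..<i}. P m)" for P by auto
    have "Measurable.pred N (\<lambda>\<omega>. W i \<omega> \<in> A (Suc n) \<and> (\<exists>m\<in>{..<i}. stops_at A (\<lambda>p. W p \<omega>) n m \<and> (\<forall>p\<in>{m<..<i}. \<not> W p \<omega> \<in> A (Suc n))))"
      using False
      by (intro pred_intros_logic(3) pred_intros_finite(3,4) pred_intros_logic(2) wp IH) auto
    then show ?thesis by (simp only: stops_at.simps eq eq2)
  qed simp
qed simp

lemma stop_set_borel: "stop_set a b l \<in> sets (borel :: (real ^ 'd) measure)"
proof -
  have [measurable]: "(\<lambda>w::real^'d. w $ j) \<in> borel_measurable borel" for j
    by (intro borel_measurable_continuous_onI continuous_intros)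
  have "{w \<in> space borel. \<bar>w $ l\<bar> > a \<and> (\<forall>j. j \<noteq> l \<longrightarrow> \<bar>w $ j\<bar> < b)} \<in> sets (borel :: (real^'d) measure)"
    by measurable
  then show ?thesis by (simp add: stop_set_def)
qed

section \<open>Whitened samples, the regression of Y on them, and stopped samples\<close>

locale whitened_sampling = sampling +
  fixes S :: "real ^ 'd ^ 'd"
  assumes sym: "transpose S = S" and root: "S ** S = \<Sigma>" and inv: "invertible \<Sigma>"
begin

definition T where "T = matrix_inv S"
text \<open>Regression coefficients of Y on the whitened sample, because E (Y W) = T rho; the
  squared norm is the part of the variance of Y that W explains.\<close>

definition \<alpha> where "\<alpha> = T *v \<rho>"
text \<open>Nothing is known about \<open>Xs 0\<close>; the value 0 makes \<open>W i\<close>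
  measurable for every i.\<close>

definition W where "W = (\<lambda>i \<omega>. if i = 0 then 0 else T *v Xs i \<omega>)"
definition Z where "Z = (\<lambda>i \<omega>. Ys i \<omega> - \<alpha> \<bullet> W i \<omega>)"

lemma invertible_S: "invertible S"
  using inv root by (metis det_mul invertible_det_nz mult_eq_0_iff)

lemma ST: "S ** T = mat 1" "T ** S = mat 1"
  using invertible_S by (simp_all add: T_def matrix_inv_mult)

lemma ST_vec: "S *v (T *v v) = v" "T *v (S *v v) = v"
  by (simp_all add: matrix_vector_mul_assoc ST)

lemma sym_inner: "u \<bullet> (S *v v) = (S *v u) \<bullet> v" "u \<bullet> (T *v v) = (T *v u) \<bullet> v"
proof -
  show S: "u \<bullet> (S *v v) = (S *v u) \<bullet> v" for u v using sym symmetric_matrix_inner by blast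
  have "u \<bullet> (T *v v) = (S *v (T *v u)) \<bullet> (T *v v)" by (simp add: ST_vec)
  also have "\<dots> = (T *v u) \<bullet> (S *v (T *v v))" by (rule S[symmetric])
  finally show "u \<bullet> (T *v v) = (T *v u) \<bullet> v" by (simp add: ST_vec)
qed

lemma cov_T: "(T *v u) \<bullet> (\<Sigma> *v (T *v v)) = u \<bullet> v"
  by (simp add: root[symmetric] matrix_vector_mul_assoc[symmetric] ST_vec sym_inner(2)[symmetric])

lemma rho_alpha: "\<rho> = S *v \<alpha>" by (simp add: \<alpha>_def ST_vec)

text \<open>The l-th diagonal entry of S S, which is 1, is the squared norm of S e_l. This serves
  \<open>rho_le_alpha\<close> and the bound on the columns of the matrix that acts on the
  noise.\<close>

lemma norm_S_axis: "(norm (S *v axis l 1))\<^sup>2 = 1"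
proof -
  have "(norm (S *v axis l 1))\<^sup>2 = axis l 1 \<bullet> (\<Sigma> *v axis l 1)"
    by (simp add: power2_norm_eq_inner root[symmetric] matrix_vector_mul_assoc[symmetric] sym_inner)
  then show ?thesis by (simp add: inner_axis' matrix_vector_mult_basis column_def diag)
qed

text \<open>Cauchy-Schwarz: rho_l is the inner product of \<alpha> with the unit vector S
  e_l.\<close>

lemma rho_le_alpha: "(\<rho> $ l)\<^sup>2 \<le> (norm \<alpha>)\<^sup>2"
proof -
  have eq: "\<rho> $ l = (S *v axis l 1) \<bullet> \<alpha>"
    unfolding sym_inner(1)[symmetric] rho_alpha[symmetric] by (simp add: inner_axis')
  have n1: "norm (S *v axis l 1) = 1" by (rule power2_eq_imp_eq) (use norm_S_axis[of l] in auto)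
  have "\<bar>\<rho> $ l\<bar> \<le> norm (S *v axis l 1) * norm \<alpha>" unfolding eq by (rule Cauchy_Schwarz_ineq2)
  then have "\<bar>\<rho> $ l\<bar> \<le> \<bar>norm \<alpha>\<bar>" by (simp only: n1 mult_1_left abs_norm_cancel)
  then show ?thesis by (simp only: abs_le_square_iff)
qed

lemma W_pair: "i \<ge> 1 \<Longrightarrow> W i \<omega> $ j = (T *v axis j 1, 0) \<bullet> (Xs i \<omega>, Ys i \<omega>)"
  by (simp add: W_def sym_inner(2)[symmetric] inner_axis')

lemma Z_pair: "i \<ge> 1 \<Longrightarrow> Z i \<omega> = (- (T *v \<alpha>), 1) \<bullet> (Xs i \<omega>, Ys i \<omega>)"
  by (simp add: Z_def W_def sym_inner(2))

lemma cov_W: "i \<ge> 1 \<Longrightarrow> (\<integral>\<omega>. ((T *v axis p 1, 0) \<bullet> (Xs i \<omega>, Ys i \<omega>)) * ((T *v axis q 1, 0) \<bullet> (Xs i \<omega>, Ys i \<omega>)) \<partial>M) = (if p = q then 1 else 0)"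
  unfolding covariance by (simp add: cov_T inner_axis_axis)

lemma cov_WZ: "i \<ge> 1 \<Longrightarrow> (\<integral>\<omega>. ((T *v axis p 1, 0) \<bullet> (Xs i \<omega>, Ys i \<omega>)) * ((- (T *v \<alpha>), 1) \<bullet> (Xs i \<omega>, Ys i \<omega>)) \<partial>M) = 0"
  unfolding covariance using cov_T[of "axis p 1" \<alpha>] sym_inner(2)[of "axis p 1" \<rho>]
  by (simp add: linear_neg[OF matrix_vector_mul_linear] \<alpha>_def)

lemma cov_Z: "i \<ge> 1 \<Longrightarrow> (\<integral>\<omega>. ((- (T *v \<alpha>), 1) \<bullet> (Xs i \<omega>, Ys i \<omega>)) * ((- (T *v \<alpha>), 1) \<bullet> (Xs i \<omega>, Ys i \<omega>)) \<partial>M) = 1 - (norm \<alpha>)\<^sup>2"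
  unfolding covariance using cov_T[of \<alpha> \<alpha>] sym_inner(2)[of \<alpha> \<rho>]
  by (simp add: linear_neg[OF matrix_vector_mul_linear] power2_norm_eq_inner \<alpha>_def)

lemma alpha_le_1: "(norm \<alpha>)\<^sup>2 \<le> 1"
proof -
  have "0 \<le> (\<integral>\<omega>. ((- (T *v \<alpha>), 1) \<bullet> (Xs 1 \<omega>, Ys 1 \<omega>)) * ((- (T *v \<alpha>), 1) \<bullet> (Xs 1 \<omega>, Ys 1 \<omega>)) \<partial>M)"
    by (intro integral_nonneg_AE) simp
  then show ?thesis using cov_Z[OF order_refl] by linarith
qed

lemma W_measurable[measurable]: "W i \<in> borel_measurable M"
proof (cases "i = 0")
  case False
  then interpret centered_gaussian M "\<lambda>\<omega>. (Xs i \<omega>, Ys i \<omega>)" using gauss by simp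
  show ?thesis
  proof (rule borel_measurable_vecI)
    have i: "i \<ge> 1" using False by simp
    fix j show "(\<lambda>x. W i x $ j) \<in> borel_measurable M" unfolding W_pair[OF i] by measurable
  qed
qed (simp add: W_def)

lemma indep_WZ: "indep_vars (\<lambda>_. borel) (\<lambda>i \<omega>. (W i \<omega>, Z i \<omega>)) {1..}"
proof -
  have "(\<lambda>z::(real^'d) \<times> real. (T *v fst z, snd z - \<alpha> \<bullet> (T *v fst z))) \<in> borel_measurable borel"
  proof -
    have "continuous_on UNIV ((*v) T)" by (rule linear_continuous_on[OF matrix_vector_mul_bounded_linear])
    then have "continuous_on UNIV (\<lambda>z::(real^'d) \<times> real. T *v fst z)"
      by (rule continuous_on_compose2[OF _ continuous_on_fst[OF continuous_on_id]]) auto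
    then show ?thesis by (intro borel_measurable_continuous_onI continuous_intros)
  qed
  from indep_vars_compose2[OF ind, of "\<lambda>_ z. (T *v fst z, snd z - \<alpha> \<bullet> (T *v fst z))" "\<lambda>_. borel", OF this]
  have "indep_vars (\<lambda>_. borel) (\<lambda>i \<omega>. (T *v Xs i \<omega>, Ys i \<omega> - \<alpha> \<bullet> (T *v Xs i \<omega>))) {1..}" by simp
  then show ?thesis
    by (rule indep_vars_cong[THEN iffD1, rotated -1]) (auto simp: W_def Z_def fun_eq_iff)
qed

lemma indep_W: "indep_vars (\<lambda>_. borel) W {1..}"
  using indep_vars_compose2[OF indep_WZ, of "\<lambda>_. fst" "\<lambda>_. borel"] borel_measurable_continuous_onI[OF continuous_on_fst[OF continuous_on_id]]
  by simp

lemma indep_set_WZ: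
  assumes "i \<ge> 1"
  shows "indep_set {W i -` A \<inter> space M |A. A \<in> sets borel} {Z i -` B \<inter> space M |B. B \<in> sets borel}"
proof -
  interpret centered_gaussian M "\<lambda>\<omega>. (Xs i \<omega>, Ys i \<omega>)" using gauss[OF assms] .
  have "W i = (\<lambda>\<omega>. \<chi> j. (T *v axis j 1, 0) \<bullet> (Xs i \<omega>, Ys i \<omega>))"
    using W_pair[OF assms] by (auto simp: vec_eq_iff fun_eq_iff)
  moreover have "Z i = (\<lambda>\<omega>. (- (T *v \<alpha>), 1) \<bullet> (Xs i \<omega>, Ys i \<omega>))" using Z_pair[OF assms] by auto
  ultimately show ?thesis
    using indep_set_inner[of "\<lambda>j. (T *v axis j 1, 0)" "(- (T *v \<alpha>), 1)"] cov_W[OF assms] cov_WZ[OF assms] by (simp only: if_False)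
qed

lemma Z_moments:
  assumes "i \<ge> 1"
  shows "integrable M (\<lambda>\<omega>. (Z i \<omega>)\<^sup>2)" "(\<integral>\<omega>. Z i \<omega> \<partial>M) = 0" "(\<integral>\<omega>. (Z i \<omega>)\<^sup>2 \<partial>M) = 1 - (norm \<alpha>)\<^sup>2"
proof -
  interpret centered_gaussian M "\<lambda>\<omega>. (Xs i \<omega>, Ys i \<omega>)" using gauss[OF assms] .
  show "integrable M (\<lambda>\<omega>. (Z i \<omega>)\<^sup>2)" "(\<integral>\<omega>. Z i \<omega> \<partial>M) = 0" "(\<integral>\<omega>. (Z i \<omega>)\<^sup>2 \<partial>M) = 1 - (norm \<alpha>)\<^sup>2"
    unfolding Z_pair[OF assms] using integrable_square centered cov_Z[OF assms] by (simp_all only: power2_eq_square)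
qed

lemma indep_W_components:
  assumes "i \<ge> 1" shows "indep_vars (\<lambda>_. borel) (\<lambda>j \<omega>. W i \<omega> $ j) UNIV" "distr M borel (\<lambda>\<omega>. W i \<omega> $ j) = gauss"
proof -
  interpret centered_gaussian M "\<lambda>\<omega>. (Xs i \<omega>, Ys i \<omega>)" using gauss[OF assms] .
  show "indep_vars (\<lambda>_. borel) (\<lambda>j \<omega>. W i \<omega> $ j) UNIV"
    unfolding W_pair[OF assms] by (rule indep_vars_inner) (simp only: cov_W[OF assms] if_False)
  show "distr M borel (\<lambda>\<omega>. W i \<omega> $ j) = gauss"
    unfolding W_pair[OF assms] by (rule distr_inner_gauss) (simp add: cov_W[OF assms] power2_eq_square del: inner_Pair)
qed

text \<open>Joint Gaussianity with identity covariance determines the law: the coordinates are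
  independent standard normals, so the law is the image of a product measure that does not involve
  i.\<close>

lemma distr_W: "i \<ge> 1 \<Longrightarrow> distr M borel (W i) = distr M borel (W 1)"
proof -
  assume i: "i \<ge> 1"
  have "distr M borel (W i) = distr (\<Pi>\<^sub>M j\<in>UNIV. gauss) borel (\<lambda>f. \<chi> j. f j)" if i: "i \<ge> 1" for i
  proof -
    have "distr M (\<Pi>\<^sub>M j\<in>UNIV. borel) (\<lambda>x. \<lambda>j\<in>UNIV. W i x $ j) = (\<Pi>\<^sub>M j\<in>UNIV. distr M borel (\<lambda>\<omega>. W i \<omega> $ j))"
      using indep_W_components(1)[OF i]
      by (subst indep_vars_iff_distr_eq_PiM[symmetric, where I = "UNIV :: 'd set" and M' = "\<lambda>_. borel" and X = "\<lambda>j \<omega>. W i \<omega> $ j"]) simp_all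
    then have eq: "(\<Pi>\<^sub>M j\<in>UNIV. gauss) = distr M (\<Pi>\<^sub>M j\<in>UNIV. borel) (\<lambda>x j. W i x $ j)"
      by (simp add: indep_W_components(2)[OF i] restrict_UNIV)
    have m1: "(\<lambda>f. \<chi> j. f j) \<in> borel_measurable (\<Pi>\<^sub>M j\<in>(UNIV::'d set). (borel :: real measure))"
      by (rule borel_measurable_vecI) simp
    have m0: "(\<lambda>x. W i x $ j) \<in> borel_measurable M" for j
      by measurable
    have m2: "(\<lambda>x j. W i x $ j) \<in> measurable M (\<Pi>\<^sub>M j\<in>(UNIV::'d set). (borel :: real measure))"
      using m0 by (intro measurable_PiM_single') auto
    show ?thesis unfolding eq by (subst distr_distr[OF m1 m2]) (simp only: comp_def vec_lambda_eta)
  qed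
  from this[OF i] this[of 1] show ?thesis by simp
qed

text \<open>Only the side w_l > a is counted, and one factor 1 - 2 Q(b) too many is allowed. The
  loss of a constant factor is harmless, as the bound serves for positivity and for the truncation
  excess, a lower order term.\<close>

lemma emeasure_stop_set:
  assumes "b > 0" "a \<ge> 0"
  shows "ennreal (Qfun a * (1 - 2 * Qfun b) ^ CARD('d)) \<le> emeasure (distr M borel (W 1)) (stop_set a b l)"
proof -
  define A where "A = (\<lambda>j. if j = l then {a<..} else {-b<..<b})"
  note I = indep_W_components[OF order_refl]
  have m0[measurable]: "(\<lambda>x. W 1 x $ j) \<in> borel_measurable M" for j
    by measurable
  have A[measurable]: "A j \<in> sets borel" for j by (simp add: A_def)
  have q: "0 \<le> 1 - 2 * Qfun b" "1 - 2 * Qfun b \<le> 1" using Qfun_less_half[OF assms(1)] Qfun_nonneg[of b] by auto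
  have pr: "prob ((\<lambda>\<omega>. W 1 \<omega> $ j) -` A j \<inter> space M) = (if j = l then Qfun a else 1 - 2 * Qfun b)" for j
  proof -
    have "prob ((\<lambda>\<omega>. W 1 \<omega> $ j) -` A j \<inter> space M) = measure (distr M borel (\<lambda>\<omega>. W 1 \<omega> $ j)) (A j)"
      by (rule measure_distr[symmetric]) simp_all
    also have "\<dots> = measure gauss (A j)" unfolding I(2) ..
    finally show ?thesis by (simp add: A_def measure_gauss_greater measure_gauss_abs_less[OF assms(1)])
  qed
  have "Qfun a * (1 - 2 * Qfun b) ^ CARD('d) \<le> Qfun a * (1 - 2 * Qfun b) ^ (CARD('d) - 1)"
    using q Qfun_nonneg[of a] by (intro mult_left_mono power_decreasing) auto
  also have "\<dots> = (\<Prod>j\<in>UNIV. if j = l then Qfun a else 1 - 2 * Qfun b)"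
  proof -
    have "(\<Prod>j\<in>UNIV. if j = l then Qfun a else 1 - 2 * Qfun b) = Qfun a * (\<Prod>j\<in>UNIV - {l}. if j = l then Qfun a else 1 - 2 * Qfun b)"
      by (subst prod.remove[of _ l]) auto
    also have "(\<Prod>j\<in>UNIV - {l}. if j = l then Qfun a else 1 - 2 * Qfun b) = (\<Prod>j\<in>UNIV - {l}. 1 - 2 * Qfun b)"
      by (rule prod.cong) auto
    finally show ?thesis by simp
  qed
  also have "\<dots> = (\<Prod>j\<in>UNIV. prob ((\<lambda>\<omega>. W 1 \<omega> $ j) -` A j \<inter> space M))" by (simp only: pr)
  also have "\<dots> = prob (\<Inter>j\<in>UNIV. (\<lambda>\<omega>. W 1 \<omega> $ j) -` A j \<inter> space M)"
    by (rule indep_varsD[OF I(1), symmetric]) (auto simp: A_def)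
  also have "\<dots> \<le> prob (W 1 -` stop_set a b l \<inter> space M)"
  proof (rule finite_measure_mono)
    show "(\<Inter>j\<in>UNIV. (\<lambda>\<omega>. W 1 \<omega> $ j) -` A j \<inter> space M) \<subseteq> W 1 -` stop_set a b l \<inter> space M"
    proof
      fix \<omega> assume *: "\<omega> \<in> (\<Inter>j\<in>UNIV. (\<lambda>\<omega>. W 1 \<omega> $ j) -` A j \<inter> space M)"
      then have "W 1 \<omega> $ l \<in> A l" "\<And>j. W 1 \<omega> $ j \<in> A j" "\<omega> \<in> space M" by auto
      then show "\<omega> \<in> W 1 -` stop_set a b l \<inter> space M"
        using assms by (fastforce simp: stop_set_def A_def split: if_splits)
    qed
    show "W 1 -` stop_set a b l \<inter> space M \<in> events" using stop_set_borel by measurable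
  qed
  finally show ?thesis
    using stop_set_borel[of a b l] by (simp add: emeasure_distr emeasure_eq_measure ennreal_leI)
qed

text \<open>By symmetry of the normal law, twice the one-sided bound.\<close>

lemma excess_moment:
  assumes c: "c \<ge> 1"
  shows "(\<integral>\<^sup>+w. ennreal ((max 0 (\<bar>w $ l\<bar> - c))\<^sup>2) \<partial>distr M borel (W 1)) \<le> ennreal (8 / c\<^sup>2 * Qfun c)"
proof -
  note I = indep_W_components(2)[OF order_refl]

  have "(\<integral>\<^sup>+w. ennreal ((max 0 (\<bar>w $ l\<bar> - c))\<^sup>2) \<partial>distr M borel (W 1)) = (\<integral>\<^sup>+\<omega>. ennreal ((max 0 (\<bar>W 1 \<omega> $ l\<bar> - c))\<^sup>2) \<partial>M)"
    by (rule nn_integral_distr) simp_all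
  also have "\<dots> = (\<integral>\<^sup>+y. ennreal ((max 0 (\<bar>y\<bar> - c))\<^sup>2) \<partial>distr M borel (\<lambda>\<omega>. W 1 \<omega> $ l))"
    by (rule nn_integral_distr[symmetric]) simp_all
  also have "\<dots> = (\<integral>\<^sup>+y. ennreal ((max 0 (\<bar>y\<bar> - c))\<^sup>2) \<partial>gauss)" unfolding I ..
  also have "\<dots> = (\<integral>\<^sup>+y. ennreal (std_normal_density y) * ennreal ((max 0 (\<bar>y\<bar> - c))\<^sup>2) \<partial>lborel)"
    by (rule nn_integral_density) simp_all
  also have "\<dots> = (\<integral>\<^sup>+y. ennreal (std_normal_density y) * (ennreal ((y - c)\<^sup>2) * indicator {c..} y) 
      + ennreal (std_normal_density (- y)) * (ennreal ((- y - c)\<^sup>2) * indicator {c..} (- y)) \<partial>lborel)"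
    using c by (intro nn_integral_cong) (auto simp: indicator_def max_def abs_if std_normal_density_def power2_eq_square algebra_simps)
  also have "\<dots> = (\<integral>\<^sup>+y. ennreal (std_normal_density y) * (ennreal ((y - c)\<^sup>2) * indicator {c..} y) \<partial>lborel)
      + (\<integral>\<^sup>+y. ennreal (std_normal_density (- y)) * (ennreal ((- y - c)\<^sup>2) * indicator {c..} (- y)) \<partial>lborel)"
    by (rule nn_integral_add) simp_all
  also have "(\<integral>\<^sup>+y. ennreal (std_normal_density (- y)) * (ennreal ((- y - c)\<^sup>2) * indicator {c..} (- y)) \<partial>lborel)
     = (\<integral>\<^sup>+y. ennreal (std_normal_density y) * (ennreal ((y - c)\<^sup>2) * indicator {c..} y) \<partial>lborel)"
    using nn_integral_real_affine[of "\<lambda>y. ennreal (std_normal_density y) * (ennreal ((y - c)\<^sup>2) * indicator {c..} y)" "-1" 0] by simp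
  also have "(\<integral>\<^sup>+y. ennreal (std_normal_density y) * (ennreal ((y - c)\<^sup>2) * indicator {c..} y) \<partial>lborel) =
     (\<integral>\<^sup>+y. ennreal ((y - c)\<^sup>2) * indicator {c..} y \<partial>gauss)"
    by (rule nn_integral_density[symmetric]) simp_all
  finally have "(\<integral>\<^sup>+w. ennreal ((max 0 (\<bar>w $ l\<bar> - c))\<^sup>2) \<partial>distr M borel (W 1)) = (\<integral>\<^sup>+y. ennreal ((y - c)\<^sup>2) * indicator {c..} y \<partial>gauss) + (\<integral>\<^sup>+y. ennreal ((y - c)\<^sup>2) * indicator {c..} y \<partial>gauss)" .
  also have "\<dots> \<le> ennreal (4 / c\<^sup>2 * Qfun c) + ennreal (4 / c\<^sup>2 * Qfun c)"
    by (intro add_mono truncated_second_moment[OF c])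
  also have "\<dots> = ennreal (8 / c\<^sup>2 * Qfun c)" using Qfun_nonneg[of c] by (simp flip: ennreal_plus)
  finally show ?thesis .
qed

lemma AE_visits:
  assumes "b > 0" "a \<ge> 0"
  shows "AE \<omega> in M. \<forall>l n. \<exists>i>n. W i \<omega> \<in> stop_set a b l"
proof -
  have "AE \<omega> in M. \<forall>n. \<exists>i\<in>{1..}. n < i \<and> W i \<omega> \<in> stop_set a b l" for l
  proof (rule AE_infinitely_often[OF indep_W _ _ stop_set_borel])
    show "distr M borel (W i) = distr M borel (W 1)" if "i \<in> {1..}" for i using that by (intro distr_W) simp
    have "0 < Qfun a * (1 - 2 * Qfun b) ^ CARD('d)" using Qfun_pos[of a] Qfun_less_half[OF assms(1)] by simp
    then show "0 < emeasure (distr M borel (W 1)) (stop_set a b l)"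
      using emeasure_stop_set[OF assms, of l] by (metis ennreal_less_zero_iff less_le_trans)
    show "infinite {1::nat..}" by (rule infinite_Ici)
  qed
  then have "AE \<omega> in M. \<forall>l\<in>UNIV. \<forall>n. \<exists>i\<in>{1..}. n < i \<and> W i \<omega> \<in> stop_set a b l"
    by (intro AE_finite_allI) simp_all
  then show ?thesis by eventually_elim blast
qed

text \<open>The law of the stopped sample is not computed:
  \<open>nn_integral_stopped_sample_le\<close> bounds the mean by the unconditional excess divided
  by the probability of the stop set. The former is at most 8/c^2 Q(c) with Q(c) <= Q(a), and Q(a)
  cancels against the latter. What remains is O(1/c^2), which the error bound multiplies by another
  factor of order 1/a^2.\<close>

lemma stopped_excess:
  assumes b: "b > 0" and a: "0 \<le> a" "a \<le> c" "1 \<le> c"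
  shows "(\<integral>\<^sup>+\<omega>. ennreal ((max 0 (\<bar>W (stop_index e a b (\<lambda>i. W i \<omega>) (Suc n)) \<omega> $ l\<bar> - c))\<^sup>2) \<partial>M)
    \<le> ennreal (8 / (c\<^sup>2 * (1 - 2 * Qfun b) ^ CARD('d)))"
proof -
  define A where "A = (\<lambda>n. stop_set a b (e n))"
  \<comment> \<open>Sample i is examined in the search for stop n + 1: stop n occurred at some
    earlier m, and no sample strictly in between hit the set. Only samples before i enter, as the
    stopped-sample inequality demands.\<close>
  define Q where "Q = (\<lambda>i. {\<omega>\<in>space M. \<exists>m\<in>{..<i}. stops_at A (\<lambda>p. W p \<omega>) n m \<and> (\<forall>p\<in>{m<..<i}. \<not> W p \<omega> \<in> A (Suc n))})"
  define J where "J = (\<lambda>\<omega>. stop_index e a b (\<lambda>i. W i \<omega>) (Suc n))"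
  define D where "D = distr M borel (W 1)"
  define \<kappa> where "\<kappa> = (1 - 2 * Qfun b) ^ CARD('d)"
  have \<kappa>: "\<kappa> > 0" using Qfun_less_half[OF b] by (simp add: \<kappa>_def)
  have AB: "A n \<in> sets borel" for n unfolding A_def by (rule stop_set_borel)
  have J: "AE \<omega> in M. J \<omega> \<in> {1..} \<and> \<omega> \<in> Q (J \<omega>) \<and> W (J \<omega>) \<omega> \<in> A (Suc n)"
    using AE_visits[OF b a(1)] AE_space
  proof eventually_elim
    case (elim \<omega>)
    then have io: "\<And>n m. \<exists>i>m. W i \<omega> \<in> stop_set a b (e n)" by blast
    from stop_index_stops(1)[where w = "\<lambda>i. W i \<omega>" and a = a and b = b and e = e and n = "Suc n", OF io] elim(2)
    show ?case by (auto simp: J_def Q_def A_def simp del: stop_index.simps)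
  qed
  have "(\<integral>\<^sup>+\<omega>. ennreal ((max 0 (\<bar>W (J \<omega>) \<omega> $ l\<bar> - c))\<^sup>2) \<partial>M) * emeasure D (A (Suc n))
    \<le> (\<integral>\<^sup>+w. ennreal ((max 0 (\<bar>w $ l\<bar> - c))\<^sup>2) * indicator (A (Suc n)) w \<partial>D)"
  proof (rule nn_integral_stopped_sample_le[OF indep_W, where Q = Q])
    show "distr M borel (W i) = D" if "i \<in> {1..}" for i unfolding D_def using that by (intro distr_W) simp
    show "Q i \<in> sets (gen_algebra M ({1..} \<inter> {..<i}) W)" if "i \<in> {1..}" for i
    proof -
      define G where "G = gen_algebra M ({1..} \<inter> {..<i}) W"
      have WG: "W p \<in> borel_measurable G" if "1 \<le> p" "p < i" for p
        unfolding G_def using that by (intro measurable_gen_algebra) auto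
      have wp: "Measurable.pred G (\<lambda>\<omega>. W p \<omega> \<in> A (Suc n))" if "1 \<le> p" "p < i" for p
        using measurable_sets[OF WG[OF that] AB[of "Suc n"]]
        by (simp add: pred_def vimage_def Int_def conj_commute)
      have "Measurable.pred G (\<lambda>\<omega>. \<exists>m\<in>{..<i}. stops_at A (\<lambda>p. W p \<omega>) n m \<and> (\<forall>p\<in>{m<..<i}. \<not> W p \<omega> \<in> A (Suc n)))"
        by (intro pred_intros_logic(3) pred_intros_finite(3,4) pred_intros_logic(2) wp measurable_stops_at WG AB) auto
      then show ?thesis by (simp add: pred_def Q_def G_def space_gen_algebra)
    qed
    fix \<omega> i j assume *: "\<omega> \<in> Q i" "W i \<omega> \<in> A (Suc n)" "\<omega> \<in> Q j" "W j \<omega> \<in> A (Suc n)"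
    then have "stops_at A (\<lambda>p. W p \<omega>) (Suc n) i" "stops_at A (\<lambda>p. W p \<omega>) (Suc n) j" by (auto simp: Q_def)
    then show "i = j" by (rule stops_at_unique)
  qed (use J AB in \<open>auto\<close>)
  also have "\<dots> \<le> (\<integral>\<^sup>+w. ennreal ((max 0 (\<bar>w $ l\<bar> - c))\<^sup>2) \<partial>D)"
    by (intro nn_integral_mono) (auto split: split_indicator)
  also have "\<dots> \<le> ennreal (8 / c\<^sup>2 * Qfun c)" unfolding D_def by (rule excess_moment[OF a(3)])
  also have "\<dots> \<le> ennreal (8 / (c\<^sup>2 * \<kappa>)) * ennreal (Qfun a * \<kappa>)"
  proof -
    have "8 / c\<^sup>2 * Qfun c \<le> 8 / c\<^sup>2 * Qfun a" using Qfun_antimono[OF a(2)] by (intro mult_left_mono) auto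
    also have "\<dots> = 8 / (c\<^sup>2 * \<kappa>) * (Qfun a * \<kappa>)" using \<kappa> by simp
    finally show ?thesis using \<kappa> Qfun_nonneg[of a] by (simp add: ennreal_mult[symmetric] ennreal_leI)
  qed
  finally have le: "(\<integral>\<^sup>+\<omega>. ennreal ((max 0 (\<bar>W (J \<omega>) \<omega> $ l\<bar> - c))\<^sup>2) \<partial>M) * emeasure D (A (Suc n)) \<le> ennreal (8 / (c\<^sup>2 * \<kappa>)) * ennreal (Qfun a * \<kappa>)" .
  have "(\<integral>\<^sup>+\<omega>. ennreal ((max 0 (\<bar>W (J \<omega>) \<omega> $ l\<bar> - c))\<^sup>2) \<partial>M) * ennreal (Qfun a * \<kappa>) \<le> (\<integral>\<^sup>+\<omega>. ennreal ((max 0 (\<bar>W (J \<omega>) \<omega> $ l\<bar> - c))\<^sup>2) \<partial>M) * emeasure D (A (Suc n))"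
    unfolding D_def \<kappa>_def A_def by (intro mult_left_mono emeasure_stop_set b a) simp
  note mult = order_trans[OF this le]
  have "ennreal (Qfun a * \<kappa>) \<noteq> 0" "ennreal (Qfun a * \<kappa>) \<noteq> top" using Qfun_pos[of a] \<kappa> by simp_all
  from ennreal_mult_le_mult_iff[OF this] mult
  have "(\<integral>\<^sup>+\<omega>. ennreal ((max 0 (\<bar>W (J \<omega>) \<omega> $ l\<bar> - c))\<^sup>2) \<partial>M) \<le> ennreal (8 / (c\<^sup>2 * \<kappa>))"
    by (simp only: mult.commute[of _ "ennreal (Qfun a * \<kappa>)"])
  then show ?thesis by (simp only: J_def \<kappa>_def)
qed

text \<open>With E the quantisation error, Y_J = \<alpha> Wq + (x + z), where x = \<alpha> E and z
  collects the residuals at the selected indices; hence est - rho = (x + z) C with C the inverse of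
  Wq times S. Column l of C has norm at most 1/g, since S e_l is a unit vector and Wq is bounded
  below by g = a - d^2 b; the d coordinates together give the factor d/g^2. The noise contributes 1
  - |\<alpha>|^2, and |x|^2 is at most the sum of the squared entries of E because |\<alpha>| <=
  1.\<close>

lemma stopping_error:
  fixes e :: "nat \<Rightarrow> 'd" and \<theta> :: "'d \<Rightarrow> 'd \<Rightarrow> nat \<Rightarrow> real"
  assumes e: "bij_betw e {1..CARD('d)} UNIV" and b: "b > 0" and a: "a > (real CARD('d))\<^sup>2 * b" "1 \<le> c" "a < c"
    and N: "n > 0" and \<theta>: "\<And>i j k. 0 \<le> \<theta> i j k \<and> \<theta> i j k \<le> 1"
  defines "est \<equiv> \<lambda>\<omega>. let w = (\<lambda>i. T *v Xs i \<omega>);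
          J = column_index e a b w;
          YJ = (\<chi> j. Ys (J j) \<omega>);
          WJ = (\<chi> i j. w (J j) $ i);
          WJq = (\<chi> i j. if i = j then quantize_diag a c (2 * n) (\<theta> i j) (WJ $ i $ j)
                        else quantize (- b) b (2 * n) (\<theta> i j) (WJ $ i $ j))
      in (YJ v* matrix_inv WJq) v* S"
  shows "mse M est \<rho> \<le> ennreal (real CARD('d) / (a - (real CARD('d))\<^sup>2 * b)\<^sup>2 * (1 - (norm \<alpha>)\<^sup>2
     + (real CARD('d))\<^sup>2 * (b / n)\<^sup>2 + real CARD('d) * (2 * ((c - a) / n)\<^sup>2 + 16 / (c\<^sup>2 * (1 - 2 * Qfun b) ^ CARD('d)))))"
proof -
  define d where "d = real CARD('d)"
  define g where "g = a - d\<^sup>2 * b"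
  have g: "g > 0" using a by (simp add: g_def d_def)
  have d: "d > 0" by (simp add: d_def)
  have a0: "a > 0" using a(1) b by (smt (verit) mult_nonneg_nonneg zero_le_power2)
  define G where "G = gen_algebra M {1..} W"
  define J where "J = (\<lambda>j \<omega>. stop_index e a b (\<lambda>i. W i \<omega>) (the_inv_into {1..CARD('d)} e j))"
  define WJ where "WJ = (\<lambda>\<omega> i j. W (J j \<omega>) \<omega> $ i)"
  define Wq :: "'a \<Rightarrow> real^'d^'d" where "Wq = (\<lambda>\<omega>. \<chi> i j. if i = j then quantize_diag a c (2 * n) (\<theta> i j) (WJ \<omega> i j)
                        else quantize (- b) b (2 * n) (\<theta> i j) (WJ \<omega> i j))"
  define E where "E = (\<lambda>\<omega> i j. WJ \<omega> i j - Wq \<omega> $ i $ j)"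
  define x :: "'a \<Rightarrow> real^'d" where "x = (\<lambda>\<omega>. \<chi> j. \<Sum>i\<in>UNIV. \<alpha> $ i * E \<omega> i j)"
  define C where "C = (\<lambda>\<omega>. matrix_inv (Wq \<omega>) ** S)"
  define c0 where "c0 = (\<lambda>l \<omega>. \<Sum>j\<in>UNIV. x \<omega> $ j * C \<omega> $ j $ l)"
  have pos: "the_inv_into {1..CARD('d)} e j \<in> {1..CARD('d)}" "e (the_inv_into {1..CARD('d)} e j) = j" for j
    using e the_inv_into_into[of e "{1..CARD('d)}" j "{1..CARD('d)}"] f_the_inv_into_f[of e "{1..CARD('d)}" j]
    by (auto simp: bij_betw_def)
  have pos_inj: "the_inv_into {1..CARD('d)} e i = the_inv_into {1..CARD('d)} e j \<Longrightarrow> i = j" for i j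
    using pos(2) by metis
  have good: "AE \<omega> in M. inj (\<lambda>j. J j \<omega>) \<and> (\<forall>j. J j \<omega> \<in> {1..}) \<and> (\<forall>j. W (J j \<omega>) \<omega> \<in> stop_set a b j)"
    using AE_visits[OF b less_imp_le[OF a0]]
  proof eventually_elim
    case (elim \<omega>)
    then have io: "\<And>n m. \<exists>i>m. W i \<omega> \<in> stop_set a b (e n)" by blast
    define s where "s = stop_index e a b (\<lambda>i. W i \<omega>)"
    have s: "s n < s (Suc n)" "W (s (Suc n)) \<omega> \<in> stop_set a b (e (Suc n))" for n
      using stop_index_stops(2,3)[where w = "\<lambda>i. W i \<omega>" and a = a and b = b and e = e and n = n, OF io]
      by (auto simp: s_def simp del: stop_index.simps)
    have mono: "strict_mono s" using s(1) by (simp add: strict_mono_Suc_iff)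
    have "inj (\<lambda>j. J j \<omega>)" unfolding J_def s_def[symmetric]
      using pos_inj strict_mono_eq[OF mono] by (intro injI) blast
    moreover have "J j \<omega> \<in> {1..} \<and> W (J j \<omega>) \<omega> \<in> stop_set a b j" for j
    proof -
      obtain k where k: "the_inv_into {1..CARD('d)} e j = Suc k" using pos(1)[of j] by (cases "the_inv_into {1..CARD('d)} e j") auto
      then have "e (Suc k) = j" using pos(2)[of j] by simp
      then show ?thesis using s[of k] unfolding J_def s_def[symmetric] k by auto
    qed
    ultimately show ?case by blast
  qed
  \<comment> \<open>Deterministic consequences of the selected samples lying in their stop sets,
    stated apart from the almost sure event that provides this.\<close>
  have bounds: "(\<forall>i j. i \<noteq> j \<longrightarrow> \<bar>E \<omega> i j\<bar> \<le> b / n) \<and> (\<forall>j. \<bar>E \<omega> j j\<bar> \<le> (c - a) / n + max 0 (\<bar>WJ \<omega> j j\<bar> - c)) \<and>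
      invertible (Wq \<omega>) \<and> (\<forall>l. (\<Sum>j\<in>UNIV. (C \<omega> $ j $ l)\<^sup>2) \<le> 1 / g\<^sup>2)"
    if *: "\<forall>j. W (J j \<omega>) \<omega> \<in> stop_set a b j" for \<omega>
  proof -
    have off: "\<bar>WJ \<omega> i j\<bar> < b" if "i \<noteq> j" for i j using *[rule_format, of j] that by (auto simp: stop_set_def WJ_def)
    have dg: "a \<le> \<bar>WJ \<omega> j j\<bar>" for j using *[rule_format, of j] by (auto simp: stop_set_def WJ_def)
    have off2: "\<bar>Wq \<omega> $ i $ j\<bar> \<le> b \<and> \<bar>E \<omega> i j\<bar> \<le> b / n" if "i \<noteq> j" for i j
    proof -
      have "- b \<le> WJ \<omega> i j" "WJ \<omega> i j \<le> b" using off[OF that] by auto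
      then show ?thesis
        using quantize[of "2 * n" "- b" b "WJ \<omega> i j" "\<theta> i j"] N b \<theta> that by (simp add: Wq_def E_def abs_le_iff)
    qed
    have dg2: "a \<le> \<bar>Wq \<omega> $ j $ j\<bar> \<and> \<bar>E \<omega> j j\<bar> \<le> (c - a) / n + max 0 (\<bar>WJ \<omega> j j\<bar> - c)" for j
      using quantize_diag[of n a c "WJ \<omega> j j" "\<theta> j j"] N a0 a(3) dg \<theta> by (simp add: Wq_def E_def)
    have below: "g * norm u \<le> norm (Wq \<omega> *v u)" for u
      unfolding g_def d_def using dg2 off2 a0 b by (intro diagonally_dominant_bound) auto
    note B = bounded_below_invertible[OF g below]
    have "(\<Sum>j\<in>UNIV. (C \<omega> $ j $ l)\<^sup>2) \<le> 1 / g\<^sup>2" for l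
    proof -
      have "(\<Sum>j\<in>UNIV. (C \<omega> $ j $ l)\<^sup>2) = (norm (C \<omega> *v axis l 1))\<^sup>2"
        by (simp add: norm_vec_square matrix_vector_mult_basis column_def)
      also have "C \<omega> *v axis l 1 = matrix_inv (Wq \<omega>) *v (S *v axis l 1)" by (simp add: C_def matrix_vector_mul_assoc)
      also have "(norm \<dots>)\<^sup>2 \<le> (norm (S *v axis l 1) / g)\<^sup>2" by (intro power_mono B(2)) simp
      also have "\<dots> = 1 / g\<^sup>2" using norm_S_axis[of l] by (simp add: power_divide)
      finally show ?thesis .
    qed
    then show ?thesis using off2 dg2 B(1) by (intro conjI allI impI) simp_all
  qed
  have decomp: "AE \<omega> in M. ennreal ((norm (est \<omega> - \<rho>))\<^sup>2) = (\<Sum>l\<in>UNIV. ennreal ((c0 l \<omega> + (\<Sum>j\<in>UNIV. C \<omega> $ j $ l * Z (J j \<omega>) \<omega>))\<^sup>2))"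
    using good
  proof eventually_elim
    case (elim \<omega>)
    have Weq: "T *v Xs i \<omega> = W i \<omega>" if "i \<ge> 1" for i using that by (simp add: W_def)
    have Jeq: "column_index e a b (\<lambda>i. T *v Xs i \<omega>) j = J j \<omega>" for j
      unfolding column_index_def J_def by (rule stop_index_cong) (rule Weq)
    have WJeq: "T *v Xs (J j \<omega>) \<omega> = W (J j \<omega>) \<omega>" for j using elim by (intro Weq) auto
    have inv: "invertible (Wq \<omega>)" using bounds elim by blast
    define YJ :: "real^'d" where "YJ = (\<chi> j. Ys (J j \<omega>) \<omega>)"
    have est: "est \<omega> = YJ v* matrix_inv (Wq \<omega>) v* S"
      unfolding est_def Let_def Jeq WJeq YJ_def Wq_def WJ_def by (simp cong: if_cong)
    define z :: "real^'d" where "z = (\<chi> j. Z (J j \<omega>) \<omega>)"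
    \<comment> \<open>The quantised matrix replaces the true one and the difference moves into x.
      The part \<alpha> Wq cancels the inverse, leaving \<alpha> S, which is exactly rho.\<close>
    have YJ: "YJ = \<alpha> v* Wq \<omega> + (x \<omega> + z)"
      by (simp add: vec_eq_iff YJ_def z_def x_def E_def Z_def WJ_def vector_matrix_mult_def inner_vec_def
          sum_subtractf right_diff_distrib mult.commute)
    have "\<alpha> v* Wq \<omega> v* matrix_inv (Wq \<omega>) v* S = \<rho>"
    proof -
      have "\<alpha> v* Wq \<omega> v* matrix_inv (Wq \<omega>) = \<alpha>" by (simp add: vector_matrix_mul_assoc matrix_inv_mult inv)
      moreover have "\<alpha> v* S = S *v \<alpha>" using sym by (metis transpose_matrix_vector)
      ultimately show ?thesis by (simp add: rho_alpha[symmetric])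
    qed
    then have "est \<omega> - \<rho> = (x \<omega> + z) v* C \<omega>"
      unfolding est YJ C_def by (simp add: vector_matrix_mul_assoc[symmetric] vector_matrix_left_distrib)
    then have "(norm (est \<omega> - \<rho>))\<^sup>2 = (\<Sum>l\<in>UNIV. (c0 l \<omega> + (\<Sum>j\<in>UNIV. C \<omega> $ j $ l * Z (J j \<omega>) \<omega>))\<^sup>2)"
      by (simp add: norm_vec_square c0_def z_def vector_matrix_mult_def distrib_left sum.distrib mult.commute)
    then show ?case by simp
  qed
  have WG: "W i \<in> borel_measurable G" for i
    by (cases "i = 0") (simp_all add: W_def[THEN fun_cong, of 0] G_def measurable_gen_algebra)
  note [measurable] = WG
  have stopG: "(\<lambda>\<omega>. stop_index e a b (\<lambda>i. W i \<omega>) k) \<in> measurable G (count_space UNIV)" for k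
  proof (induction k)
    case (Suc k)
    note [measurable] = Suc stop_set_borel
    show ?case by simp
  qed simp
  have JG[measurable]: "J j \<in> measurable G (count_space UNIV)" for j unfolding J_def by (rule stopG)
  have WJG[measurable]: "(\<lambda>\<omega>. WJ \<omega> i j) \<in> borel_measurable G" for i j
    unfolding WJ_def by (rule measurable_compose_countable[OF _ JG]) measurable
  note [measurable] = measurable_compose[OF WJG measurable_quantize] measurable_compose[OF WJG measurable_quantize_diag]
  have WqG[measurable]: "(\<lambda>\<omega>. Wq \<omega> $ i $ j) \<in> borel_measurable G" for i j
    unfolding Wq_def by (cases "i = j") simp_all
  have [measurable]: "(\<lambda>\<omega>. matrix_inv (Wq \<omega>) $ i $ j) \<in> borel_measurable G" for i j
    by (rule measurable_matrix_inv) measurable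
  have CG[measurable]: "(\<lambda>\<omega>. C \<omega> $ i $ j) \<in> borel_measurable G" for i j
    unfolding C_def matrix_matrix_mult_def by simp
  have EG[measurable]: "(\<lambda>\<omega>. E \<omega> i j) \<in> borel_measurable G" for i j unfolding E_def by measurable
  have [measurable]: "(\<lambda>\<omega>. x \<omega> $ j) \<in> borel_measurable G" for j
  proof -
    have "(\<lambda>\<omega>. x \<omega> $ j) = (\<lambda>\<omega>. \<Sum>i\<in>UNIV. \<alpha> $ i * E \<omega> i j)" by (simp add: x_def)
    then show ?thesis by (simp only:) measurable
  qed
  have c0G[measurable]: "c0 l \<in> borel_measurable G" for l unfolding c0_def by measurable
  have GM: "f \<in> borel_measurable M" if "f \<in> borel_measurable G" for f :: "'a \<Rightarrow> real"
    by (rule measurable_gen_algebra_subset[OF _ that[unfolded G_def]]) (rule W_measurable)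
  note [measurable] = GM[OF WJG] GM[OF CG] GM[OF EG]
  have [measurable]: "c0 l \<in> borel_measurable M" for l by (rule GM) measurable
  \<comment> \<open>Bound of \<open>stopped_excess\<close>; since the squared sum of cell error u
    and excess v is estimated by 2 u^2 + 2 v^2, its 8 becomes the 16 of the conclusion.\<close>
  define ex where "ex = 8 / (c\<^sup>2 * (1 - 2 * Qfun b) ^ CARD('d))"
  have ex0: "ex \<ge> 0" using Qfun_less_half[OF b] by (simp add: ex_def)
  have s2: "0 \<le> 1 - (norm \<alpha>)\<^sup>2" using alpha_le_1 by simp
  have comp: "(\<integral>\<^sup>+\<omega>. ennreal ((c0 l \<omega> + (\<Sum>j\<in>UNIV. C \<omega> $ j $ l * Z (J j \<omega>) \<omega>))\<^sup>2) \<partial>M)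
     = (\<integral>\<^sup>+\<omega>. ennreal ((c0 l \<omega>)\<^sup>2 + (1 - (norm \<alpha>)\<^sup>2) * (\<Sum>j\<in>UNIV. (C \<omega> $ j $ l)\<^sup>2)) \<partial>M)" for l
  proof (rule second_moment_indep_noise[OF indep_WZ])
    show "AE \<omega> in M. inj (\<lambda>j. J j \<omega>) \<and> (\<forall>j. J j \<omega> \<in> {1..})" using good by eventually_elim blast
    show "J j \<in> measurable (gen_algebra M {1..} W) (count_space UNIV)" for j using JG[of j] by (simp only: G_def)
    show "(\<lambda>\<omega>. C \<omega> $ j $ l) \<in> borel_measurable (gen_algebra M {1..} W)" for j using CG[of j l] by (simp only: G_def)
    show "c0 l \<in> borel_measurable (gen_algebra M {1..} W)" using c0G[of l] by (simp only: G_def)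
    fix i :: nat assume "i \<in> {1..}"
    then have i: "i \<ge> 1" by simp
    show "integrable M (\<lambda>\<omega>. (Z i \<omega>)\<^sup>2)" "(\<integral>\<omega>. Z i \<omega> \<partial>M) = 0" "(\<integral>\<omega>. (Z i \<omega>)\<^sup>2 \<partial>M) = 1 - (norm \<alpha>)\<^sup>2"
      by (rule Z_moments[OF i])+
    show "indep_set {W i -` A \<inter> space M |A. A \<in> sets borel} {Z i -` B \<inter> space M |B. B \<in> sets borel}"
      by (rule indep_set_WZ[OF i])
  qed
  have pointwise: "AE \<omega> in M. (c0 l \<omega>)\<^sup>2 + (1 - (norm \<alpha>)\<^sup>2) * (\<Sum>j\<in>UNIV. (C \<omega> $ j $ l)\<^sup>2)
     \<le> 1 / g\<^sup>2 * (1 - (norm \<alpha>)\<^sup>2 + d\<^sup>2 * (b / n)\<^sup>2 + d * (2 * ((c - a) / n)\<^sup>2)) + (\<Sum>j\<in>UNIV. 2 / g\<^sup>2 * (max 0 (\<bar>WJ \<omega> j j\<bar> - c))\<^sup>2)" for l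
    using good
  proof eventually_elim
    case (elim \<omega>)
    note B = bounds[of \<omega>, OF conjunct2[OF conjunct2[OF elim]]]
    define K where "K = (\<Sum>j\<in>UNIV. (C \<omega> $ j $ l)\<^sup>2)"
    have K: "0 \<le> K" "K \<le> 1 / g\<^sup>2" using B by (auto simp: K_def intro: sum_nonneg)
    have Kcol: "K = (norm (column l (C \<omega>)))\<^sup>2" by (simp add: K_def norm_vec_square column_def)
    have "c0 l \<omega> = x \<omega> \<bullet> column l (C \<omega>)" by (simp add: c0_def inner_vec_def column_def)
    then have "\<bar>c0 l \<omega>\<bar> \<le> norm (x \<omega>) * norm (column l (C \<omega>))" by (simp only: Cauchy_Schwarz_ineq2)
    then have "(c0 l \<omega>)\<^sup>2 \<le> (norm (x \<omega>) * norm (column l (C \<omega>)))\<^sup>2" by (metis abs_ge_zero power2_abs power_mono)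
    then have c0K: "(c0 l \<omega>)\<^sup>2 \<le> (norm (x \<omega>))\<^sup>2 * K" by (simp add: power_mult_distrib Kcol)
    have "(norm (x \<omega>))\<^sup>2 \<le> (\<Sum>j\<in>UNIV. \<Sum>i\<in>UNIV. (E \<omega> i j)\<^sup>2)"
      unfolding norm_vec_square
    proof (rule sum_mono)
      fix j
      have "x \<omega> $ j = \<alpha> \<bullet> (\<chi> i. E \<omega> i j)" by (simp add: x_def inner_vec_def)
      then have "(x \<omega> $ j)\<^sup>2 \<le> (norm \<alpha> * norm (\<chi> i. E \<omega> i j))\<^sup>2" using Cauchy_Schwarz_ineq2[of \<alpha> "\<chi> i. E \<omega> i j"]
        by (metis abs_ge_zero power2_abs power_mono)
      also have "\<dots> = (norm \<alpha>)\<^sup>2 * (\<Sum>i\<in>UNIV. (E \<omega> i j)\<^sup>2)" by (simp add: power_mult_distrib norm_vec_square[of "\<chi> i. E \<omega> i j"])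
      also have "\<dots> \<le> 1 * (\<Sum>i\<in>UNIV. (E \<omega> i j)\<^sup>2)" by (intro mult_right_mono alpha_le_1 sum_nonneg) simp
      finally show "(x \<omega> $ j)\<^sup>2 \<le> (\<Sum>i\<in>UNIV. (E \<omega> i j)\<^sup>2)" by simp
    qed
    also have "\<dots> \<le> (\<Sum>j\<in>UNIV. d * (b / n)\<^sup>2 + (2 * ((c - a) / n)\<^sup>2 + 2 * (max 0 (\<bar>WJ \<omega> j j\<bar> - c))\<^sup>2))"
    proof (rule sum_mono)
      fix j
      have "(\<Sum>i\<in>UNIV. (E \<omega> i j)\<^sup>2) = (\<Sum>i\<in>UNIV - {j}. (E \<omega> i j)\<^sup>2) + (E \<omega> j j)\<^sup>2"
        by (subst sum.remove[of _ j]) auto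
      moreover have "(\<Sum>i\<in>UNIV - {j}. (E \<omega> i j)\<^sup>2) \<le> d * (b / n)\<^sup>2"
      proof -
        have "(\<Sum>i\<in>UNIV - {j}. (E \<omega> i j)\<^sup>2) \<le> (\<Sum>i\<in>UNIV - {j}. (b / n)\<^sup>2)"
        proof (rule sum_mono)
          fix i assume "i \<in> UNIV - {j}"
          then have "\<bar>E \<omega> i j\<bar> \<le> b / n" using B by auto
          then show "(E \<omega> i j)\<^sup>2 \<le> (b / n)\<^sup>2" by (metis abs_ge_zero power2_abs power_mono)
        qed
        also have "\<dots> \<le> (\<Sum>i\<in>(UNIV::'d set). (b / n)\<^sup>2)" by (intro sum_mono2) auto
        finally show ?thesis by (simp add: d_def)
      qed
      moreover have "(E \<omega> j j)\<^sup>2 \<le> 2 * ((c - a) / n)\<^sup>2 + 2 * (max 0 (\<bar>WJ \<omega> j j\<bar> - c))\<^sup>2"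
      proof -
        define u v where "u = (c - a) / n" and "v = max 0 (\<bar>WJ \<omega> j j\<bar> - c)"
        have "\<bar>E \<omega> j j\<bar> \<le> u + v" using B by (simp add: u_def v_def)
        then have "(E \<omega> j j)\<^sup>2 \<le> (u + v)\<^sup>2" by (metis abs_ge_zero power2_abs power_mono)
        also have "\<dots> \<le> 2 * u\<^sup>2 + 2 * v\<^sup>2" using zero_le_power2[of "u - v"] by (simp add: power2_eq_square algebra_simps)
        finally show ?thesis by (simp only: u_def v_def)
      qed
      ultimately show "(\<Sum>i\<in>UNIV. (E \<omega> i j)\<^sup>2) \<le> d * (b / n)\<^sup>2 + (2 * ((c - a) / n)\<^sup>2 + 2 * (max 0 (\<bar>WJ \<omega> j j\<bar> - c))\<^sup>2)" by linarith
    qed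
    also have "\<dots> = d\<^sup>2 * (b / n)\<^sup>2 + d * (2 * ((c - a) / n)\<^sup>2) + (\<Sum>j\<in>UNIV. 2 * (max 0 (\<bar>WJ \<omega> j j\<bar> - c))\<^sup>2)"
      by (simp add: sum.distrib d_def power2_eq_square[of "real _"])
    finally have xb: "(norm (x \<omega>))\<^sup>2 \<le> d\<^sup>2 * (b / n)\<^sup>2 + d * (2 * ((c - a) / n)\<^sup>2) + (\<Sum>j\<in>UNIV. 2 * (max 0 (\<bar>WJ \<omega> j j\<bar> - c))\<^sup>2)" .
    have "(c0 l \<omega>)\<^sup>2 + (1 - (norm \<alpha>)\<^sup>2) * K \<le> (1 - (norm \<alpha>)\<^sup>2 + (norm (x \<omega>))\<^sup>2) * K" using c0K by (simp add: algebra_simps)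
    also have "\<dots> \<le> (1 - (norm \<alpha>)\<^sup>2 + (norm (x \<omega>))\<^sup>2) * (1 / g\<^sup>2)" using K s2 by (intro mult_left_mono) auto
    also have "\<dots> \<le> (1 - (norm \<alpha>)\<^sup>2 + (d\<^sup>2 * (b / n)\<^sup>2 + d * (2 * ((c - a) / n)\<^sup>2) + (\<Sum>j\<in>UNIV. 2 * (max 0 (\<bar>WJ \<omega> j j\<bar> - c))\<^sup>2))) * (1 / g\<^sup>2)"
      using xb by (intro mult_right_mono) auto
    also have "\<dots> = 1 / g\<^sup>2 * (1 - (norm \<alpha>)\<^sup>2 + d\<^sup>2 * (b / n)\<^sup>2 + d * (2 * ((c - a) / n)\<^sup>2)) + (\<Sum>j\<in>UNIV. 2 / g\<^sup>2 * (max 0 (\<bar>WJ \<omega> j j\<bar> - c))\<^sup>2)"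
      by (simp add: add_divide_distrib sum_divide_distrib)
    finally show ?case by (simp only: K_def)
  qed
  define H where "H = 1 / g\<^sup>2 * (1 - (norm \<alpha>)\<^sup>2 + d\<^sup>2 * (b / n)\<^sup>2 + d * (2 * ((c - a) / n)\<^sup>2))"
  have H0: "H \<ge> 0" using s2 d by (simp add: H_def)
  have each: "(\<integral>\<^sup>+\<omega>. ennreal ((c0 l \<omega> + (\<Sum>j\<in>UNIV. C \<omega> $ j $ l * Z (J j \<omega>) \<omega>))\<^sup>2) \<partial>M) \<le> ennreal (H + d * (2 / g\<^sup>2 * ex))" for l
  proof -
    have "(\<integral>\<^sup>+\<omega>. ennreal ((c0 l \<omega> + (\<Sum>j\<in>UNIV. C \<omega> $ j $ l * Z (J j \<omega>) \<omega>))\<^sup>2) \<partial>M)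
      \<le> (\<integral>\<^sup>+\<omega>. ennreal H + (\<Sum>j\<in>UNIV. ennreal (2 / g\<^sup>2) * ennreal ((max 0 (\<bar>WJ \<omega> j j\<bar> - c))\<^sup>2)) \<partial>M)"
      unfolding comp
    proof (rule nn_integral_mono_AE)
      show "AE \<omega> in M. ennreal ((c0 l \<omega>)\<^sup>2 + (1 - (norm \<alpha>)\<^sup>2) * (\<Sum>j\<in>UNIV. (C \<omega> $ j $ l)\<^sup>2)) \<le>
          ennreal H + (\<Sum>j\<in>UNIV. ennreal (2 / g\<^sup>2) * ennreal ((max 0 (\<bar>WJ \<omega> j j\<bar> - c))\<^sup>2))"
        using pointwise[of l]
      proof eventually_elim
        case (elim \<omega>)
        have "ennreal H + (\<Sum>j\<in>UNIV. ennreal (2 / g\<^sup>2) * ennreal ((max 0 (\<bar>WJ \<omega> j j\<bar> - c))\<^sup>2)) =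
          ennreal (H + (\<Sum>j\<in>UNIV. 2 / g\<^sup>2 * (max 0 (\<bar>WJ \<omega> j j\<bar> - c))\<^sup>2))"
          using H0 by (subst ennreal_plus) (auto simp: ennreal_mult[symmetric] sum_nonneg)
        then show ?case using ennreal_leI[OF elim] by (simp only: H_def)
      qed
    qed
    also have "\<dots> = ennreal H + (\<Sum>j\<in>UNIV. ennreal (2 / g\<^sup>2) * (\<integral>\<^sup>+\<omega>. ennreal ((max 0 (\<bar>WJ \<omega> j j\<bar> - c))\<^sup>2) \<partial>M))"
      by (subst nn_integral_add) (simp_all add: nn_integral_sum nn_integral_cmult emeasure_space_1)
    also have "\<dots> \<le> ennreal H + (\<Sum>j\<in>(UNIV::'d set). ennreal (2 / g\<^sup>2) * ennreal ex)"
    proof (intro add_left_mono sum_mono mult_left_mono)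
      fix j :: 'd
      obtain k where k: "the_inv_into {1..CARD('d)} e j = Suc k" using pos(1)[of j] by (cases "the_inv_into {1..CARD('d)} e j") auto
      show "(\<integral>\<^sup>+\<omega>. ennreal ((max 0 (\<bar>WJ \<omega> j j\<bar> - c))\<^sup>2) \<partial>M) \<le> ennreal ex"
        unfolding WJ_def J_def k ex_def using b a0 a by (intro stopped_excess) auto
    qed simp
    also have "\<dots> = ennreal (H + d * (2 / g\<^sup>2 * ex))"
      using H0 ex0 by (simp add: d_def ennreal_mult[symmetric] ennreal_of_nat_eq_real_of_nat flip: ennreal_plus)
    finally show ?thesis .
  qed
  have [measurable]: "(\<lambda>\<omega>. c0 l \<omega> + (\<Sum>j\<in>UNIV. C \<omega> $ j $ l * Z' j \<omega>)) \<in> borel_measurable M" if "\<And>j. Z' j \<in> borel_measurable M" for l Z'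
    using that by measurable
  have mse1: "mse M est \<rho> = (\<integral>\<^sup>+\<omega>. (\<Sum>l\<in>UNIV. ennreal ((c0 l \<omega> + (\<Sum>j\<in>UNIV. C \<omega> $ j $ l * Z (J j \<omega>) \<omega>))\<^sup>2)) \<partial>M)"
    unfolding mse_def by (rule nn_integral_cong_AE[OF decomp])
  have "\<dots> = (\<Sum>l\<in>UNIV. \<integral>\<^sup>+\<omega>. ennreal ((c0 l \<omega> + (\<Sum>j\<in>UNIV. C \<omega> $ j $ l * Z (J j \<omega>) \<omega>))\<^sup>2) \<partial>M)"
  proof -
    define ZJ where "ZJ = (\<lambda>j \<omega>. if J j \<omega> \<in> {1..} then Z (J j \<omega>) \<omega> else 0)"
    have Z1: "Z i \<in> borel_measurable M" if "i \<in> {1..}" for i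
    proof -
      interpret centered_gaussian M "\<lambda>\<omega>. (Xs i \<omega>, Ys i \<omega>)" using gauss that by simp
      have "Z i = (\<lambda>\<omega>. (- (T *v \<alpha>), 1) \<bullet> (Xs i \<omega>, Ys i \<omega>))" using Z_pair[of i] that by auto
      then show ?thesis by (simp only:) measurable
    qed
    have JM: "J j \<in> measurable M (count_space UNIV)" for j
      using measurable_gen_algebra_subset[of "{1..}" W M "J j"] JG unfolding G_def by simp
    have ZJ[measurable]: "ZJ j \<in> borel_measurable M" for j
    proof -
      have "(\<lambda>\<omega>. if i \<in> {1..} then Z i \<omega> else 0) \<in> borel_measurable M" for i using Z1[of i] by (cases "i \<in> {1..}") auto
      from measurable_compose_countable[OF this JM[of j]] show ?thesis by (simp only: ZJ_def)
    qed
    have AEZ: "AE \<omega> in M. \<forall>j. Z (J j \<omega>) \<omega> = ZJ j \<omega>" using good by eventually_elim (simp add: ZJ_def)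
    have "(\<integral>\<^sup>+\<omega>. (\<Sum>l\<in>UNIV. ennreal ((c0 l \<omega> + (\<Sum>j\<in>UNIV. C \<omega> $ j $ l * Z (J j \<omega>) \<omega>))\<^sup>2)) \<partial>M)
      = (\<integral>\<^sup>+\<omega>. (\<Sum>l\<in>UNIV. ennreal ((c0 l \<omega> + (\<Sum>j\<in>UNIV. C \<omega> $ j $ l * ZJ j \<omega>))\<^sup>2)) \<partial>M)"
      by (rule nn_integral_cong_AE) (use AEZ in eventually_elim, simp)
    also have "\<dots> = (\<Sum>l\<in>UNIV. \<integral>\<^sup>+\<omega>. ennreal ((c0 l \<omega> + (\<Sum>j\<in>UNIV. C \<omega> $ j $ l * ZJ j \<omega>))\<^sup>2) \<partial>M)"
      by (rule nn_integral_sum) measurable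
    also have "\<dots> = (\<Sum>l\<in>UNIV. \<integral>\<^sup>+\<omega>. ennreal ((c0 l \<omega> + (\<Sum>j\<in>UNIV. C \<omega> $ j $ l * Z (J j \<omega>) \<omega>))\<^sup>2) \<partial>M)"
      by (intro sum.cong refl nn_integral_cong_AE) (use AEZ in eventually_elim, simp)
    finally show ?thesis .
  qed
  also have "\<dots> \<le> (\<Sum>l\<in>(UNIV::'d set). ennreal (H + d * (2 / g\<^sup>2 * ex)))" by (intro sum_mono each)
  also have "\<dots> = ennreal (d * (H + d * (2 / g\<^sup>2 * ex)))"
  proof -
    have "0 \<le> H + d * (2 / g\<^sup>2 * ex)" using H0 ex0 d by simp
    then show ?thesis
      using d by (simp only: sum_constant ennreal_of_nat_eq_real_of_nat d_def[symmetric] ennreal_mult[symmetric] less_imp_le)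
  qed
  also have "d * (H + d * (2 / g\<^sup>2 * ex)) = d / g\<^sup>2 * (1 - (norm \<alpha>)\<^sup>2 + d\<^sup>2 * (b / n)\<^sup>2 + d * (2 * ((c - a) / n)\<^sup>2 + 2 * ex))"
    by (simp add: H_def add_divide_distrib distrib_left)
  finally show ?thesis unfolding mse1 by (simp add: g_def d_def ex_def)
qed

text \<open>From k_l / k -> 1/d one gets a^2 ~ 2 ln 2 k / d, hence k d / (a - d^2 b)^2 -> d^2 / (2
  ln 2). The remainder \<open>R\<close> vanishes: cells shrink like 2^(-k_q) with k_q ~ 2 sqrt k /
  d^2, and the truncation excess is O(1/a^2).\<close>

lemma stopping_limit:
  fixes e :: "nat \<Rightarrow> 'd" and \<theta> :: "real \<Rightarrow> 'd \<Rightarrow> 'd \<Rightarrow> nat \<Rightarrow> real"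
  assumes e: "bij_betw e {1..CARD('d)} UNIV" and b: "b > 0"
    and \<theta>: "\<And>k i j n. 0 \<le> \<theta> k i j n \<and> \<theta> k i j n \<le> 1" and S: "S = sqrt_mat \<Sigma>"
  obtains B where "(B \<longlongrightarrow> (1 - (norm \<alpha>)\<^sup>2) * (real CARD('d))\<^sup>2 / (2 * ln 2)) at_top"
    "\<forall>\<^sub>F k in at_top. k \<in> admissible_bits CARD('d) \<longrightarrow>
      ennreal k * mse M (\<lambda>\<omega>. stopping_estimator e \<Sigma> b (\<theta> k) k (\<lambda>i. Xs i \<omega>) (\<lambda>i. Ys i \<omega>)) \<rho> \<le> ennreal (B k)"
proof -
  define d where "d = real CARD('d)"
  have d: "d > 0" by (simp add: d_def)
  define q where "q = 1 - 2 * Qfun b"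
  have q: "q > 0" using Qfun_less_half[OF b] by (simp add: q_def)
  define a where "a = stop_level CARD('d) b"
  define K where "K = loc_bits CARD('d)"
  \<comment> \<open>Half the number of cells, that is the cells on each side of the diagonal
    quantiser. Being defined for all real k, it admits limits along all k; at admissible k it is the
    integer n of \<open>stopping_error\<close>.\<close>
  define \<nu> where "\<nu> = (\<lambda>k. 2 powr (quant_bits CARD('d) k - 1))"
  have K_eq: "K = (\<lambda>k. (sqrt (k + 1) - 1)\<^sup>2 / d)" by (simp add: K_def loc_bits_def[abs_def] d_def)
  have Kinf: "filterlim K at_top at_top" unfolding K_eq using d by real_asymp
  have Kk: "((\<lambda>k. K k / k) \<longlongrightarrow> 1 / d) at_top"
  proof -
    have "((\<lambda>k. K k / k) \<longlongrightarrow> inverse d) at_top" unfolding K_eq using d by real_asymp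
    then show ?thesis by (simp only: inverse_eq_divide)
  qed
  have a_eq: "a = (\<lambda>k. Qinv (geom_entropy_inv (K k) / (2 * q ^ (CARD('d) - 1))))"
    by (simp add: a_def stop_level_def[abs_def] K_def q_def)
  have C: "2 * q ^ (CARD('d) - 1) > 0" using q by simp
  note A = Qinv_geom_asymp[OF Kinf C, folded a_eq]
  have ainf: "filterlim a at_top at_top" using A(1) by (simp add: a_eq)
  have aK: "((\<lambda>k. (a k)\<^sup>2 / K k) \<longlongrightarrow> 2 * ln 2) at_top" using A(3) by (simp add: a_eq)
  have Kpos: "\<forall>\<^sub>F k in at_top. K k > 0" using Kinf by (simp add: filterlim_at_top_dense)
  \<comment> \<open>Beyond this level a - d^2 b is positive, as the error bound requires, and a > 1
    makes c = sqrt 3 a at least 1.\<close>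
  have apos: "\<forall>\<^sub>F k in at_top. a k > d\<^sup>2 * b + 1" using ainf by (simp add: filterlim_at_top_dense)
  have ak: "((\<lambda>k. (a k)\<^sup>2 / k) \<longlongrightarrow> 2 * ln 2 * (1 / d)) at_top"
  proof (rule Lim_transform_eventually[OF tendsto_mult[OF aK Kk]])
    show "\<forall>\<^sub>F k in at_top. (a k)\<^sup>2 / K k * (K k / k) = (a k)\<^sup>2 / k"
      using Kpos by eventually_elim simp
  qed
  have ratio: "((\<lambda>k. (a k - d\<^sup>2 * b) / a k) \<longlongrightarrow> 1) at_top"
  proof -
    have "((\<lambda>y. (y - d\<^sup>2 * b) / y) \<longlongrightarrow> 1) at_top" by real_asymp
    then show ?thesis by (rule filterlim_compose[OF _ ainf])
  qed
  have kg: "((\<lambda>k. k / (a k - d\<^sup>2 * b)\<^sup>2) \<longlongrightarrow> d / (2 * ln 2)) at_top"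
  proof -
    have "((\<lambda>k. 1 / ((a k)\<^sup>2 / k * ((a k - d\<^sup>2 * b) / a k)\<^sup>2)) \<longlongrightarrow> 1 / (2 * ln 2 * (1 / d) * 1\<^sup>2)) at_top"
      using d by (intro tendsto_intros ak ratio) auto
    moreover have "\<forall>\<^sub>F k in at_top. 1 / ((a k)\<^sup>2 / k * ((a k - d\<^sup>2 * b) / a k)\<^sup>2) = k / (a k - d\<^sup>2 * b)\<^sup>2"
      using apos
    proof eventually_elim
      case (elim k)
      have "d\<^sup>2 * b \<ge> 0" using b by simp
      then have "a k > 0" using elim by linarith
      then show ?case by (simp add: power_divide)
    qed
    ultimately show ?thesis by (simp add: Lim_transform_eventually)
  qed
  \<comment> \<open>4 k_l / d^3 is a perfect square, so k_q = 2 (sqrt (k + 1) - 1) / d^2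
    explicitly.\<close>
  have \<nu>_eq: "\<forall>\<^sub>F k in at_top. \<nu> k = 2 powr (2 * (sqrt (k + 1) - 1) / d\<^sup>2 - 1)"
    using eventually_gt_at_top[of 0]
  proof eventually_elim
    case (elim k)
    have "4 * (s\<^sup>2 / d) / d ^ 3 = (2 * s / d\<^sup>2)\<^sup>2" for s
      using d by (simp add: power2_eq_square power3_eq_cube field_simps)
    then have "quant_bits CARD('d) k = sqrt ((2 * (sqrt (k + 1) - 1) / d\<^sup>2)\<^sup>2)"
      unfolding quant_bits_def loc_bits_def d_def[symmetric] by (simp only:)
    also have "\<dots> = 2 * (sqrt (k + 1) - 1) / d\<^sup>2" using elim by (simp add: real_sqrt_abs)
    finally show ?case by (simp add: \<nu>_def)
  qed
  have "((\<lambda>k. 1 / 2 powr (2 * (sqrt (k + 1) - 1) / d\<^sup>2 - 1)) \<longlongrightarrow> 0) at_top" using d by real_asymp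
  then have \<nu>0: "((\<lambda>k. 1 / \<nu> k) \<longlongrightarrow> 0) at_top"
    by (rule Lim_transform_eventually) (use \<nu>_eq in eventually_elim, simp)
  have "((\<lambda>k. k * (1 / 2 powr (2 * (sqrt (k + 1) - 1) / d\<^sup>2 - 1))\<^sup>2) \<longlongrightarrow> 0) at_top" using d by real_asymp
  then have k\<nu>: "((\<lambda>k. k * (1 / \<nu> k)\<^sup>2) \<longlongrightarrow> 0) at_top"
    by (rule Lim_transform_eventually) (use \<nu>_eq in eventually_elim, simp)
  \<comment> \<open>The diagonal range (sqrt 3 - 1) a grows with k, so the cell size must vanish
    even after multiplication by a.\<close>
  have a\<nu>: "((\<lambda>k. (a k)\<^sup>2 * (1 / \<nu> k)\<^sup>2) \<longlongrightarrow> 0) at_top"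
  proof -
    have "((\<lambda>k. (a k)\<^sup>2 / k * (k * (1 / \<nu> k)\<^sup>2)) \<longlongrightarrow> 2 * ln 2 * (1 / d) * 0) at_top"
      by (intro tendsto_intros ak k\<nu>)
    moreover have "\<forall>\<^sub>F k in at_top. (a k)\<^sup>2 / k * (k * (1 / \<nu> k)\<^sup>2) = (a k)\<^sup>2 * (1 / \<nu> k)\<^sup>2"
      using eventually_gt_at_top[of 0] by eventually_elim simp
    ultimately show ?thesis by (simp add: Lim_transform_eventually)
  qed
  have inv_a: "((\<lambda>k. 1 / (a k)\<^sup>2) \<longlongrightarrow> 0) at_top"
  proof -
    have "((\<lambda>y::real. 1 / y\<^sup>2) \<longlongrightarrow> 0) at_top" by real_asymp
    then show ?thesis by (rule filterlim_compose[OF _ ainf])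
  qed
  define R where "R = (\<lambda>k. d\<^sup>2 * (b\<^sup>2 * (1 / \<nu> k)\<^sup>2) + d * (2 * ((sqrt 3 - 1)\<^sup>2 * ((a k)\<^sup>2 * (1 / \<nu> k)\<^sup>2)) + 16 / (3 * q ^ CARD('d)) * (1 / (a k)\<^sup>2)))"
  have "(R \<longlongrightarrow> d\<^sup>2 * (b\<^sup>2 * 0\<^sup>2) + d * (2 * ((sqrt 3 - 1)\<^sup>2 * 0) + 16 / (3 * q ^ CARD('d)) * 0)) at_top"
    unfolding R_def by (intro tendsto_add tendsto_mult tendsto_const tendsto_power \<nu>0 a\<nu> inv_a)
  then have R: "(R \<longlongrightarrow> 0) at_top" by simp
  define B where "B = (\<lambda>k. k / (a k - d\<^sup>2 * b)\<^sup>2 * d * (1 - (norm \<alpha>)\<^sup>2 + R k))"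
  have "(B \<longlongrightarrow> d / (2 * ln 2) * d * (1 - (norm \<alpha>)\<^sup>2 + 0)) at_top"
    unfolding B_def by (intro tendsto_intros kg R)
  then have Blim: "(B \<longlongrightarrow> (1 - (norm \<alpha>)\<^sup>2) * (real CARD('d))\<^sup>2 / (2 * ln 2)) at_top"
    by (simp add: d_def[symmetric] power2_eq_square mult_ac)
  have "\<forall>\<^sub>F k in at_top. k \<in> admissible_bits CARD('d) \<longrightarrow>
      ennreal k * mse M (\<lambda>\<omega>. stopping_estimator e \<Sigma> b (\<theta> k) k (\<lambda>i. Xs i \<omega>) (\<lambda>i. Ys i \<omega>)) \<rho> \<le> ennreal (B k)"
    using apos
  proof (eventually_elim, intro impI)
    fix k assume ak: "a k > d\<^sup>2 * b + 1" and adm: "k \<in> admissible_bits CARD('d)"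
    obtain m :: nat where m: "m > 0" "quant_bits CARD('d) k = real m" and k: "k > 0"
      using adm by (auto simp: admissible_bits_def)
    define n :: nat where "n = 2 ^ (m - 1)"
    have n: "n > 0" "2 ^ nat \<lfloor>quant_bits CARD('d) k\<rfloor> = 2 * n" using m by (auto simp: n_def power_Suc[symmetric] simp del: power_Suc)
    have \<nu>n: "\<nu> k = real n" using m by (simp add: \<nu>_def n_def powr_realpow[symmetric] of_nat_diff)
    have "d\<^sup>2 * b \<ge> 0" using b by simp
    then have a1: "a k > d\<^sup>2 * b" "a k > 1" using ak by linarith+
    have s3: "1 < sqrt 3" by simp
    have ac: "a k < sqrt 3 * a k" using s3 a1 by simp
    have c1: "1 \<le> sqrt 3 * a k" using ac a1 by linarith
    have mse: "mse M (\<lambda>\<omega>. stopping_estimator e \<Sigma> b (\<theta> k) k (\<lambda>i. Xs i \<omega>) (\<lambda>i. Ys i \<omega>)) \<rho>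
      \<le> ennreal (d / (a k - d\<^sup>2 * b)\<^sup>2 * (1 - (norm \<alpha>)\<^sup>2
     + d\<^sup>2 * (b / n)\<^sup>2 + d * (2 * ((sqrt 3 * a k - a k) / n)\<^sup>2 + 16 / ((sqrt 3 * a k)\<^sup>2 * (1 - 2 * Qfun b) ^ CARD('d)))))"
      using stopping_error[OF e b a1(1)[unfolded d_def] c1 ac n(1) \<theta>[of k]]
      unfolding stopping_estimator_def n(2) S[symmetric] T_def[symmetric] a_def[symmetric] d_def[symmetric] Let_def .
    have "ennreal k * mse M (\<lambda>\<omega>. stopping_estimator e \<Sigma> b (\<theta> k) k (\<lambda>i. Xs i \<omega>) (\<lambda>i. Ys i \<omega>)) \<rho>
      \<le> ennreal k * ennreal (d / (a k - d\<^sup>2 * b)\<^sup>2 * (1 - (norm \<alpha>)\<^sup>2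
     + d\<^sup>2 * (b / n)\<^sup>2 + d * (2 * ((sqrt 3 * a k - a k) / n)\<^sup>2 + 16 / ((sqrt 3 * a k)\<^sup>2 * (1 - 2 * Qfun b) ^ CARD('d)))))"
      by (rule mult_left_mono[OF mse]) simp
    also have "\<dots> = ennreal (k * (d / (a k - d\<^sup>2 * b)\<^sup>2 * (1 - (norm \<alpha>)\<^sup>2
     + d\<^sup>2 * (b / n)\<^sup>2 + d * (2 * ((sqrt 3 * a k - a k) / n)\<^sup>2 + 16 / ((sqrt 3 * a k)\<^sup>2 * (1 - 2 * Qfun b) ^ CARD('d))))))"
      using k by (intro ennreal_mult'[symmetric]) simp
    also have "\<dots> = ennreal (B k)"
    proof -
      have "(sqrt 3 * a k - a k) / n = (sqrt 3 - 1) * (a k * (1 / \<nu> k))" by (simp add: \<nu>n algebra_simps diff_divide_distrib)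
      then have 1: "((sqrt 3 * a k - a k) / n)\<^sup>2 = (sqrt 3 - 1)\<^sup>2 * ((a k)\<^sup>2 * (1 / \<nu> k)\<^sup>2)" by (simp only: power_mult_distrib)
      have 2: "(b / n)\<^sup>2 = b\<^sup>2 * (1 / \<nu> k)\<^sup>2" by (simp add: \<nu>n power_divide)
      have 3: "16 / ((sqrt 3 * a k)\<^sup>2 * (1 - 2 * Qfun b) ^ CARD('d)) = 16 / (3 * q ^ CARD('d)) * (1 / (a k)\<^sup>2)"
        by (simp add: power_mult_distrib q_def)
      show ?thesis unfolding 1 2 3 B_def R_def by (simp add: mult_ac add_ac)
    qed
    finally show "ennreal k * mse M (\<lambda>\<omega>. stopping_estimator e \<Sigma> b (\<theta> k) k (\<lambda>i. Xs i \<omega>) (\<lambda>i. Ys i \<omega>)) \<rho> \<le> ennreal (B k)" .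
  qed
  with Blim show ?thesis by (rule that)
qed

end

section \<open>Measurability, the covariance matrix and the weights\<close>

context sampling
begin

lemma measurable_scalar_estimate:
  assumes s: "range s \<subseteq> {1..}"
  shows "(\<lambda>\<omega>. Ys (s (scalar_index meth \<kappa> (\<lambda>j. Xs (s j) \<omega> $ l))) \<omega>) \<in> borel_measurable M"
proof (rule measurable_compose_countable[where f = "\<lambda>j. Ys (s j)"])
  have M: "(\<lambda>\<omega>. Xs (s j) \<omega> $ l) \<in> borel_measurable M" "Ys (s j) \<in> borel_measurable M" for j
  proof -
    interpret centered_gaussian M "\<lambda>\<omega>. (Xs (s j) \<omega>, Ys (s j) \<omega>)" using gauss s by auto
    have "(\<lambda>\<omega>. (axis l 1, 0) \<bullet> (Xs (s j) \<omega>, Ys (s j) \<omega>)) \<in> borel_measurable M"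
      "(\<lambda>\<omega>. (0, 1) \<bullet> (Xs (s j) \<omega>, Ys (s j) \<omega>)) \<in> borel_measurable M" by measurable
    then show "(\<lambda>\<omega>. Xs (s j) \<omega> $ l) \<in> borel_measurable M" "Ys (s j) \<in> borel_measurable M" by (simp_all add: inner_axis')
  qed
  note [measurable] = M(1)
  show "Ys (s j) \<in> borel_measurable M" for j by (rule M(2))
  show "(\<lambda>\<omega>. scalar_index meth \<kappa> (\<lambda>j. Xs (s j) \<omega> $ l)) \<in> measurable M (count_space UNIV)"
    unfolding scalar_index_def by (cases meth) (simp_all add: threshold_index_def max_index_def)
qed

text \<open>The form is the variance of the functional v of X. If it vanishes, this functional is 0
  almost surely, so all its covariances vanish, that is \<Sigma> v = 0, against
  invertibility.\<close>

lemma positive_definite: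
  assumes inv: "invertible \<Sigma>" and v: "v \<noteq> 0"
  shows "0 < v \<bullet> (\<Sigma> *v v)"
proof -
  interpret g: centered_gaussian M "\<lambda>\<omega>. (Xs 1 \<omega>, Ys 1 \<omega>)" using gauss by simp
  define f where "f = (\<lambda>u \<omega>. (u, 0) \<bullet> (Xs 1 \<omega>, Ys 1 \<omega>))"
  have cov': "(\<integral>\<omega>. f u \<omega> * f u' \<omega> \<partial>M) = u \<bullet> (\<Sigma> *v u')" for u u'
    unfolding f_def covariance[OF order_refl] by simp
  have int: "integrable M (\<lambda>\<omega>. f u \<omega> * f u' \<omega>)" for u u' unfolding f_def by (rule g.integrable_prod)
  have "v \<bullet> (\<Sigma> *v v) \<ge> 0" unfolding cov'[symmetric] by (intro integral_nonneg_AE) simp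
  moreover have "v \<bullet> (\<Sigma> *v v) \<noteq> 0"
  proof
    assume "v \<bullet> (\<Sigma> *v v) = 0"
    then have "(\<integral>\<omega>. f v \<omega> * f v \<omega> \<partial>M) = 0" by (simp only: cov')
    then have AE0: "AE \<omega> in M. f v \<omega> * f v \<omega> = 0"
      using integral_nonneg_eq_0_iff_AE[OF int[of v v]] by simp
    have "u \<bullet> (\<Sigma> *v v) = 0" for u
    proof -
      have [measurable]: "f u \<in> borel_measurable M" for u unfolding f_def by measurable
      have "(\<integral>\<omega>. f u \<omega> * f v \<omega> \<partial>M) = (\<integral>\<omega>. 0 \<partial>M)"
        by (rule integral_cong_AE) (use AE0 in \<open>auto elim!: eventually_mono\<close>)
      then show ?thesis by (simp add: cov')
    qed
    then have "\<Sigma> *v v = 0" by (metis inner_eq_zero_iff)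
    then show False using v inv by (metis invertible_left_inverse matrix_left_invertible_ker)
  qed
  ultimately show ?thesis by simp
qed

lemma symmetric_covariance: "transpose \<Sigma> = \<Sigma>"
  by (simp add: vec_eq_iff transpose_def cov(1)[OF order_refl, symmetric] mult.commute)

end

lemma (in prob_space) gaussian_rv_distr_cong:
  assumes g: "gaussian_rv M \<mu> \<sigma> Z" and Z': "Z' \<in> borel_measurable M" and eq: "distr M borel Z' = distr M borel Z"
  shows "gaussian_rv M \<mu> \<sigma> Z'"
proof -
  have Z: "Z \<in> borel_measurable M" using g by (simp add: gaussian_rv_def)
  have "AE \<omega> in M. Z' \<omega> = \<mu>" if "AE \<omega> in M. Z \<omega> = \<mu>"
  proof -
    have "AE x in distr M borel Z. x = \<mu>" using that Z by (subst AE_distr_iff) auto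
    then have "AE x in distr M borel Z'. x = \<mu>" by (simp only: eq)
    then show ?thesis using Z' by (subst (asm) AE_distr_iff) auto
  qed
  moreover have "distributed M lborel Z' (normal_density \<mu> \<sigma>)" if "distributed M lborel Z (normal_density \<mu> \<sigma>)"
  proof -
    have "distr M lborel Z' = distr M borel Z'" "distr M lborel Z = distr M borel Z" by (rule distr_cong; simp)+
    then show ?thesis using that Z' eq by (simp add: distributed_def)
  qed
  ultimately show ?thesis using g Z' unfolding gaussian_rv_def by blast
qed

text \<open>Tangent of 1/w at w = 1/d: (1 - d w)^2 >= 0 gives 1/w >= 2 d - d^2 w. Summing with total
  weight 1 leaves 2 d^2 - d^2, with equality for uniform weights.\<close>

lemma harmonic_weights:
  fixes wt :: "'d::finite \<Rightarrow> real"
  assumes "\<And>l. wt l > 0" "(\<Sum>l\<in>UNIV. wt l) = 1"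
  shows "(real CARD('d))\<^sup>2 \<le> (\<Sum>l\<in>UNIV. 1 / wt l)"
proof -
  define d where "d = real CARD('d)"
  have "2 * d - d\<^sup>2 * wt l \<le> 1 / wt l" for l
  proof -
    have "0 \<le> (1 - d * wt l)\<^sup>2 / wt l" using assms(1)[of l] by simp
    also have "\<dots> = 1 / wt l - 2 * d + d\<^sup>2 * wt l" using assms(1)[of l] by (simp add: power2_eq_square field_simps)
    finally show ?thesis by simp
  qed
  then have "(\<Sum>l\<in>(UNIV::'d set). 2 * d - d\<^sup>2 * wt l) \<le> (\<Sum>l\<in>UNIV. 1 / wt l)" by (intro sum_mono)
  then show ?thesis
    by (simp add: sum_subtractf sum_distrib_left[symmetric] assms(2) d_def power2_eq_square)
qed

subsection \<open>Comparison of the estimators\<close>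

text \<open>Apart from independence, every requirement of the locale concerns the law of a single
  sample, so it transfers from (X, Y) to each copy.\<close>

lemma sampling_iid_copies:
  fixes X :: "'a \<Rightarrow> real ^ 'd" and Y :: "'a \<Rightarrow> real"
  assumes M: "prob_space M" and gauss: "jointly_gaussian M (\<lambda>\<omega>. (X \<omega>, Y \<omega>))"
    and Y: "distributed M lborel Y std_normal_density" and X: "normal_vector M 0 \<Sigma> X"
    and diag: "\<forall>i. \<Sigma> $ i $ i = 1" and \<rho>: "\<rho> = (\<chi> l. \<integral>\<omega>. Y \<omega> * X \<omega> $ l \<partial>M)"
    and iid: "iid_copies M (\<lambda>\<omega>. (X \<omega>, Y \<omega>)) (\<lambda>i \<omega>. (Xs i \<omega>, Ys i \<omega>))"
  shows "sampling M Xs Ys \<Sigma> \<rho>"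
proof -
  interpret prob_space M by fact
  have XYM: "(\<lambda>\<omega>. (X \<omega>, Y \<omega>)) \<in> borel_measurable M" using gauss by (simp add: jointly_gaussian_def)
  have ind: "indep_vars (\<lambda>_. borel) (\<lambda>i \<omega>. (Xs i \<omega>, Ys i \<omega>)) {1..}" using iid by (simp add: iid_copies_def)
  have VM: "(\<lambda>\<omega>. (Xs i \<omega>, Ys i \<omega>)) \<in> borel_measurable M" if "i \<ge> 1" for i
    using ind that unfolding indep_vars_def2 by auto
  have eqd: "distr M borel (\<lambda>\<omega>. (Xs i \<omega>, Ys i \<omega>)) = distr M borel (\<lambda>\<omega>. (X \<omega>, Y \<omega>))" if "i \<ge> 1" for i
    using iid that by (simp add: iid_copies_def)
  have transfer: "(\<integral>\<omega>. h (Xs i \<omega>, Ys i \<omega>) \<partial>M) = (\<integral>\<omega>. h (X \<omega>, Y \<omega>) \<partial>M)"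
    if i: "i \<ge> 1" and h: "h \<in> borel_measurable borel" for h :: "(real^'d) \<times> real \<Rightarrow> real" and i
  proof -
    have "(\<integral>\<omega>. h (Xs i \<omega>, Ys i \<omega>) \<partial>M) = (\<integral>z. h z \<partial>distr M borel (\<lambda>\<omega>. (Xs i \<omega>, Ys i \<omega>)))"
      by (rule integral_distr[OF VM[OF i] h, symmetric])
    also have "\<dots> = (\<integral>\<omega>. h (X \<omega>, Y \<omega>) \<partial>M)" unfolding eqd[OF i] by (rule integral_distr[OF XYM h])
    finally show ?thesis .
  qed
  have gi: "\<exists>\<mu> \<sigma>. gaussian_rv M \<mu> \<sigma> (\<lambda>\<omega>. u \<bullet> (X \<omega>, Y \<omega>))" for u
    using gauss unfolding jointly_gaussian_def by blast
  have EX: "integrable M (\<lambda>\<omega>. X \<omega> $ j)" "(\<integral>\<omega>. X \<omega> $ j \<partial>M) = 0" for j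
  proof -
    obtain \<mu> \<sigma> where g: "gaussian_rv M \<mu> \<sigma> (\<lambda>\<omega>. (axis j 1, 0) \<bullet> (X \<omega>, Y \<omega>))" using gi by blast
    have "(\<lambda>\<omega>. (axis j 1, 0) \<bullet> (X \<omega>, Y \<omega>)) = (\<lambda>\<omega>. X \<omega> $ j)" by (simp add: inner_axis')
    then have "gaussian_rv M \<mu> \<sigma> (\<lambda>\<omega>. X \<omega> $ j)" using g by simp
    then show "integrable M (\<lambda>\<omega>. X \<omega> $ j)"
      using square_integrable_imp_integrable gaussian_rv_moments(1) by (auto simp: gaussian_rv_def)
    show "(\<integral>\<omega>. X \<omega> $ j \<partial>M) = 0" using X by (simp add: normal_vector_def)
  qed
  have gY: "gaussian_rv M 0 1 Y" using Y by (auto simp: gaussian_rv_def distributed_def cong: measurable_cong_sets)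
  have EY: "integrable M Y" "(\<integral>\<omega>. Y \<omega> \<partial>M) = 0" "(\<integral>\<omega>. (Y \<omega>)\<^sup>2 \<partial>M) = 1"
  proof -
    have "Y \<in> borel_measurable M" using gY by (simp add: gaussian_rv_def)
    then show "integrable M Y" using square_integrable_imp_integrable gaussian_rv_moments(1)[OF gY] by blast
    show "(\<integral>\<omega>. Y \<omega> \<partial>M) = 0" "(\<integral>\<omega>. (Y \<omega>)\<^sup>2 \<partial>M) = 1" using gaussian_rv_moments(2,3)[OF gY] by simp_all
  qed
  have lin: "(\<lambda>z::(real^'d) \<times> real. u \<bullet> z) \<in> borel_measurable borel" for u
    by (intro borel_measurable_continuous_onI continuous_intros)
  show ?thesis
  proof (rule sampling.intro[OF prob_space_axioms sampling_axioms.intro])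
    show "indep_vars (\<lambda>_. borel) (\<lambda>i \<omega>. (Xs i \<omega>, Ys i \<omega>)) {1..}" by (rule ind)
    show "\<Sigma> $ l $ l = 1" for l using diag by simp
    fix i :: nat assume i: "i \<ge> 1"
    show "centered_gaussian M (\<lambda>\<omega>. (Xs i \<omega>, Ys i \<omega>))"
    proof
      show "jointly_gaussian M (\<lambda>\<omega>. (Xs i \<omega>, Ys i \<omega>))"
        unfolding jointly_gaussian_def
      proof (intro conjI VM[OF i] allI)
        fix u
        obtain \<mu> \<sigma> where g: "gaussian_rv M \<mu> \<sigma> (\<lambda>\<omega>. u \<bullet> (X \<omega>, Y \<omega>))" using gi by blast
        have "gaussian_rv M \<mu> \<sigma> (\<lambda>\<omega>. u \<bullet> (Xs i \<omega>, Ys i \<omega>))"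
        proof (rule gaussian_rv_distr_cong[OF g])
          show "(\<lambda>\<omega>. u \<bullet> (Xs i \<omega>, Ys i \<omega>)) \<in> borel_measurable M" by (rule measurable_compose[OF VM[OF i] lin])
          have "distr M borel (\<lambda>\<omega>. u \<bullet> (Xs i \<omega>, Ys i \<omega>)) = distr (distr M borel (\<lambda>\<omega>. (Xs i \<omega>, Ys i \<omega>))) borel (\<lambda>z. u \<bullet> z)"
            by (subst distr_distr[OF lin VM[OF i]]) (simp only: comp_def)
          also have "\<dots> = distr M borel (\<lambda>\<omega>. u \<bullet> (X \<omega>, Y \<omega>))"
            unfolding eqd[OF i] by (subst distr_distr[OF lin XYM]) (simp only: comp_def)
          finally show "distr M borel (\<lambda>\<omega>. u \<bullet> (Xs i \<omega>, Ys i \<omega>)) = distr M borel (\<lambda>\<omega>. u \<bullet> (X \<omega>, Y \<omega>))" .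
        qed
        then show "\<exists>\<mu> \<sigma>. gaussian_rv M \<mu> \<sigma> (\<lambda>\<omega>. u \<bullet> (Xs i \<omega>, Ys i \<omega>))" by blast
      qed
      fix u :: "(real^'d) \<times> real"
      have "(\<integral>\<omega>. u \<bullet> (Xs i \<omega>, Ys i \<omega>) \<partial>M) = (\<integral>\<omega>. u \<bullet> (X \<omega>, Y \<omega>) \<partial>M)" by (rule transfer[OF i lin])
      also have "\<dots> = (\<integral>\<omega>. (\<Sum>j\<in>UNIV. fst u $ j * X \<omega> $ j) + snd u * Y \<omega> \<partial>M)"
        by (cases u) (simp add: inner_vec_def)
      also have "\<dots> = 0" using EX EY by simp
      finally show "(\<integral>\<omega>. u \<bullet> (Xs i \<omega>, Ys i \<omega>) \<partial>M) = 0" .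
    qed
    show "(\<integral>\<omega>. Xs i \<omega> $ a * Xs i \<omega> $ b \<partial>M) = \<Sigma> $ a $ b" for a b
    proof -
      have "(\<integral>\<omega>. Xs i \<omega> $ a * Xs i \<omega> $ b \<partial>M) = (\<integral>\<omega>. X \<omega> $ a * X \<omega> $ b \<partial>M)"
        using transfer[OF i, of "\<lambda>z. fst z $ a * fst z $ b"] by (simp add: borel_measurable_continuous_onI continuous_intros)
      then show ?thesis using X by (simp add: normal_vector_def)
    qed
    show "(\<integral>\<omega>. Ys i \<omega> * Xs i \<omega> $ l \<partial>M) = \<rho> $ l" for l
      using transfer[OF i, of "\<lambda>z. snd z * fst z $ l"] by (simp add: \<rho> borel_measurable_continuous_onI continuous_intros)
    show "(\<integral>\<omega>. (Ys i \<omega>)\<^sup>2 \<partial>M) = 1"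
      using transfer[OF i, of "\<lambda>z. (snd z)\<^sup>2"] EY(3) by (simp add: borel_measurable_continuous_onI continuous_intros)
  qed
qed

context sampling
begin

text \<open>The squared norm is a sum over coordinates, so the one-coordinate limits add; the sum is
  taken among the real functions provided by \<open>scalar_limit\<close>.\<close>

lemma scalar_estimator_limit:
  fixes wt :: "'d \<Rightarrow> real" and s :: "real \<Rightarrow> 'd \<Rightarrow> nat \<Rightarrow> nat"
  assumes wt: "\<And>l. wt l > 0" and s: "\<And>k. disjoint_samples (s k)"
  shows "((\<lambda>k. ennreal k * mse M (scalar_estimator M meth wt (s k) Xs Ys k) \<rho>) \<longlongrightarrow>
    ennreal (\<Sum>l\<in>UNIV. (1 - (\<rho> $ l)\<^sup>2) / (2 * ln 2 * wt l))) at_top"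
proof -
  have s': "strict_mono (s k l)" "range (s k l) \<subseteq> {1..}" for k l using s[of k] by (auto simp: disjoint_samples_def)
  define J where "J = (\<lambda>k l \<omega>. s k l (scalar_index (meth l) (wt l * k) (\<lambda>j. Xs (s k l j) \<omega> $ l)))"
  define I where "I = (\<lambda>k l. \<integral>\<^sup>+\<omega>. ennreal ((Ys (J k l \<omega>) \<omega> / (\<integral>\<omega>'. Xs (J k l \<omega>') \<omega>' $ l \<partial>M) - \<rho> $ l)\<^sup>2) \<partial>M)"
  have "\<forall>l. \<exists>f. (f \<longlongrightarrow> (1 - (\<rho> $ l)\<^sup>2) / (2 * ln 2 * wt l)) at_top \<and> (\<forall>\<^sub>F k in at_top. f k \<ge> 0 \<and> ennreal k * I k l = ennreal (f k))"
    using scalar_limit[OF s' wt] by (simp add: I_def J_def Let_def)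
  from choice[OF this] obtain f where f: "\<And>l. (f l \<longlongrightarrow> (1 - (\<rho> $ l)\<^sup>2) / (2 * ln 2 * wt l)) at_top"
    "\<And>l. \<forall>\<^sub>F k in at_top. f l k \<ge> 0 \<and> ennreal k * I k l = ennreal (f l k)" by blast
  have mse: "mse M (scalar_estimator M meth wt (s k) Xs Ys k) \<rho> = (\<Sum>l\<in>UNIV. I k l)" for k
  proof -
    have "mse M (scalar_estimator M meth wt (s k) Xs Ys k) \<rho> =
      (\<integral>\<^sup>+\<omega>. (\<Sum>l\<in>UNIV. ennreal ((Ys (J k l \<omega>) \<omega> / (\<integral>\<omega>'. Xs (J k l \<omega>') \<omega>' $ l \<partial>M) - \<rho> $ l)\<^sup>2)) \<partial>M)"
      unfolding mse_def norm_vec_square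
      by (intro nn_integral_cong) (simp add: scalar_estimator_def Let_def scalar_sample_def J_def)
    also have "\<dots> = (\<Sum>l\<in>UNIV. I k l)"
      unfolding I_def
    proof (rule nn_integral_sum)
      fix l
      have [measurable]: "(\<lambda>\<omega>. Ys (J k l \<omega>) \<omega>) \<in> borel_measurable M"
        unfolding J_def by (rule measurable_scalar_estimate[OF s'(2)])
      show "(\<lambda>\<omega>. ennreal ((Ys (J k l \<omega>) \<omega> / (\<integral>\<omega>'. Xs (J k l \<omega>') \<omega>' $ l \<partial>M) - \<rho> $ l)\<^sup>2)) \<in> borel_measurable M"
        by measurable
    qed
    finally show ?thesis .
  qed
  have "((\<lambda>k. ennreal (\<Sum>l\<in>UNIV. f l k)) \<longlongrightarrow> ennreal (\<Sum>l\<in>UNIV. (1 - (\<rho> $ l)\<^sup>2) / (2 * ln 2 * wt l))) at_top"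
    by (intro tendsto_ennrealI tendsto_sum f(1))
  moreover have "\<forall>\<^sub>F k in at_top. ennreal (\<Sum>l\<in>UNIV. f l k) = ennreal k * mse M (scalar_estimator M meth wt (s k) Xs Ys k) \<rho>"
  proof -
    have "\<forall>\<^sub>F k in at_top. \<forall>l\<in>UNIV. f l k \<ge> 0 \<and> ennreal k * I k l = ennreal (f l k)"
      by (intro eventually_ball_finite ballI f(2)) simp
    then show ?thesis by eventually_elim (simp add: mse sum_distrib_left)
  qed
  ultimately show ?thesis by (rule Lim_transform_eventually)
qed

end

text \<open>The scalar errors converge along all real k, while the limsup runs over admissible k
  only, which the restricted filter expresses. A real L states that the scalar limit exists and is
  finite.\<close>

theorem corollary1:
  fixes M :: "'a measure"
    and X :: "'a \<Rightarrow> real ^ 'd" and Y :: "'a \<Rightarrow> real"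
    and Xs :: "nat \<Rightarrow> 'a \<Rightarrow> real ^ 'd" and Ys :: "nat \<Rightarrow> 'a \<Rightarrow> real"
    and \<Sigma> :: "real ^ 'd ^ 'd" and \<rho> :: "real ^ 'd"
    and e :: "nat \<Rightarrow> 'd" and b0 :: real
    and \<theta> :: "real \<Rightarrow> 'd \<Rightarrow> 'd \<Rightarrow> nat \<Rightarrow> real"
    and wt :: "'d \<Rightarrow> real" and meth :: "'d \<Rightarrow> scalar_method"
    and s :: "real \<Rightarrow> 'd \<Rightarrow> nat \<Rightarrow> nat"
  assumes "prob_space M"
    and "jointly_gaussian M (\<lambda>\<omega>. (X \<omega>, Y \<omega>))"
    and "distributed M lborel Y std_normal_density"
    and "normal_vector M 0 \<Sigma> X"
    and "invertible \<Sigma>" and "\<forall>i. \<Sigma> $ i $ i = 1"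
    and "\<rho> = (\<chi> l. \<integral>\<omega>. Y \<omega> * X \<omega> $ l \<partial>M)"
    and "iid_copies M (\<lambda>\<omega>. (X \<omega>, Y \<omega>)) (\<lambda>i \<omega>. (Xs i \<omega>, Ys i \<omega>))"
    and "bij_betw e {1..CARD('d)} UNIV"
    and "b0 > 0"
    and "\<forall>k i j n. 0 \<le> \<theta> k i j n \<and> \<theta> k i j n \<le> 1"
    and "\<forall>l. wt l > 0" and "(\<Sum>l\<in>UNIV. wt l) = 1"
    and "\<forall>k. disjoint_samples (s k)"
  shows "\<exists>L::real.
    ((\<lambda>k. ennreal k * mse M (scalar_estimator M meth wt (s k) Xs Ys k) \<rho>) \<longlongrightarrow> ennreal L) at_top \<and>
    Limsup (inf at_top (principal (admissible_bits CARD('d))))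
      (\<lambda>k. ennreal k *
         mse M (\<lambda>\<omega>. stopping_estimator e \<Sigma> b0 (\<theta> k) k (\<lambda>i. Xs i \<omega>) (\<lambda>i. Ys i \<omega>)) \<rho>)
    \<le> ennreal L"
proof -
  interpret sampling M Xs Ys \<Sigma> \<rho>
    by (rule sampling_iid_copies[OF assms(1-4,6-8)])
  note root = sqrt_mat[OF symmetric_covariance positive_definite[OF assms(5)]]
  interpret whitened_sampling M Xs Ys \<Sigma> \<rho> "sqrt_mat \<Sigma>"
    by unfold_locales (use root assms(5) in auto)
  define L where "L = (\<Sum>l\<in>UNIV. (1 - (\<rho> $ l)\<^sup>2) / (2 * ln 2 * wt l))"
  define K where "K = (1 - (norm \<alpha>)\<^sup>2) * (real CARD('d))\<^sup>2 / (2 * ln 2)"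
  have lim: "((\<lambda>k. ennreal k * mse M (scalar_estimator M meth wt (s k) Xs Ys k) \<rho>) \<longlongrightarrow> ennreal L) at_top"
    unfolding L_def using assms(12,14) by (intro scalar_estimator_limit) auto
  \<comment> \<open>The weights are treated before the correlations, while the common factor 1 -
    |\<alpha>|^2 >= 0 can still be pulled out of the sum.\<close>
  have KL: "K \<le> L"
  proof -
    have "K \<le> (1 - (norm \<alpha>)\<^sup>2) * (\<Sum>l\<in>UNIV. 1 / wt l) / (2 * ln 2)"
      unfolding K_def using harmonic_weights[of wt] assms(12,13) alpha_le_1
      by (intro divide_right_mono mult_left_mono) auto
    also have "\<dots> = (\<Sum>l\<in>UNIV. (1 - (norm \<alpha>)\<^sup>2) / (2 * ln 2 * wt l))"
      unfolding sum_distrib_left sum_divide_distrib by (intro sum.cong refl) (simp add: mult.commute)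
    also have "\<dots> \<le> L"
      unfolding L_def using assms(12) rho_le_alpha by (intro sum_mono divide_right_mono) (auto intro: less_imp_le)
    finally show ?thesis .
  qed
  obtain B where B: "(B \<longlongrightarrow> K) at_top"
    "\<forall>\<^sub>F k in at_top. k \<in> admissible_bits CARD('d) \<longrightarrow>
      ennreal k * mse M (\<lambda>\<omega>. stopping_estimator e \<Sigma> b0 (\<theta> k) k (\<lambda>i. Xs i \<omega>) (\<lambda>i. Ys i \<omega>)) \<rho> \<le> ennreal (B k)"
    unfolding K_def by (rule stopping_limit[of e b0 \<theta>]) (use assms(9-11) in auto)
  have "Limsup (inf at_top (principal (admissible_bits CARD('d))))
      (\<lambda>k. ennreal k * mse M (\<lambda>\<omega>. stopping_estimator e \<Sigma> b0 (\<theta> k) k (\<lambda>i. Xs i \<omega>) (\<lambda>i. Ys i \<omega>)) \<rho>) \<le> ennreal L"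
    unfolding Limsup_le_iff
  proof (intro allI impI)
    fix y assume "ennreal L < y"
    then have "ennreal K < y" using ennreal_leI[OF KL] by (rule le_less_trans[rotated])
    then have "\<forall>\<^sub>F k in at_top. ennreal (B k) < y" using tendsto_ennrealI[OF B(1)] by (rule order_tendstoD(2)[rotated])
    with B(2) show "\<forall>\<^sub>F k in inf at_top (principal (admissible_bits CARD('d))).
        ennreal k * mse M (\<lambda>\<omega>. stopping_estimator e \<Sigma> b0 (\<theta> k) k (\<lambda>i. Xs i \<omega>) (\<lambda>i. Ys i \<omega>)) \<rho> < y"
      unfolding eventually_inf_principal by eventually_elim (auto intro: le_less_trans)
  qed
  with lim show ?thesis by blast
qed

end
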